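(* Let $(Q,\mathfrak{n},k)$ be a local ring, $x\in\mathfrak{n}$ a non-zerodivisor of $Q$, and $R=Q/(x)$. Let $M$ be a finitely generated non-zero $R$-module. Suppose that $N$ is an $R$-module which is pre-rigid of degree $0$ with respect to $M$ and $Q$. If $\operatorname{Tor}^R_n(M,N)$ has finite length for some $n\ge 0$, then $\operatorname{Tor}^Q_{n-2i}(M,N)$ has finite length for all $i\ge 0$, and $$\operatorname{length}\operatorname{Tor}^R_n(M,N)=\sum_{i\ge 0}\operatorname{length}\operatorname{Tor}^Q_{n-2i}(M,N).$$
   Context: "Local ring" means commutative Noetherian local ring. $\operatorname{Tor}_m=0$ for $m<0$. Higher homotopies: let $F$ be a $Q$-free resolution of $M$. A system of higher homotopies on $F$ is a family $\{\sigma_i\}_{i\ge 0}$ where each $\sigma_i$ is a degree $2i-1$ endomorphism of $F$ as a graded $Q$-module, with $\sigma_0=\partial^F$ (the differential of $F$), $\sigma_0\sigma_1+\sigma_1\sigma_0=x\operatorname{Id}_F$, and $\sum_{i+j=n}\sigma_i\sigma_j=0$ for $n>1$. The component of $\sigma_i$ from $F_j$ to $F_{j+2i-1}$ is denoted $(\sigma_i)_j$. Pre-rigidity: an $R$-module $N$ is pre-rigid of degree $r$ with respect to $M$ and $Q$ if there exist a $Q$-free resolution $F$ of $M$ and a system of higher homotopies $\{\sigma_i\}_{i\ge 0}$ on $F$ such that the induced maps $(\sigma_i)_j\otimes_Q N: F_j\otimes_Q N \to F_{j+2i-1}\otimes_Q N$ are zero for all $j>r-(2i-1)$ and all $i\ge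 1$. *)

theory Defs
  imports
    "HOL-Algebra.Module" "HOL-Algebra.QuotRing" "HOL-Algebra.Ring_Divisibility"
    "HOL-Library.FSet" "HOL-Library.Extended_Real"
begin

section \<open>Rings\<close>

locale noetherian_local_ring = cring R + noetherian_ring R for R (structure) +
  fixes \<nn>
  assumes maximal: "maximalideal \<nn> R"
    and unique_maximal: "maximalideal J R \<Longrightarrow> J = \<nn>"

definition non_zerodivisor :: "('r, 'z) ring_scheme \<Rightarrow> 'r \<Rightarrow> bool" where
  "non_zerodivisor R x \<longleftrightarrow> x \<in> carrier R \<and>
     (\<forall>a \<in> carrier R. x \<otimes>\<^bsub>R\<^esub> a = \<zero>\<^bsub>R\<^esub> \<longrightarrow> a = \<zero>\<^bsub>R\<^esub>)"


section \<open>Modules\<close>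

text \<open>Module records inherit the fields \<open>mult\<close> and \<open>one\<close> from rings.  They carry no meaning for
  a module and are left \<open>undefined\<close> in the constructions below.\<close>

definition mod_hom ::
  "('r, 'z) ring_scheme \<Rightarrow> ('r, 'a) module \<Rightarrow> ('r, 'b) module \<Rightarrow> ('a \<Rightarrow> 'b) set" where
  "mod_hom R M N = {h \<in> carrier M \<rightarrow> carrier N.
     (\<forall>u \<in> carrier M. \<forall>v \<in> carrier M. h (u \<oplus>\<^bsub>M\<^esub> v) = h u \<oplus>\<^bsub>N\<^esub> h v) \<and>
     (\<forall>a \<in> carrier R. \<forall>u \<in> carrier M. h (a \<odot>\<^bsub>M\<^esub> u) = a \<odot>\<^bsub>N\<^esub> h u)}"

definition mod_span :: "('r, 'z) ring_scheme \<Rightarrow> ('r, 'a) module \<Rightarrow> 'a set \<Rightarrow> 'a set" where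
  "mod_span R M A = \<Inter>{H. submodule H R M \<and> A \<subseteq> H}"

definition finitely_generated :: "('r, 'z) ring_scheme \<Rightarrow> ('r, 'a) module \<Rightarrow> bool" where
  "finitely_generated R M \<longleftrightarrow> (\<exists>A \<subseteq> carrier M. finite A \<and> mod_span R M A = carrier M)"

definition quotient_module ::
  "('r, 'z) ring_scheme \<Rightarrow> ('r, 'a) module \<Rightarrow> 'a set \<Rightarrow> ('r, 'a set) module" where
  "quotient_module R M H =
     \<lparr>carrier = a_rcosets\<^bsub>M\<^esub> H, mult = undefined, one = undefined, zero = H, add = set_add M,
      smult = (\<lambda>a U. \<Union>u\<in>U. H +>\<^bsub>M\<^esub> (a \<odot>\<^bsub>M\<^esub> u))\<rparr>"

definition restrict_scalars :: "('q \<Rightarrow> 'r) \<Rightarrow> ('r, 'a) module \<Rightarrow> ('q, 'a) module" where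
  "restrict_scalars \<phi> M =
     \<lparr>carrier = carrier M, mult = mult M, one = one M, zero = zero M, add = add M,
      smult = (\<lambda>q u. \<phi> q \<odot>\<^bsub>M\<^esub> u)\<rparr>"

text \<open>A module over \<open>Q Quot (PIdl x)\<close>, regarded as a module over \<open>Q\<close>.\<close>

definition over_base ::
  "('q, 'z) ring_scheme \<Rightarrow> 'q \<Rightarrow> ('q set, 'a) module \<Rightarrow> ('q, 'a) module" where
  "over_base Q x M = restrict_scalars (\<lambda>q. (PIdl\<^bsub>Q\<^esub> x) +>\<^bsub>Q\<^esub> q) M"

text \<open>The length of a module: the supremum of the lengths \<open>n\<close> of strict chains
  \<open>C 0 \<subset> \<dots> \<subset> C n\<close> of submodules.\<close>

definition module_length :: "('r, 'z) ring_scheme \<Rightarrow> ('r, 'a) module \<Rightarrow> enat" where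
  "module_length R M =
     Sup {enat n | n. \<exists>C. (\<forall>i\<le>n. submodule (C i) R M) \<and> (\<forall>i<n. C i \<subset> C (Suc i))}"

definition finite_length :: "('r, 'z) ring_scheme \<Rightarrow> ('r, 'a) module \<Rightarrow> bool" where
  "finite_length R M \<longleftrightarrow> module_length R M \<noteq> \<infinity>"


section \<open>Free modules\<close>

definition supp :: "('r, 'z) ring_scheme \<Rightarrow> ('b \<Rightarrow> 'r) \<Rightarrow> 'b set" where
  "supp R c = {b. c b \<noteq> \<zero>\<^bsub>R\<^esub>}"

text \<open>The free module on the set \<open>B\<close>, consisting of the finitely supported coefficient functions
  on \<open>B\<close>, extended by zero.\<close>

definition free_mod :: "('r, 'z) ring_scheme \<Rightarrow> 'b set \<Rightarrow> ('r, 'b \<Rightarrow> 'r) module" where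
  "free_mod R B =
     \<lparr>carrier = {c. range c \<subseteq> carrier R \<and> supp R c \<subseteq> B \<and> finite (supp R c)},
      mult = undefined, one = undefined,
      zero = (\<lambda>_. \<zero>\<^bsub>R\<^esub>),
      add = (\<lambda>c d b. c b \<oplus>\<^bsub>R\<^esub> d b),
      smult = (\<lambda>a c b. a \<otimes>\<^bsub>R\<^esub> c b)\<rparr>"

definition delta :: "('r, 'z) ring_scheme \<Rightarrow> 'b \<Rightarrow> 'b \<Rightarrow> 'r" where
  "delta R b = (\<lambda>b'. if b' = b then \<one>\<^bsub>R\<^esub> else \<zero>\<^bsub>R\<^esub>)"

text \<open>The linear extension to free modules of a map \<open>g\<close> from the basis into \<open>M\<close>.\<close>

definition free_ext ::
  "('r, 'z) ring_scheme \<Rightarrow> ('r, 'a) module \<Rightarrow> ('b \<Rightarrow> 'a) \<Rightarrow> ('b \<Rightarrow> 'r) \<Rightarrow> 'a" where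
  "free_ext R M g c = (\<Oplus>\<^bsub>M\<^esub> b \<in> supp R c. c b \<odot>\<^bsub>M\<^esub> g b)"

definition is_basis :: "('r, 'z) ring_scheme \<Rightarrow> ('r, 'a) module \<Rightarrow> 'a set \<Rightarrow> bool" where
  "is_basis R M B \<longleftrightarrow> B \<subseteq> carrier M \<and>
     bij_betw (free_ext R M (\<lambda>b. b)) (carrier (free_mod R B)) (carrier M)"

definition is_free :: "('r, 'z) ring_scheme \<Rightarrow> ('r, 'a) module \<Rightarrow> bool" where
  "is_free R M \<longleftrightarrow> (\<exists>B. is_basis R M B)"


section \<open>Tensor products\<close>

definition tensor_relations ::
  "('r, 'z) ring_scheme \<Rightarrow> ('r, 'a) module \<Rightarrow> ('r, 'b) module \<Rightarrow> ('a \<times> 'b \<Rightarrow> 'r) set" where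
  "tensor_relations R M N =
    (let P = free_mod R (carrier M \<times> carrier N) in
     {delta R (u \<oplus>\<^bsub>M\<^esub> u', v) \<ominus>\<^bsub>P\<^esub> (delta R (u, v) \<oplus>\<^bsub>P\<^esub> delta R (u', v)) | u u' v.
        u \<in> carrier M \<and> u' \<in> carrier M \<and> v \<in> carrier N}
   \<union> {delta R (u, v \<oplus>\<^bsub>N\<^esub> v') \<ominus>\<^bsub>P\<^esub> (delta R (u, v) \<oplus>\<^bsub>P\<^esub> delta R (u, v')) | u v v'.
        u \<in> carrier M \<and> v \<in> carrier N \<and> v' \<in> carrier N}
   \<union> {delta R (a \<odot>\<^bsub>M\<^esub> u, v) \<ominus>\<^bsub>P\<^esub> (a \<odot>\<^bsub>P\<^esub> delta R (u, v)) | a u v.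
        a \<in> carrier R \<and> u \<in> carrier M \<and> v \<in> carrier N}
   \<union> {delta R (u, a \<odot>\<^bsub>N\<^esub> v) \<ominus>\<^bsub>P\<^esub> (a \<odot>\<^bsub>P\<^esub> delta R (u, v)) | a u v.
        a \<in> carrier R \<and> u \<in> carrier M \<and> v \<in> carrier N})"

definition tensor_kernel ::
  "('r, 'z) ring_scheme \<Rightarrow> ('r, 'a) module \<Rightarrow> ('r, 'b) module \<Rightarrow> ('a \<times> 'b \<Rightarrow> 'r) set" where
  "tensor_kernel R M N =
     mod_span R (free_mod R (carrier M \<times> carrier N)) (tensor_relations R M N)"

definition tensor ::
  "('r, 'z) ring_scheme \<Rightarrow> ('r, 'a) module \<Rightarrow> ('r, 'b) module \<Rightarrow>
     ('r, ('a \<times> 'b \<Rightarrow> 'r) set) module" where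
  "tensor R M N = quotient_module R (free_mod R (carrier M \<times> carrier N)) (tensor_kernel R M N)"

definition pure_tensor ::
  "('r, 'z) ring_scheme \<Rightarrow> ('r, 'a) module \<Rightarrow> ('r, 'b) module \<Rightarrow> 'a \<Rightarrow> 'b \<Rightarrow>
     ('a \<times> 'b \<Rightarrow> 'r) set" where
  "pure_tensor R M N u v =
     tensor_kernel R M N +>\<^bsub>free_mod R (carrier M \<times> carrier N)\<^esub> delta R (u, v)"

text \<open>\<open>tensor_map R M' N h\<close> is the map \<open>h \<otimes> N\<close> into \<open>M' \<otimes> N\<close> induced by a linear map \<open>h\<close> into
  \<open>M'\<close>.  It sends the class of \<open>c\<close> to the sum of all \<open>c (u, v) \<odot> (h u \<otimes> v)\<close>; for linear \<open>h\<close> this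
  does not depend on the representative \<open>c\<close> of the coset, so that the image below is a
  singleton.\<close>

definition tensor_map ::
  "('r, 'z) ring_scheme \<Rightarrow> ('r, 'a') module \<Rightarrow> ('r, 'b) module \<Rightarrow> ('a \<Rightarrow> 'a') \<Rightarrow>
     ('a \<times> 'b \<Rightarrow> 'r) set \<Rightarrow> ('a' \<times> 'b \<Rightarrow> 'r) set" where
  "tensor_map R M' N h U =
     the_elem (free_ext R (tensor R M' N) (\<lambda>(u, v). pure_tensor R M' N (h u) v) ` U)"


section \<open>Homology and free resolutions\<close>

text \<open>Graded modules and complexes are indexed by \<^typ>\<open>int\<close>; \<open>d j\<close> maps \<open>C j\<close> to \<open>C (j - 1)\<close>.\<close>

definition homology ::
  "('r, 'z) ring_scheme \<Rightarrow> (int \<Rightarrow> ('r, 'a) module) \<Rightarrow> (int \<Rightarrow> 'a \<Rightarrow> 'a) \<Rightarrow> int \<Rightarrow>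
     ('r, 'a set) module" where
  "homology R C d j =
     quotient_module R ((C j)\<lparr>carrier := {u \<in> carrier (C j). d j u = \<zero>\<^bsub>C (j - 1)\<^esub>}\<rparr>)
       (d (j + 1) ` carrier (C (j + 1)))"

definition free_resolution ::
  "('r, 'z) ring_scheme \<Rightarrow> (int \<Rightarrow> ('r, 'f) module) \<Rightarrow> (int \<Rightarrow> 'f \<Rightarrow> 'f) \<Rightarrow> ('f \<Rightarrow> 'a) \<Rightarrow>
     ('r, 'a) module \<Rightarrow> bool" where
  "free_resolution R F d \<epsilon> M \<longleftrightarrow>
     (\<forall>j. Module.module R (F j) \<and> is_free R (F j)) \<and>
     (\<forall>j<0. carrier (F j) = {\<zero>\<^bsub>F j\<^esub>}) \<and>
     (\<forall>j. d j \<in> mod_hom R (F j) (F (j - 1))) \<and>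
     (\<forall>j>0. d (j + 1) ` carrier (F (j + 1)) = {u \<in> carrier (F j). d j u = \<zero>\<^bsub>F (j - 1)\<^esub>}) \<and>
     \<epsilon> \<in> mod_hom R (F 0) M \<and>
     d 1 ` carrier (F 1) = {u \<in> carrier (F 0). \<epsilon> u = \<zero>\<^bsub>M\<^esub>} \<and>
     \<epsilon> ` carrier (F 0) = carrier M"


section \<open>Tor\<close>

text \<open>Tor is computed from the standard free resolution of a module \<open>M\<close>: the module in degree
  \<open>0\<close> is free on the set \<open>M\<close>, and the module in degree \<open>n + 1\<close> is free on the set of all cycles in
  degree \<open>n\<close> (where in degree \<open>0\<close> the cycles are the elements of the kernel of the augmentation).
  To have all degrees in one type, a cycle, being a finitely supported function on the previous
  basis, is named by the finite graph of its restriction to its support.\<close>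

datatype ('m, 'r) std_gen = Elt 'm | Cyc "(('m, 'r) std_gen \<times> 'r) fset"

definition gen_of_cycle ::
  "('r, 'z) ring_scheme \<Rightarrow> (('m, 'r) std_gen \<Rightarrow> 'r) \<Rightarrow> ('m, 'r) std_gen" where
  "gen_of_cycle R c = Cyc (Abs_fset ((\<lambda>g. (g, c g)) ` supp R c))"

definition cycle_of_gen ::
  "('r, 'z) ring_scheme \<Rightarrow> ('m, 'r) std_gen \<Rightarrow> ('m, 'r) std_gen \<Rightarrow> 'r" where
  "cycle_of_gen R e = (case e of
       Elt m \<Rightarrow> (\<lambda>_. \<zero>\<^bsub>R\<^esub>)
     | Cyc S \<Rightarrow> (\<lambda>g. if \<exists>a. (g, a) |\<in>| S then THE a. (g, a) |\<in>| S else \<zero>\<^bsub>R\<^esub>))"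

definition std_aug ::
  "('r, 'z) ring_scheme \<Rightarrow> ('r, 'm) module \<Rightarrow> (('m, 'r) std_gen \<Rightarrow> 'r) \<Rightarrow> 'm" where
  "std_aug R M = free_ext R M (\<lambda>e. case e of Elt m \<Rightarrow> m | Cyc _ \<Rightarrow> \<zero>\<^bsub>M\<^esub>)"

fun std_basis ::
  "('r, 'z) ring_scheme \<Rightarrow> ('r, 'm) module \<Rightarrow> nat \<Rightarrow> ('m, 'r) std_gen set" where
  "std_basis R M 0 = Elt ` carrier M"
| "std_basis R M (Suc 0) = gen_of_cycle R `
     {c \<in> carrier (free_mod R (std_basis R M 0)). std_aug R M c = \<zero>\<^bsub>M\<^esub>}"
| "std_basis R M (Suc (Suc n)) = gen_of_cycle R `
     {c \<in> carrier (free_mod R (std_basis R M (Suc n))).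
        free_ext R (free_mod R (std_basis R M n)) (cycle_of_gen R) c
          = \<zero>\<^bsub>free_mod R (std_basis R M n)\<^esub>}"

definition std_mod ::
  "('r, 'z) ring_scheme \<Rightarrow> ('r, 'm) module \<Rightarrow> int \<Rightarrow> ('r, ('m, 'r) std_gen \<Rightarrow> 'r) module" where
  "std_mod R M j = free_mod R (if j < 0 then {} else std_basis R M (nat j))"

definition std_diff ::
  "('r, 'z) ring_scheme \<Rightarrow> ('r, 'm) module \<Rightarrow> int \<Rightarrow>
     (('m, 'r) std_gen \<Rightarrow> 'r) \<Rightarrow> (('m, 'r) std_gen \<Rightarrow> 'r)" where
  "std_diff R M j =
     (if j \<le> 0 then (\<lambda>_. \<zero>\<^bsub>std_mod R M (j - 1)\<^esub>)
      else free_ext R (std_mod R M (j - 1)) (cycle_of_gen R))"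

definition Tor ::
  "('r, 'z) ring_scheme \<Rightarrow> int \<Rightarrow> ('r, 'm) module \<Rightarrow> ('r, 'n) module \<Rightarrow>
     ('r, ((('m, 'r) std_gen \<Rightarrow> 'r) \<times> 'n \<Rightarrow> 'r) set set) module" where
  "Tor R j M N =
     homology R (\<lambda>i. tensor R (std_mod R M i) N)
       (\<lambda>i. tensor_map R (std_mod R M (i - 1)) N (std_diff R M i)) j"


section \<open>Higher homotopies and pre-rigidity\<close>

text \<open>\<open>\<sigma> i j\<close> is the component of \<open>\<sigma>\<^sub>i\<close> from \<open>F j\<close> to \<open>F (j + 2 * i - 1)\<close>.\<close>

definition higher_homotopies ::
  "('q, 'z) ring_scheme \<Rightarrow> 'q \<Rightarrow> (int \<Rightarrow> ('q, 'f) module) \<Rightarrow> (int \<Rightarrow> 'f \<Rightarrow> 'f) \<Rightarrow>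
     (nat \<Rightarrow> int \<Rightarrow> 'f \<Rightarrow> 'f) \<Rightarrow> bool" where
  "higher_homotopies Q x F d \<sigma> \<longleftrightarrow>
     (\<forall>i j. \<sigma> i j \<in> mod_hom Q (F j) (F (j + (2 * int i - 1)))) \<and>
     (\<forall>j. \<forall>u \<in> carrier (F j). \<sigma> 0 j u = d j u) \<and>
     (\<forall>j. \<forall>u \<in> carrier (F j).
        \<sigma> 0 (j + 1) (\<sigma> 1 j u) \<oplus>\<^bsub>F j\<^esub> \<sigma> 1 (j - 1) (\<sigma> 0 j u) = x \<odot>\<^bsub>F j\<^esub> u) \<and>
     (\<forall>n>1. \<forall>j. \<forall>u \<in> carrier (F j).
        (\<Oplus>\<^bsub>F (j + (2 * int n - 2))\<^esub> i \<in> {..n}.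
           \<sigma> i (j + (2 * int (n - i) - 1)) (\<sigma> (n - i) j u))
        = \<zero>\<^bsub>F (j + (2 * int n - 2))\<^esub>)"

text \<open>HOL cannot quantify over the type \<open>'f\<close> of the elements of the resolution inside a formula, so
  it is a parameter; a statement assuming \<open>pre_rigid TYPE('f) \<dots>\<close> for a type variable \<open>'f\<close> not
  occurring in its conclusion covers resolutions of every type.\<close>

definition pre_rigid ::
  "'f itself \<Rightarrow> int \<Rightarrow> ('q, 'z) ring_scheme \<Rightarrow> 'q \<Rightarrow> ('q set, 'm) module \<Rightarrow>
     ('q set, 'n) module \<Rightarrow> bool" where
  "pre_rigid _ r Q x M N \<longleftrightarrow>
     (\<exists>(F :: int \<Rightarrow> ('q, 'f) module) d \<epsilon> \<sigma>.
        free_resolution Q F d \<epsilon> (over_base Q x M) \<and>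
        higher_homotopies Q x F d \<sigma> \<and>
        (\<forall>i\<ge>1. \<forall>j > r - (2 * int i - 1).
           \<forall>t \<in> carrier (tensor Q (F j) (over_base Q x N)).
             tensor_map Q (F (j + (2 * int i - 1))) (over_base Q x N) (\<sigma> i j) t
             = \<zero>\<^bsub>tensor Q (F (j + (2 * int i - 1))) (over_base Q x N)\<^esub>))"

end

theory Submission
  imports Defs
begin

text \<open>Let \<open>F\<close> be the given \<open>Q\<close>-free resolution of \<open>M\<close> and \<open>G\<^sub>n = F\<^sub>n \<oplus> F\<^bsub>n-2\<^esub> \<oplus> F\<^bsub>n-4\<^esub> \<oplus> \<dots>\<close>.
  The homotopies add up to a map \<open>D = \<sigma>\<^sub>0 + \<sigma>\<^sub>1 + \<dots>\<close> on \<open>G\<close> with \<open>D\<^sup>2 = x \<cdot> shift\<close>, so \<open>G/xG\<close>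
  is a complex over \<open>R = Q/(x)\<close>; it is the Shamash--Eisenbud resolution of \<open>M\<close> over \<open>R\<close>.
  Tensoring with \<open>N\<close> kills all \<open>\<sigma>\<^sub>i\<close> with \<open>i \<ge> 1\<close>, so that \<open>G \<otimes> N\<close> is the direct sum of the
  shifted copies \<open>(F \<otimes> N)[-2i]\<close>, and taking homology gives the formula.

  Everything takes place over \<open>Q\<close>, with congruences modulo \<open>x\<close> in place of
  \<open>R\<close>-modules.  The standard resolution over \<open>R\<close> is lifted to such a complex modulo \<open>x\<close> of
  free \<open>Q\<close>-modules, and resolutions modulo \<open>x\<close> are compared as usual; the case
  \<open>x = 0\<close> compares \<open>F\<close> with the standard resolution over \<open>Q\<close>.\<close>

section \<open>Linear maps, submodules and quotients\<close>

text \<open>A complex modulo x becomes a genuine complex after tensoring with N, because x kills N.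
  So one notion of resolution, with x or with 0, serves for Tor over both rings, and X/xX is never
  formed. That x is a non-zerodivisor serves to cancel x in x D w = x shift u on the torsion-free
  module G. Pre-rigidity of degree 0 covers all of F: the bound on j is 1 - 2i, which is negative
  for i \<ge> 1, and F vanishes in negative degrees. The direct sum is not treated all at once.
  Dropping its first summand gives a sequence F \<rightarrow> G \<rightarrow> G[-2], whose linear
  splitting need not commute with D; rigidity makes it commute after tensoring. Each step gives
  length H_n(G) = length H_n(F) + length H_{n-2}(G), and the iteration ends below degree 0. Lengths
  are extended naturals, counted by chains between boundaries and cycles, so the formula is proved
  with infinite values allowed; finiteness of the summands is read off from it afterwards.\<close>

lemma (in abelian_monoid) finsum_triangle:
  assumes "\<And>k l. k + l \<le> K \<Longrightarrow> f k l \<in> carrier G"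
  shows "(\<Oplus>k\<in>{..K::nat}. \<Oplus>l\<in>{..K - k}. f k l) = (\<Oplus>m\<in>{..K}. \<Oplus>k\<in>{..m}. f k (m - k))"
  using assms
proof (induction K)
  case 0
  then show ?case by (simp add: Pi_def)
next
  case (Suc K)
  have cl: "f k l \<in> carrier G" if "k + l \<le> Suc K" for k l using Suc.prems that by auto
  have "(\<Oplus>k\<in>{..Suc K}. \<Oplus>l\<in>{..Suc K - k}. f k l)
      = f (Suc K) 0 \<oplus> (\<Oplus>k\<in>{..K}. \<Oplus>l\<in>{..Suc K - k}. f k l)"
    using cl[of "Suc K" 0] by (subst finsum_Suc) (auto intro!: finsum_closed cl)
  \<comment> \<open>Each inner sum gains one term when K grows by 1; together with
    \<open>f (Suc K) 0\<close> these terms form the diagonal m = K + 1.\<close>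
  also have "(\<Oplus>k\<in>{..K}. \<Oplus>l\<in>{..Suc K - k}. f k l)
      = (\<Oplus>k\<in>{..K}. f k (Suc K - k) \<oplus> (\<Oplus>l\<in>{..K - k}. f k l))"
    by (rule finsum_cong') (auto simp: Suc_diff_le intro!: finsum_closed cl finsum_Suc)
  also have "\<dots> = (\<Oplus>k\<in>{..K}. f k (Suc K - k)) \<oplus> (\<Oplus>k\<in>{..K}. \<Oplus>l\<in>{..K - k}. f k l)"
    by (rule finsum_addf) (auto intro!: finsum_closed cl)
  also have "(\<Oplus>k\<in>{..K}. \<Oplus>l\<in>{..K - k}. f k l) = (\<Oplus>m\<in>{..K}. \<Oplus>k\<in>{..m}. f k (m - k))"
    by (rule Suc.IH) (auto intro: cl)
  finally have "(\<Oplus>k\<in>{..Suc K}. \<Oplus>l\<in>{..Suc K - k}. f k l)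
    = (f (Suc K) 0 \<oplus> (\<Oplus>k\<in>{..K}. f k (Suc K - k))) \<oplus> (\<Oplus>m\<in>{..K}. \<Oplus>k\<in>{..m}. f k (m - k))"
    by (subst a_assoc) (auto intro!: finsum_closed cl)
  also have "f (Suc K) 0 \<oplus> (\<Oplus>k\<in>{..K}. f k (Suc K - k)) = (\<Oplus>k\<in>{..Suc K}. f k (Suc K - k))"
    by (subst finsum_Suc) (auto intro!: cl)
  finally show ?case by (subst finsum_Suc) (auto intro!: finsum_closed cl)
qed

context abelian_group
begin

lemma add_minus_cancel_left: "a \<in> carrier G \<Longrightarrow> b \<in> carrier G \<Longrightarrow> (a \<oplus> b) \<ominus> a = b"
  by (simp add: a_minus_def a_comm[of a b] a_assoc r_neg)

lemma minus_add_cancel: "a \<in> carrier G \<Longrightarrow> b \<in> carrier G \<Longrightarrow> (b \<ominus> a) \<oplus> a = b"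
  by (simp add: a_minus_def a_assoc l_neg)

lemma minus_minus_cancel: "a \<in> carrier G \<Longrightarrow> b \<in> carrier G \<Longrightarrow> a \<ominus> (a \<ominus> b) = b"
  by (simp add: a_minus_def minus_add minus_minus r_neg2 a_assoc[symmetric] r_neg)

end

section \<open>Linear maps and their pointwise operations\<close>

lemma mod_homI:
  assumes "\<And>u. u \<in> carrier M \<Longrightarrow> h u \<in> carrier N"
    and "\<And>u v. u \<in> carrier M \<Longrightarrow> v \<in> carrier M \<Longrightarrow> h (u \<oplus>\<^bsub>M\<^esub> v) = h u \<oplus>\<^bsub>N\<^esub> h v"
    and "\<And>a u. a \<in> carrier R \<Longrightarrow> u \<in> carrier M \<Longrightarrow> h (a \<odot>\<^bsub>M\<^esub> u) = a \<odot>\<^bsub>N\<^esub> h u"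
  shows "h \<in> mod_hom R M N"
  using assms by (auto simp: mod_hom_def)

lemma mod_hom_closed: "h \<in> mod_hom R M N \<Longrightarrow> u \<in> carrier M \<Longrightarrow> h u \<in> carrier N"
  by (auto simp: mod_hom_def)

lemma mod_hom_add:
  "h \<in> mod_hom R M N \<Longrightarrow> u \<in> carrier M \<Longrightarrow> v \<in> carrier M \<Longrightarrow> h (u \<oplus>\<^bsub>M\<^esub> v) = h u \<oplus>\<^bsub>N\<^esub> h v"
  by (auto simp: mod_hom_def)

lemma mod_hom_smult:
  "h \<in> mod_hom R M N \<Longrightarrow> a \<in> carrier R \<Longrightarrow> u \<in> carrier M \<Longrightarrow> h (a \<odot>\<^bsub>M\<^esub> u) = a \<odot>\<^bsub>N\<^esub> h u"
  by (auto simp: mod_hom_def)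

lemma mod_hom_zero:
  assumes "Module.module R M" "Module.module R N" "h \<in> mod_hom R M N"
  shows "h \<zero>\<^bsub>M\<^esub> = \<zero>\<^bsub>N\<^esub>"
proof -
  interpret M: Module.module R M by fact
  interpret N: Module.module R N by fact
  have "h (\<zero>\<^bsub>R\<^esub> \<odot>\<^bsub>M\<^esub> \<zero>\<^bsub>M\<^esub>) = \<zero>\<^bsub>R\<^esub> \<odot>\<^bsub>N\<^esub> h \<zero>\<^bsub>M\<^esub>"
    by (rule mod_hom_smult[OF assms(3)]) auto
  then show ?thesis using mod_hom_closed[OF assms(3), of "\<zero>\<^bsub>M\<^esub>"] by simp
qed

lemma mod_hom_uminus:
  assumes "Module.module R M" "Module.module R N" "h \<in> mod_hom R M N" "u \<in> carrier M"
  shows "h (\<ominus>\<^bsub>M\<^esub> u) = \<ominus>\<^bsub>N\<^esub> h u"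
proof -
  interpret M: Module.module R M by fact
  interpret N: Module.module R N by fact
  have hu: "h u \<in> carrier N" by (rule mod_hom_closed[OF assms(3,4)])
  have "h ((\<ominus>\<^bsub>R\<^esub> \<one>\<^bsub>R\<^esub>) \<odot>\<^bsub>M\<^esub> u) = (\<ominus>\<^bsub>R\<^esub> \<one>\<^bsub>R\<^esub>) \<odot>\<^bsub>N\<^esub> h u"
    by (rule mod_hom_smult[OF assms(3)]) (use assms in auto)
  then show ?thesis using hu assms(4) by (simp add: M.smult_l_minus N.smult_l_minus)
qed

lemma mod_hom_minus:
  assumes "Module.module R M" "Module.module R N" "h \<in> mod_hom R M N"
    "u \<in> carrier M" "v \<in> carrier M"
  shows "h (u \<ominus>\<^bsub>M\<^esub> v) = h u \<ominus>\<^bsub>N\<^esub> h v"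
proof -
  interpret M: Module.module R M by fact
  show ?thesis using assms
    by (simp add: a_minus_def mod_hom_add[OF assms(3)] mod_hom_uminus[OF assms(1-3)])
qed

lemma mod_hom_id: "(\<lambda>u. u) \<in> mod_hom R M M"
  by (rule mod_homI) auto

lemma mod_hom_comp:
  assumes "g \<in> mod_hom R N L" "h \<in> mod_hom R M N"
  shows "(\<lambda>u. g (h u)) \<in> mod_hom R M L"
  using assms by (auto simp: mod_hom_def Pi_iff)

lemma mod_hom_const_zero:
  assumes "Module.module R N"
  shows "(\<lambda>u. \<zero>\<^bsub>N\<^esub>) \<in> mod_hom R M N"
proof -
  interpret N: Module.module R N by fact
  show ?thesis by (rule mod_homI) auto
qed

lemma mod_hom_plus:
  assumes "Module.module R N" "g \<in> mod_hom R M N" "h \<in> mod_hom R M N"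
  shows "(\<lambda>u. g u \<oplus>\<^bsub>N\<^esub> h u) \<in> mod_hom R M N"
proof -
  interpret N: Module.module R N by fact
  note cl = mod_hom_closed[OF assms(2)] mod_hom_closed[OF assms(3)]
  show ?thesis
    by (rule mod_homI)
      (simp_all add: cl mod_hom_add[OF assms(2)] mod_hom_add[OF assms(3)] N.M.a_ac
        mod_hom_smult[OF assms(2)] mod_hom_smult[OF assms(3)] N.smult_r_distr)
qed

lemma mod_hom_diff:
  assumes "Module.module R N" "g \<in> mod_hom R M N" "h \<in> mod_hom R M N"
  shows "(\<lambda>u. g u \<ominus>\<^bsub>N\<^esub> h u) \<in> mod_hom R M N"
proof -
  interpret N: Module.module R N by fact
  note cl = mod_hom_closed[OF assms(2)] mod_hom_closed[OF assms(3)]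
  show ?thesis
    by (rule mod_homI)
      (simp_all add: a_minus_def cl mod_hom_add[OF assms(2)] mod_hom_add[OF assms(3)] N.M.a_ac
        mod_hom_smult[OF assms(2)] mod_hom_smult[OF assms(3)] N.smult_r_distr N.M.minus_add
        N.smult_r_minus)
qed

section \<open>Submodules: preimages, images and sums\<close>

lemma submodule_intro:
  assumes "Module.module R M" "H \<subseteq> carrier M" "\<zero>\<^bsub>M\<^esub> \<in> H"
    and "\<And>u v. u \<in> H \<Longrightarrow> v \<in> H \<Longrightarrow> u \<oplus>\<^bsub>M\<^esub> v \<in> H"
    and "\<And>a u. a \<in> carrier R \<Longrightarrow> u \<in> H \<Longrightarrow> a \<odot>\<^bsub>M\<^esub> u \<in> H"
  shows "submodule H R M"
proof -
  interpret M: Module.module R M by fact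
  show ?thesis
  proof (rule M.submoduleI)
    \<comment> \<open>Negatives are multiples by -1, so closure under scaling provides them.\<close>
    fix a assume "a \<in> H"
    then have "(\<ominus>\<^bsub>R\<^esub> \<one>\<^bsub>R\<^esub>) \<odot>\<^bsub>M\<^esub> a \<in> H" using assms(5) by simp
    then show "\<ominus>\<^bsub>M\<^esub> a \<in> H" using \<open>a \<in> H\<close> assms(2) by (simp add: M.smult_l_minus subset_iff)
  qed (use assms in auto)
qed

lemma submodule_subset: "submodule H R M \<Longrightarrow> H \<subseteq> carrier M"
  by (auto simp: submodule_def subgroup_def)

lemma submodule_zero: "submodule H R M \<Longrightarrow> \<zero>\<^bsub>M\<^esub> \<in> H"
  by (auto simp: submodule_def subgroup_def)

lemma submodule_add: "submodule H R M \<Longrightarrow> u \<in> H \<Longrightarrow> v \<in> H \<Longrightarrow> u \<oplus>\<^bsub>M\<^esub> v \<in> H"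
  by (auto simp: submodule_def subgroup_def)

lemma submodule_smult: "submodule H R M \<Longrightarrow> a \<in> carrier R \<Longrightarrow> u \<in> H \<Longrightarrow> a \<odot>\<^bsub>M\<^esub> u \<in> H"
  by (auto simp: submodule_def submodule_axioms_def)

lemma submodule_uminus: "submodule H R M \<Longrightarrow> u \<in> H \<Longrightarrow> \<ominus>\<^bsub>M\<^esub> u \<in> H"
  unfolding submodule_def a_inv_def
  by (metis (no_types) subgroup.m_inv_closed)

lemma submodule_minus: "submodule H R M \<Longrightarrow> u \<in> H \<Longrightarrow> v \<in> H \<Longrightarrow> u \<ominus>\<^bsub>M\<^esub> v \<in> H"
  by (simp add: a_minus_def submodule_add submodule_uminus)

lemma submodule_Inter:
  assumes "Module.module R M" "\<And>H. H \<in> \<H> \<Longrightarrow> submodule H R M" "\<H> \<noteq> {}"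
  shows "submodule (\<Inter>\<H>) R M"
  using assms
  by (intro submodule_intro)
    (auto intro: submodule_zero submodule_add submodule_smult dest: submodule_subset)

lemma submodule_mod_span:
  assumes "Module.module R M" "A \<subseteq> carrier M"
  shows "submodule (mod_span R M A) R M"
  unfolding mod_span_def
  using assms Module.module.carrier_is_submodule[OF assms(1)]
  by (intro submodule_Inter) auto

lemma mod_span_least: "submodule H R M \<Longrightarrow> A \<subseteq> H \<Longrightarrow> mod_span R M A \<subseteq> H"
  unfolding mod_span_def by auto

lemma mod_span_incl: "A \<subseteq> mod_span R M A"
  unfolding mod_span_def by auto

lemma submodule_preimage:
  assumes "Module.module R M" "Module.module R N" "h \<in> mod_hom R M N" "submodule K R N"
  shows "submodule {u \<in> carrier M. h u \<in> K} R M"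
proof -
  interpret M: Module.module R M by fact
  show ?thesis
    by (rule submodule_intro)
      (use assms in \<open>auto simp: mod_hom_zero[OF assms(1-3)] mod_hom_add[OF assms(3)]
        mod_hom_smult[OF assms(3)] intro: submodule_zero submodule_add submodule_smult\<close>)
qed

lemma submodule_singleton_zero:
  assumes "Module.module R M" shows "submodule {\<zero>\<^bsub>M\<^esub>} R M"
proof -
  interpret M: Module.module R M by fact
  show ?thesis by (rule submodule_intro) (use assms in auto)
qed

lemma submodule_kernel:
  assumes "Module.module R M" "Module.module R N" "h \<in> mod_hom R M N"
  shows "submodule {u \<in> carrier M. h u = \<zero>\<^bsub>N\<^esub>} R M"
  using submodule_preimage[OF assms submodule_singleton_zero[OF assms(2)]] by simp

lemma submodule_equalizer:
  assumes "Module.module R M" "Module.module R N" "g \<in> mod_hom R M N" "h \<in> mod_hom R M N"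
  shows "submodule {u \<in> carrier M. g u = h u} R M"
proof -
  interpret M: Module.module R M by fact
  show ?thesis
    by (rule submodule_intro)
      (use assms in \<open>auto simp: mod_hom_zero[OF assms(1-3)] mod_hom_add[OF assms(3)]
        mod_hom_smult[OF assms(3)] mod_hom_zero[OF assms(1,2,4)] mod_hom_add[OF assms(4)]
        mod_hom_smult[OF assms(4)]\<close>)
qed

lemma submodule_image:
  assumes "Module.module R M" "Module.module R N" "h \<in> mod_hom R M N" "submodule K R M"
  shows "submodule (h ` K) R N"
proof -
  note KM = submodule_subset[OF assms(4)]
  show ?thesis
  proof (rule submodule_intro[OF assms(2)])
    show "h ` K \<subseteq> carrier N" using KM mod_hom_closed[OF assms(3)] by auto
    show "\<zero>\<^bsub>N\<^esub> \<in> h ` K"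
      using mod_hom_zero[OF assms(1-3)] submodule_zero[OF assms(4)] by (metis imageI)
    fix u v assume "u \<in> h ` K" "v \<in> h ` K"
    then obtain u' v' where "u = h u'" "v = h v'" "u' \<in> K" "v' \<in> K" by auto
    then show "u \<oplus>\<^bsub>N\<^esub> v \<in> h ` K"
      using KM submodule_add[OF assms(4), of u' v'] mod_hom_add[OF assms(3), of u' v']
      by (metis imageI subsetD)
  next
    fix a u assume "a \<in> carrier R" "u \<in> h ` K"
    then obtain u' where "u = h u'" "u' \<in> K" by auto
    then show "a \<odot>\<^bsub>N\<^esub> u \<in> h ` K"
      using KM \<open>a \<in> carrier R\<close> submodule_smult[OF assms(4), of a u']
        mod_hom_smult[OF assms(3), of a u'] by (metis imageI subsetD)
  qed
qed

lemma submodule_sum: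
  assumes "Module.module R M" "submodule H R M" "submodule K R M"
  shows "submodule {h \<oplus>\<^bsub>M\<^esub> k | h k. h \<in> H \<and> k \<in> K} R M"
proof -
  interpret M: Module.module R M by fact
  note sub = submodule_subset[OF assms(2)] submodule_subset[OF assms(3)]
  show ?thesis
  proof (rule submodule_intro[OF assms(1)], goal_cases)
    case 1 then show ?case using sub by auto
  next
    case 2
    have "\<zero>\<^bsub>M\<^esub> = \<zero>\<^bsub>M\<^esub> \<oplus>\<^bsub>M\<^esub> \<zero>\<^bsub>M\<^esub>" by simp
    then show ?case using submodule_zero[OF assms(2)] submodule_zero[OF assms(3)] by blast
  next
    case (3 u v)
    then obtain h k h' k' where *: "u = h \<oplus>\<^bsub>M\<^esub> k" "v = h' \<oplus>\<^bsub>M\<^esub> k'" "h \<in> H" "h' \<in> H" "k \<in> K" "k' \<in> K"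
      by auto
    then have "u \<oplus>\<^bsub>M\<^esub> v = (h \<oplus>\<^bsub>M\<^esub> h') \<oplus>\<^bsub>M\<^esub> (k \<oplus>\<^bsub>M\<^esub> k')"
      using sub by (simp add: M.M.a_ac subset_iff)
    then show ?case using * submodule_add[OF assms(2)] submodule_add[OF assms(3)] by blast
  next
    case (4 a u)
    then obtain h k where *: "u = h \<oplus>\<^bsub>M\<^esub> k" "h \<in> H" "k \<in> K" by auto
    then have "a \<odot>\<^bsub>M\<^esub> u = a \<odot>\<^bsub>M\<^esub> h \<oplus>\<^bsub>M\<^esub> a \<odot>\<^bsub>M\<^esub> k"
      using sub 4 by (simp add: M.smult_r_distr subset_iff)
    then show ?case using * 4 submodule_smult[OF assms(2)] submodule_smult[OF assms(3)] by blast
  qed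
qed

lemma mod_hom_finsum_distrib:
  assumes M: "Module.module R M" and N: "Module.module R N" and h: "h \<in> mod_hom R M N"
    and g: "g \<in> A \<rightarrow> carrier M"
  shows "h (\<Oplus>\<^bsub>M\<^esub> i \<in> A. g i) = (\<Oplus>\<^bsub>N\<^esub> i \<in> A. h (g i))"
proof -
  interpret M: Module.module R M by fact
  interpret N: Module.module R N by fact
  show ?thesis using g
  proof (induction A rule: infinite_finite_induct)
    case (insert a A)
    then have "g \<in> A \<rightarrow> carrier M" "g a \<in> carrier M" "(\<lambda>i. h (g i)) \<in> A \<rightarrow> carrier N" "h (g a) \<in> carrier N"
      using mod_hom_closed[OF h] by auto
    then show ?case using insert by (simp add: mod_hom_add[OF h])
  qed (simp_all add: mod_hom_zero[OF M N h] M.M.finsum_infinite N.M.finsum_infinite)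
qed

lemma submodule_finsum:
  assumes M: "Module.module R M" and H: "submodule H R M" and g: "\<And>i. i \<in> A \<Longrightarrow> g i \<in> H"
  shows "(\<Oplus>\<^bsub>M\<^esub> i \<in> A. g i) \<in> H"
proof -
  interpret M: Module.module R M by fact
  show ?thesis using g
  proof (induction A rule: infinite_finite_induct)
    case (insert a A)
    then have "g \<in> A \<rightarrow> carrier M" "g a \<in> carrier M" using submodule_subset[OF H] by auto
    then show ?case using insert by (simp add: submodule_add[OF H])
  qed (simp_all add: submodule_zero[OF H] M.M.finsum_infinite)
qed

section \<open>Quotient modules and coset arithmetic\<close>

locale quotient = Module.module R M for R :: "('r, 'z) ring_scheme" and M :: "('r, 'a) module" +
  fixes H assumes sub: "submodule H R M"
begin

lemma subgrp: "abelian_subgroup H M"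
  using sub M.abelian_group_axioms
  by (intro abelian_subgroupI3 additive_subgroupI) (auto simp: submodule_def)

sublocale S: abelian_subgroup H M by (rule subgrp)

lemma cos_eq_iff:
  assumes "u \<in> carrier M" "v \<in> carrier M"
  shows "H +>\<^bsub>M\<^esub> u = H +>\<^bsub>M\<^esub> v \<longleftrightarrow> u \<ominus>\<^bsub>M\<^esub> v \<in> H"
proof -
  have "H +>\<^bsub>M\<^esub> u = H +>\<^bsub>M\<^esub> v \<longleftrightarrow> u \<in> H +>\<^bsub>M\<^esub> v"
    using assms S.a_rcos_self S.a_repr_independence' by metis
  also have "\<dots> \<longleftrightarrow> u \<ominus>\<^bsub>M\<^esub> v \<in> H"
    using S.a_rcos_module[OF assms(2,1)] by (simp add: a_minus_def)
  finally show ?thesis .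
qed

lemma carrier_quotient: "carrier (quotient_module R M H) = {H +>\<^bsub>M\<^esub> u | u. u \<in> carrier M}"
  by (auto simp: quotient_module_def A_RCOSETS_def')

lemma zero_quotient: "\<zero>\<^bsub>quotient_module R M H\<^esub> = H"
  by (simp add: quotient_module_def)

lemma cos_zero: "H +>\<^bsub>M\<^esub> \<zero>\<^bsub>M\<^esub> = H"
  using submodule_subset[OF sub] by simp

lemma uminus_zero: "\<ominus>\<^bsub>M\<^esub> \<zero>\<^bsub>M\<^esub> = \<zero>\<^bsub>M\<^esub>"
  by (rule M.minus_equality) auto

lemma cos_eq_zero_iff: "u \<in> carrier M \<Longrightarrow> H +>\<^bsub>M\<^esub> u = H \<longleftrightarrow> u \<in> H"
  using cos_eq_iff[of u "\<zero>\<^bsub>M\<^esub>"] cos_zero by (simp add: a_minus_def uminus_zero)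

lemma cos_add:
  "u \<in> carrier M \<Longrightarrow> v \<in> carrier M \<Longrightarrow>
     (H +>\<^bsub>M\<^esub> u) \<oplus>\<^bsub>quotient_module R M H\<^esub> (H +>\<^bsub>M\<^esub> v) = H +>\<^bsub>M\<^esub> (u \<oplus>\<^bsub>M\<^esub> v)"
  by (simp add: quotient_module_def S.a_rcos_sum)

text \<open>The scalar multiple in \<open>quotient_module\<close> is a union over all
  representatives of the coset. Two representatives differ by an element of H, and scaling keeps
  that difference in H, so all members of the union coincide.\<close>

lemma cos_smult:
  assumes a: "a \<in> carrier R" and u: "u \<in> carrier M"
  shows "a \<odot>\<^bsub>quotient_module R M H\<^esub> (H +>\<^bsub>M\<^esub> u) = H +>\<^bsub>M\<^esub> (a \<odot>\<^bsub>M\<^esub> u)"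
proof -
  have "H +>\<^bsub>M\<^esub> (a \<odot>\<^bsub>M\<^esub> v) = H +>\<^bsub>M\<^esub> (a \<odot>\<^bsub>M\<^esub> u)" if "v \<in> H +>\<^bsub>M\<^esub> u" for v
  proof -
    have v: "v \<in> carrier M" using that u S.a_elemrcos_carrier by auto
    have "v \<ominus>\<^bsub>M\<^esub> u \<in> H" using that S.a_rcos_module[OF u v] by (simp add: a_minus_def)
    then have "a \<odot>\<^bsub>M\<^esub> (v \<ominus>\<^bsub>M\<^esub> u) \<in> H" by (rule submodule_smult[OF sub a])
    then show ?thesis
      using a u v by (subst cos_eq_iff) (simp_all add: a_minus_def smult_r_distr smult_r_minus)
  qed
  moreover have "u \<in> H +>\<^bsub>M\<^esub> u" using u by (rule S.a_rcos_self)
  ultimately have "(\<Union>v\<in>H +>\<^bsub>M\<^esub> u. H +>\<^bsub>M\<^esub> (a \<odot>\<^bsub>M\<^esub> v)) = H +>\<^bsub>M\<^esub> (a \<odot>\<^bsub>M\<^esub> u)" by blast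
  then show ?thesis by (simp add: quotient_module_def)
qed

lemma cos_closed: "u \<in> carrier M \<Longrightarrow> H +>\<^bsub>M\<^esub> u \<in> carrier (quotient_module R M H)"
  by (auto simp: carrier_quotient)

lemma module_quotient: "Module.module R (quotient_module R M H)"
proof (intro moduleI abelian_groupI)
  show "cring R" by unfold_locales
  show "\<exists>V\<in>carrier (quotient_module R M H). V \<oplus>\<^bsub>quotient_module R M H\<^esub> U = \<zero>\<^bsub>quotient_module R M H\<^esub>"
    if U: "U \<in> carrier (quotient_module R M H)" for U
  proof -
    obtain u where u: "u \<in> carrier M" "U = H +>\<^bsub>M\<^esub> u" using U by (auto simp: carrier_quotient)
    have "(H +>\<^bsub>M\<^esub> \<ominus>\<^bsub>M\<^esub> u) \<oplus>\<^bsub>quotient_module R M H\<^esub> U = \<zero>\<^bsub>quotient_module R M H\<^esub>"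
      using u by (simp add: cos_add zero_quotient M.l_neg cos_zero)
    then show ?thesis using u cos_closed[of "\<ominus>\<^bsub>M\<^esub> u"] by blast
  qed
  show "\<zero>\<^bsub>quotient_module R M H\<^esub> \<in> carrier (quotient_module R M H)"
    using cos_closed[of "\<zero>\<^bsub>M\<^esub>"] cos_zero by (simp add: zero_quotient)
  fix U assume "U \<in> carrier (quotient_module R M H)"
  then obtain u where u: "u \<in> carrier M" "U = H +>\<^bsub>M\<^esub> u" by (auto simp: carrier_quotient)
  have "(H +>\<^bsub>M\<^esub> \<zero>\<^bsub>M\<^esub>) \<oplus>\<^bsub>quotient_module R M H\<^esub> U = U" using u by (simp add: cos_add del: M.a_coset_add_zero)
  then show "\<zero>\<^bsub>quotient_module R M H\<^esub> \<oplus>\<^bsub>quotient_module R M H\<^esub> U = U"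
    by (simp only: zero_quotient cos_zero)
qed (auto simp: carrier_quotient cos_add cos_smult smult_l_distr smult_r_distr smult_assoc1 M.a_ac)

lemma cos_hom: "(\<lambda>u. H +>\<^bsub>M\<^esub> u) \<in> mod_hom R M (quotient_module R M H)"
  by (rule mod_homI) (simp_all add: cos_closed cos_add cos_smult)

end

lemma quotientI: "Module.module R M \<Longrightarrow> submodule H R M \<Longrightarrow> quotient R M H"
  by (simp add: quotient_def quotient_axioms_def)

section \<open>Free modules\<close>

lemma free_mod_sel:
  "c \<in> carrier (free_mod R B) \<longleftrightarrow> range c \<subseteq> carrier R \<and> supp R c \<subseteq> B \<and> finite (supp R c)"
  "\<zero>\<^bsub>free_mod R B\<^esub> = (\<lambda>_. \<zero>\<^bsub>R\<^esub>)"
  "c \<oplus>\<^bsub>free_mod R B\<^esub> c' = (\<lambda>b. c b \<oplus>\<^bsub>R\<^esub> c' b)"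
  "a \<odot>\<^bsub>free_mod R B\<^esub> c = (\<lambda>b. a \<otimes>\<^bsub>R\<^esub> c b)"
  by (auto simp: free_mod_def)

lemma free_mod_closed: "c \<in> carrier (free_mod R B) \<Longrightarrow> c b \<in> carrier R"
  by (auto simp: free_mod_sel)

lemma module_free_mod:
  assumes "cring R"
  shows "Module.module R (free_mod R B)"
proof -
  interpret cring R by fact
  have supp_add: "supp R (\<lambda>b. c b \<oplus>\<^bsub>R\<^esub> c' b) \<subseteq> supp R c \<union> supp R c'"
    if "c \<in> carrier (free_mod R B)" "c' \<in> carrier (free_mod R B)" for c c'
    using that by (auto simp: supp_def free_mod_sel)
  have supp_smult: "supp R (\<lambda>b. a \<otimes>\<^bsub>R\<^esub> c b) \<subseteq> supp R c" if "a \<in> carrier R" for a c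
    using that by (auto simp: supp_def)
  have cl: "c \<oplus>\<^bsub>free_mod R B\<^esub> c' \<in> carrier (free_mod R B)"
    if "c \<in> carrier (free_mod R B)" "c' \<in> carrier (free_mod R B)" for c c'
    using that supp_add[OF that] finite_subset[OF supp_add[OF that]] 
    by (auto simp: free_mod_sel image_subset_iff intro!: a_closed)
  have cls: "a \<odot>\<^bsub>free_mod R B\<^esub> c \<in> carrier (free_mod R B)"
    if "a \<in> carrier R" "c \<in> carrier (free_mod R B)" for a c
    using that supp_smult[OF that(1), of c] finite_subset[OF supp_smult[OF that(1), of c]]
    by (auto simp: free_mod_sel)
  show ?thesis
  proof (intro moduleI abelian_groupI)
    show "\<zero>\<^bsub>free_mod R B\<^esub> \<in> carrier (free_mod R B)" by (auto simp: free_mod_sel supp_def)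
    show "\<exists>d\<in>carrier (free_mod R B). d \<oplus>\<^bsub>free_mod R B\<^esub> c = \<zero>\<^bsub>free_mod R B\<^esub>"
      if "c \<in> carrier (free_mod R B)" for c
    proof
      show "(\<ominus>\<^bsub>R\<^esub> \<one>\<^bsub>R\<^esub>) \<odot>\<^bsub>free_mod R B\<^esub> c \<in> carrier (free_mod R B)" using that by (intro cls) auto
      show "(\<ominus>\<^bsub>R\<^esub> \<one>\<^bsub>R\<^esub>) \<odot>\<^bsub>free_mod R B\<^esub> c \<oplus>\<^bsub>free_mod R B\<^esub> c = \<zero>\<^bsub>free_mod R B\<^esub>"
        using free_mod_closed[OF that] by (auto simp: free_mod_sel(2-4) l_minus l_neg)
    qed
  qed (use assms cl cls in
      \<open>auto simp: free_mod_sel(2-4) l_distr r_distr m_assoc a_ac free_mod_closed\<close>)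
qed

lemma delta_closed:
  assumes "cring R" "b \<in> B" shows "delta R b \<in> carrier (free_mod R B)"
proof -
  interpret cring R by fact
  have "supp R (delta R b) \<subseteq> {b}" by (auto simp: supp_def delta_def)
  then show ?thesis using assms(2) finite_subset[of _ "{b}"]
    by (auto simp: free_mod_sel delta_def)
qed

text \<open>Peeling off one point of the finite support at a time writes c as a sum of multiples of
  basis functions. This serves as the induction rule for every linear condition on a free
  module.\<close>

lemma free_mod_induct:
  assumes R: "cring R" and H: "submodule H R (free_mod R B)" and \<delta>: "\<And>b. b \<in> B \<Longrightarrow> delta R b \<in> H"
    and c: "c \<in> carrier (free_mod R B)"
  shows "c \<in> H"
proof -
  interpret cring R by fact
  \<comment> \<open>S may be larger than the support, so the induction can drop b from S whether or
    not \<open>c b\<close> is zero.\<close>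
  have "c \<in> H" if "finite S" "S \<subseteq> B" "supp R c \<subseteq> S" "c \<in> carrier (free_mod R B)" for S c
    using that
  proof (induction S arbitrary: c rule: finite_induct)
    case empty
    then have "c = \<zero>\<^bsub>free_mod R B\<^esub>" by (auto simp: free_mod_sel supp_def)
    then show ?case using submodule_zero[OF H] by simp
  next
    case (insert b S)
    define c' where "c' = c(b := \<zero>\<^bsub>R\<^esub>)"
    have cr: "c e \<in> carrier R" for e using insert.prems free_mod_closed by metis
    have sup: "supp R c' \<subseteq> S" using insert.prems by (auto simp: c'_def supp_def)
    have "c' \<in> carrier (free_mod R B)"
      using sup insert finite_subset[OF sup] cr by (auto simp: free_mod_sel(1) c'_def)
    then have c'H: "c' \<in> H" using insert sup by auto
    have "c b \<odot>\<^bsub>free_mod R B\<^esub> delta R b \<in> H"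
      using insert.prems cr by (intro submodule_smult[OF H] \<delta>) auto
    then have "c b \<odot>\<^bsub>free_mod R B\<^esub> delta R b \<oplus>\<^bsub>free_mod R B\<^esub> c' \<in> H"
      using c'H by (rule submodule_add[OF H])
    moreover have "c b \<odot>\<^bsub>free_mod R B\<^esub> delta R b \<oplus>\<^bsub>free_mod R B\<^esub> c' = c"
      using cr by (auto simp: free_mod_sel c'_def delta_def)
    ultimately show ?case by simp
  qed
  from this[of "supp R c" c] c show ?thesis by (auto simp: free_mod_sel)
qed

text \<open>Points outside the support contribute zero. This lets coefficient functions with
  different supports be summed over one common finite set.\<close>

lemma free_ext_eq_finsum:
  assumes "Module.module R M" "g \<in> B \<rightarrow> carrier M" "c \<in> carrier (free_mod R B)"
    "supp R c \<subseteq> S" "finite S" "S \<subseteq> B"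
  shows "free_ext R M g c = (\<Oplus>\<^bsub>M\<^esub> b \<in> S. c b \<odot>\<^bsub>M\<^esub> g b)"
proof -
  interpret M: Module.module R M by fact
  show ?thesis
    unfolding free_ext_def
  proof (rule M.add.finprod_mono_neutral_cong_left)
    fix i assume "i \<in> S - supp R c"
    then have "c i = \<zero>\<^bsub>R\<^esub>" "g i \<in> carrier M" using assms by (auto simp: supp_def)
    then show "c i \<odot>\<^bsub>M\<^esub> g i = \<zero>\<^bsub>M\<^esub>" by simp
  qed (use assms free_mod_closed[OF assms(3)] in \<open>auto simp: Pi_iff\<close>)
qed

lemma free_ext_hom:
  assumes M: "Module.module R M" and g: "g \<in> B \<rightarrow> carrier M"
  shows "free_ext R M g \<in> mod_hom R (free_mod R B) M"
proof -
  interpret M: Module.module R M by fact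
  have R: "cring R" by unfold_locales
  interpret F: Module.module R "free_mod R B" by (rule module_free_mod[OF R])
  have gb: "g b \<in> carrier M" if "b \<in> S" "S \<subseteq> B" for b S using g that by auto
  show ?thesis
  proof (rule mod_homI, goal_cases)
    case (1 c)
    then have "supp R c \<subseteq> B" "finite (supp R c)" by (auto simp: free_mod_sel)
    then show ?case
      unfolding free_ext_def using free_mod_closed[OF 1] gb[of _ "supp R c"]
      by (intro M.M.finsum_closed) auto
  next
    case (2 c c')
    define S where "S = supp R c \<union> supp R c'"
    have S: "S \<subseteq> B" "finite S" "supp R c \<subseteq> S" "supp R c' \<subseteq> S"
      "supp R (c \<oplus>\<^bsub>free_mod R B\<^esub> c') \<subseteq> S"
      using 2 by (auto simp: S_def free_mod_sel supp_def)
    have "free_ext R M g (c \<oplus>\<^bsub>free_mod R B\<^esub> c') = (\<Oplus>\<^bsub>M\<^esub> b \<in> S. (c b \<oplus>\<^bsub>R\<^esub> c' b) \<odot>\<^bsub>M\<^esub> g b)"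
      using free_ext_eq_finsum[OF M g F.M.a_closed[OF 2] S(5,2,1)] by (simp add: free_mod_sel(3))
    also have "\<dots> = (\<Oplus>\<^bsub>M\<^esub> b \<in> S. c b \<odot>\<^bsub>M\<^esub> g b \<oplus>\<^bsub>M\<^esub> c' b \<odot>\<^bsub>M\<^esub> g b)"
      using 2 S gb[of _ S] by (intro M.M.finsum_cong') (auto simp: free_mod_closed M.smult_l_distr)
    also have "\<dots> = (\<Oplus>\<^bsub>M\<^esub> b \<in> S. c b \<odot>\<^bsub>M\<^esub> g b) \<oplus>\<^bsub>M\<^esub> (\<Oplus>\<^bsub>M\<^esub> b \<in> S. c' b \<odot>\<^bsub>M\<^esub> g b)"
      using 2 S gb[of _ S] by (intro M.M.finsum_addf) (auto simp: free_mod_closed)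
    finally show ?case
      using 2 S by (simp add: free_ext_eq_finsum[OF M g])
  next
    case (3 a c)
    define S where "S = supp R c"
    have S: "S \<subseteq> B" "finite S" "supp R c \<subseteq> S" "supp R (a \<odot>\<^bsub>free_mod R B\<^esub> c) \<subseteq> S"
      using 3 by (auto simp: S_def free_mod_sel supp_def)
    have "free_ext R M g (a \<odot>\<^bsub>free_mod R B\<^esub> c) = (\<Oplus>\<^bsub>M\<^esub> b \<in> S. (a \<otimes>\<^bsub>R\<^esub> c b) \<odot>\<^bsub>M\<^esub> g b)"
      using free_ext_eq_finsum[OF M g F.smult_closed[OF 3] S(4,2,1)] by (simp add: free_mod_sel(4))
    also have "\<dots> = (\<Oplus>\<^bsub>M\<^esub> b \<in> S. a \<odot>\<^bsub>M\<^esub> (c b \<odot>\<^bsub>M\<^esub> g b))"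
      using 3 S gb[of _ S] by (intro M.M.finsum_cong') (auto simp: free_mod_closed M.smult_assoc1)
    also have "\<dots> = a \<odot>\<^bsub>M\<^esub> (\<Oplus>\<^bsub>M\<^esub> b \<in> S. c b \<odot>\<^bsub>M\<^esub> g b)"
      using 3 S gb[of _ S] by (intro M.finsum_smult_ldistr[symmetric]) (auto simp: free_mod_closed)
    finally show ?case
      using 3 S by (simp add: free_ext_eq_finsum[OF M g])
  qed
qed

lemma free_ext_delta:
  assumes M: "Module.module R M" and g: "g \<in> B \<rightarrow> carrier M" and b: "b \<in> B"
  shows "free_ext R M g (delta R b) = g b"
proof -
  interpret M: Module.module R M by fact
  have R: "cring R" by unfold_locales
  have gb: "g b \<in> carrier M" using g b by auto
  have "free_ext R M g (delta R b) = (\<Oplus>\<^bsub>M\<^esub> b' \<in> {b}. delta R b b' \<odot>\<^bsub>M\<^esub> g b')"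
    by (rule free_ext_eq_finsum[OF M g delta_closed[OF R b]])
      (use b in \<open>auto simp: supp_def delta_def\<close>)
  then show ?thesis using gb by (simp add: delta_def)
qed

text \<open>The set on which two linear maps agree is a submodule, so \<open>free_mod_induct\<close>
  applies to it.\<close>

lemma free_mod_hom_eq:
  assumes "cring R" "Module.module R M" "h \<in> mod_hom R (free_mod R B) M" "h' \<in> mod_hom R (free_mod R B) M"
    "\<And>b. b \<in> B \<Longrightarrow> h (delta R b) = h' (delta R b)" "c \<in> carrier (free_mod R B)"
  shows "h c = h' c"
proof -
  have "c \<in> {u \<in> carrier (free_mod R B). h u = h' u}"
    by (rule free_mod_induct[OF assms(1) submodule_equalizer[OF module_free_mod[OF assms(1)] assms(2-4)] _ assms(6)])
      (simp add: delta_closed[OF assms(1)] assms(5))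
  then show ?thesis by simp
qed

lemma free_ext_comp:
  assumes M: "Module.module R M" and N: "Module.module R N" and h: "h \<in> mod_hom R M N"
    and g: "g \<in> B \<rightarrow> carrier M" and c: "c \<in> carrier (free_mod R B)"
  shows "h (free_ext R M g c) = free_ext R N (\<lambda>b. h (g b)) c"
proof -
  interpret M: Module.module R M by fact
  have R: "cring R" by unfold_locales
  have hg: "(\<lambda>b. h (g b)) \<in> B \<rightarrow> carrier N" using g mod_hom_closed[OF h] by auto
  show ?thesis
    by (rule free_mod_hom_eq[OF R N mod_hom_comp[OF h free_ext_hom[OF M g]] free_ext_hom[OF N hg] _ c])
      (simp add: free_ext_delta[OF M g] free_ext_delta[OF N hg])
qed

section \<open>Tensor products\<close>

locale tensor_prod = M: Module.module R M + N: Module.module R N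
  for R :: "('r, 'z) ring_scheme" and M :: "('r, 'a) module" and N :: "('r, 'b) module"
begin

abbreviation (input) "P \<equiv> free_mod R (carrier M \<times> carrier N)"
abbreviation (input) "K \<equiv> tensor_kernel R M N"
abbreviation (input) "T \<equiv> tensor R M N"
abbreviation (input) "pt \<equiv> pure_tensor R M N"

lemma cringR: "cring R" by unfold_locales

lemma modP: "Module.module R P" by (rule module_free_mod[OF cringR])

lemma \<delta>_closed: "u \<in> carrier M \<Longrightarrow> v \<in> carrier N \<Longrightarrow> delta R (u, v) \<in> carrier P"
  by (rule delta_closed[OF cringR]) simp

lemma tensor_relations_closed: "tensor_relations R M N \<subseteq> carrier P"
proof -
  interpret P: Module.module R P by (rule modP)
  show ?thesis
    unfolding tensor_relations_def Let_def
    by (auto intro!: P.M.minus_closed P.M.a_closed P.smult_closed \<delta>_closed)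
qed

lemma subK: "submodule K R P"
  unfolding tensor_kernel_def by (rule submodule_mod_span[OF modP tensor_relations_closed])

sublocale T: quotient R P K by (rule quotientI[OF modP subK])

lemma module_tensor: "Module.module R T"
  unfolding tensor_def by (rule T.module_quotient)

lemma relation_cos_eq:
  assumes "s \<ominus>\<^bsub>P\<^esub> t \<in> tensor_relations R M N" "s \<in> carrier P" "t \<in> carrier P"
  shows "K +>\<^bsub>P\<^esub> s = K +>\<^bsub>P\<^esub> t"
  using assms mod_span_incl[of "tensor_relations R M N" R P]
  by (subst T.cos_eq_iff) (auto simp: tensor_kernel_def)

lemma pure_closed: "u \<in> carrier M \<Longrightarrow> v \<in> carrier N \<Longrightarrow> pt u v \<in> carrier T"
  unfolding tensor_def pure_tensor_def by (rule T.cos_closed[OF \<delta>_closed])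

lemma pure_add_left:
  assumes "u \<in> carrier M" "u' \<in> carrier M" "v \<in> carrier N"
  shows "pt (u \<oplus>\<^bsub>M\<^esub> u') v = pt u v \<oplus>\<^bsub>T\<^esub> pt u' v"
proof -
  have "K +>\<^bsub>P\<^esub> delta R (u \<oplus>\<^bsub>M\<^esub> u', v) = K +>\<^bsub>P\<^esub> (delta R (u, v) \<oplus>\<^bsub>P\<^esub> delta R (u', v))"
    using assms by (intro relation_cos_eq)
      (auto intro!: \<delta>_closed T.smult_closed T.M.a_closed simp: tensor_relations_def Let_def)
  then show ?thesis using assms by (simp add: tensor_def pure_tensor_def T.cos_add \<delta>_closed)
qed

lemma pure_add_right:
  assumes "u \<in> carrier M" "v \<in> carrier N" "v' \<in> carrier N"
  shows "pt u (v \<oplus>\<^bsub>N\<^esub> v') = pt u v \<oplus>\<^bsub>T\<^esub> pt u v'"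
proof -
  have "K +>\<^bsub>P\<^esub> delta R (u, v \<oplus>\<^bsub>N\<^esub> v') = K +>\<^bsub>P\<^esub> (delta R (u, v) \<oplus>\<^bsub>P\<^esub> delta R (u, v'))"
    using assms by (intro relation_cos_eq)
      (auto intro!: \<delta>_closed T.smult_closed T.M.a_closed simp: tensor_relations_def Let_def)
  then show ?thesis using assms by (simp add: tensor_def pure_tensor_def T.cos_add \<delta>_closed)
qed

lemma pure_smult_left:
  assumes "a \<in> carrier R" "u \<in> carrier M" "v \<in> carrier N"
  shows "pt (a \<odot>\<^bsub>M\<^esub> u) v = a \<odot>\<^bsub>T\<^esub> pt u v"
proof -
  have "K +>\<^bsub>P\<^esub> delta R (a \<odot>\<^bsub>M\<^esub> u, v) = K +>\<^bsub>P\<^esub> (a \<odot>\<^bsub>P\<^esub> delta R (u, v))"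
    using assms by (intro relation_cos_eq)
      (auto intro!: \<delta>_closed T.smult_closed T.M.a_closed simp: tensor_relations_def Let_def)
  then show ?thesis using assms by (simp add: tensor_def pure_tensor_def T.cos_smult \<delta>_closed)
qed

lemma pure_smult_right:
  assumes "a \<in> carrier R" "u \<in> carrier M" "v \<in> carrier N"
  shows "pt u (a \<odot>\<^bsub>N\<^esub> v) = a \<odot>\<^bsub>T\<^esub> pt u v"
proof -
  have "K +>\<^bsub>P\<^esub> delta R (u, a \<odot>\<^bsub>N\<^esub> v) = K +>\<^bsub>P\<^esub> (a \<odot>\<^bsub>P\<^esub> delta R (u, v))"
    using assms by (intro relation_cos_eq)
      (auto intro!: \<delta>_closed T.smult_closed T.M.a_closed simp: tensor_relations_def Let_def)
  then show ?thesis using assms by (simp add: tensor_def pure_tensor_def T.cos_smult \<delta>_closed)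
qed

text \<open>Pulled back along the coset map, H becomes a submodule of the free module on pairs; the
  pure tensors are the images of the basis functions.\<close>

lemma tensor_induct:
  assumes H: "submodule H R T" and p: "\<And>u v. u \<in> carrier M \<Longrightarrow> v \<in> carrier N \<Longrightarrow> pt u v \<in> H"
    and t: "t \<in> carrier T"
  shows "t \<in> H"
proof -
  have hom: "(\<lambda>c. K +>\<^bsub>P\<^esub> c) \<in> mod_hom R P T" unfolding tensor_def by (rule T.cos_hom)
  obtain c where c: "c \<in> carrier P" "t = K +>\<^bsub>P\<^esub> c"
    using t by (auto simp: tensor_def T.carrier_quotient)
  have "c \<in> {c \<in> carrier P. K +>\<^bsub>P\<^esub> c \<in> H}"
    using p \<delta>_closed
    by (intro free_mod_induct[OF cringR submodule_preimage[OF modP module_tensor hom H] _ c(1)])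
      (auto simp: pure_tensor_def)
  then show ?thesis using c by simp
qed

lemma tensor_hom_eq:
  assumes "Module.module R L" "h \<in> mod_hom R T L" "h' \<in> mod_hom R T L"
    "\<And>u v. u \<in> carrier M \<Longrightarrow> v \<in> carrier N \<Longrightarrow> h (pt u v) = h' (pt u v)" "t \<in> carrier T"
  shows "h t = h' t"
proof -
  have "t \<in> {u \<in> carrier T. h u = h' u}"
    by (rule tensor_induct[OF submodule_equalizer[OF module_tensor assms(1-3)] _ assms(5)])
      (simp add: pure_closed assms(4))
  then show ?thesis by simp
qed

text \<open>After the closure condition there is one clause for each of the four families in
  \<open>tensor_relations\<close>.\<close>

definition balanced :: "('r, 'c) module \<Rightarrow> ('a \<Rightarrow> 'b \<Rightarrow> 'c) \<Rightarrow> bool" where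
  "balanced L \<phi> \<longleftrightarrow>
    (\<forall>u\<in>carrier M. \<forall>v\<in>carrier N. \<phi> u v \<in> carrier L) \<and>
    (\<forall>u\<in>carrier M. \<forall>u'\<in>carrier M. \<forall>v\<in>carrier N. \<phi> (u \<oplus>\<^bsub>M\<^esub> u') v = \<phi> u v \<oplus>\<^bsub>L\<^esub> \<phi> u' v) \<and>
    (\<forall>u\<in>carrier M. \<forall>v\<in>carrier N. \<forall>v'\<in>carrier N. \<phi> u (v \<oplus>\<^bsub>N\<^esub> v') = \<phi> u v \<oplus>\<^bsub>L\<^esub> \<phi> u v') \<and>
    (\<forall>a\<in>carrier R. \<forall>u\<in>carrier M. \<forall>v\<in>carrier N. \<phi> (a \<odot>\<^bsub>M\<^esub> u) v = a \<odot>\<^bsub>L\<^esub> \<phi> u v) \<and>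
    (\<forall>a\<in>carrier R. \<forall>u\<in>carrier M. \<forall>v\<in>carrier N. \<phi> u (a \<odot>\<^bsub>N\<^esub> v) = a \<odot>\<^bsub>L\<^esub> \<phi> u v)"

text \<open>The universal property of the tensor product. The map h is written with
  \<open>the_elem\<close> because \<open>tensor_map\<close> has that shape, so
  \<open>tensor_map\<close> is an instance.\<close>

lemma tensor_lift:
  assumes L: "Module.module R L" and bal: "balanced L \<phi>"
  defines "h \<equiv> \<lambda>U. the_elem (free_ext R L (\<lambda>(u, v). \<phi> u v) ` U)"
  shows "h \<in> mod_hom R T L"
    and "u \<in> carrier M \<Longrightarrow> v \<in> carrier N \<Longrightarrow> h (pt u v) = \<phi> u v"
proof -
  interpret L: Module.module R L by fact
  define f where "f = free_ext R L (\<lambda>(u, v). \<phi> u v)"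
  have g: "(\<lambda>(u, v). \<phi> u v) \<in> carrier M \<times> carrier N \<rightarrow> carrier L"
    using bal by (auto simp: balanced_def)
  have f: "f \<in> mod_hom R P L" unfolding f_def by (rule free_ext_hom[OF L g])
  note fcl = mod_hom_closed[OF f]
  have f\<delta>: "f (delta R (u, v)) = \<phi> u v" if "u \<in> carrier M" "v \<in> carrier N" for u v
    unfolding f_def using that by (subst free_ext_delta[OF L g]) auto
  have ker: "f (s \<ominus>\<^bsub>P\<^esub> t) = \<zero>\<^bsub>L\<^esub>" if "f s = f t" "s \<in> carrier P" "t \<in> carrier P" for s t
    using that fcl by (subst mod_hom_minus[OF modP L f]) (simp_all add: a_minus_def L.M.r_neg)
  have "tensor_relations R M N \<subseteq> {c \<in> carrier P. f c = \<zero>\<^bsub>L\<^esub>}"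
    using bal unfolding tensor_relations_def Let_def balanced_def
    by (auto intro!: ker T.M.minus_closed T.M.a_closed T.smult_closed \<delta>_closed
        simp: f\<delta> mod_hom_add[OF f] mod_hom_smult[OF f] \<delta>_closed)
  then have K: "K \<subseteq> {c \<in> carrier P. f c = \<zero>\<^bsub>L\<^esub>}"
    unfolding tensor_kernel_def by (rule mod_span_least[OF submodule_kernel[OF modP L f]])
  \<comment> \<open>The kernel of f contains K, so f is constant on each coset; the image is a
    singleton and \<open>the_elem\<close> returns its value.\<close>
  have hc: "h (K +>\<^bsub>P\<^esub> c) = f c" if c: "c \<in> carrier P" for c
  proof -
    have "f ` (K +>\<^bsub>P\<^esub> c) = {f c}"
    proof
      show "f ` (K +>\<^bsub>P\<^esub> c) \<subseteq> {f c}"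
        using K c fcl by (auto simp: a_r_coset_def' mod_hom_add[OF f])
      show "{f c} \<subseteq> f ` (K +>\<^bsub>P\<^esub> c)" using T.S.a_rcos_self[OF c] by blast
    qed
    then show ?thesis by (simp add: h_def f_def[symmetric])
  qed
  show "h \<in> mod_hom R T L"
    unfolding tensor_def
    by (rule mod_homI)
      (auto simp: T.carrier_quotient T.cos_add T.cos_smult hc fcl mod_hom_add[OF f] mod_hom_smult[OF f])
  show "h (pt u v) = \<phi> u v" if "u \<in> carrier M" "v \<in> carrier N"
    using that by (simp add: pure_tensor_def hc \<delta>_closed f\<delta>)
qed

end

lemma tensor_prodI: "Module.module R M \<Longrightarrow> Module.module R N \<Longrightarrow> tensor_prod R M N"
  by (simp add: tensor_prod_def)

lemma tensor_map:
  assumes M: "Module.module R M" and M': "Module.module R M'" and N: "Module.module R N"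
    and h: "h \<in> mod_hom R M M'"
  shows tensor_map_hom: "tensor_map R M' N h \<in> mod_hom R (tensor R M N) (tensor R M' N)"
    and tensor_map_pure: "u \<in> carrier M \<Longrightarrow> v \<in> carrier N \<Longrightarrow>
      tensor_map R M' N h (pure_tensor R M N u v) = pure_tensor R M' N (h u) v"
proof -
  interpret A: tensor_prod R M N by (rule tensor_prodI[OF M N])
  interpret B: tensor_prod R M' N by (rule tensor_prodI[OF M' N])
  have bal: "A.balanced (tensor R M' N) (\<lambda>u v. pure_tensor R M' N (h u) v)"
    unfolding A.balanced_def
    by (simp add: mod_hom_closed[OF h] mod_hom_add[OF h] mod_hom_smult[OF h] B.pure_closed
      B.pure_add_left B.pure_add_right B.pure_smult_left B.pure_smult_right)
  show "tensor_map R M' N h \<in> mod_hom R (tensor R M N) (tensor R M' N)"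
    using A.tensor_lift(1)[OF B.module_tensor bal]
    by (simp add: tensor_map_def[abs_def])
  show "u \<in> carrier M \<Longrightarrow> v \<in> carrier N \<Longrightarrow>
      tensor_map R M' N h (pure_tensor R M N u v) = pure_tensor R M' N (h u) v"
    using A.tensor_lift(2)[OF B.module_tensor bal]
    by (simp add: tensor_map_def[abs_def])
qed

lemma tensor_map_comp:
  assumes X: "Module.module R X" and Y: "Module.module R Y" and Z: "Module.module R Z"
    and N: "Module.module R N" and h: "h \<in> mod_hom R X Y" and g: "g \<in> mod_hom R Y Z"
    and t: "t \<in> carrier (tensor R X N)"
  shows "tensor_map R Z N (\<lambda>u. g (h u)) t = tensor_map R Z N g (tensor_map R Y N h t)"
proof -
  interpret A: tensor_prod R X N by (rule tensor_prodI[OF X N])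
  interpret C: tensor_prod R Z N by (rule tensor_prodI[OF Z N])
  show ?thesis
    by (rule A.tensor_hom_eq[OF C.module_tensor tensor_map_hom[OF X Z N mod_hom_comp[OF g h]]
          mod_hom_comp[OF tensor_map_hom[OF Y Z N g] tensor_map_hom[OF X Y N h]] _ t])
      (simp add: tensor_map_pure[OF X Z N mod_hom_comp[OF g h]] tensor_map_pure[OF X Y N h]
        tensor_map_pure[OF Y Z N g] mod_hom_closed[OF h])
qed

lemma tensor_map_id:
  assumes X: "Module.module R X" and N: "Module.module R N" and t: "t \<in> carrier (tensor R X N)"
  shows "tensor_map R X N (\<lambda>u. u) t = t"
proof -
  interpret A: tensor_prod R X N by (rule tensor_prodI[OF X N])
  show ?thesis
    by (rule A.tensor_hom_eq[OF A.module_tensor tensor_map_hom[OF X X N mod_hom_id] mod_hom_id _ t])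
      (simp add: tensor_map_pure[OF X X N mod_hom_id])
qed

lemma tensor_map_plus:
  assumes X: "Module.module R X" and Y: "Module.module R Y" and N: "Module.module R N"
    and g: "g \<in> mod_hom R X Y" and h: "h \<in> mod_hom R X Y" and t: "t \<in> carrier (tensor R X N)"
  shows "tensor_map R Y N (\<lambda>u. g u \<oplus>\<^bsub>Y\<^esub> h u) t
    = tensor_map R Y N g t \<oplus>\<^bsub>tensor R Y N\<^esub> tensor_map R Y N h t"
proof -
  interpret A: tensor_prod R X N by (rule tensor_prodI[OF X N])
  interpret B: tensor_prod R Y N by (rule tensor_prodI[OF Y N])
  show ?thesis
    by (rule A.tensor_hom_eq[OF B.module_tensor tensor_map_hom[OF X Y N mod_hom_plus[OF Y g h]]
          mod_hom_plus[OF B.module_tensor tensor_map_hom[OF X Y N g] tensor_map_hom[OF X Y N h]] _ t])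
      (simp add: tensor_map_pure[OF X Y N mod_hom_plus[OF Y g h]] tensor_map_pure[OF X Y N g]
        tensor_map_pure[OF X Y N h] mod_hom_closed[OF h] mod_hom_closed[OF g] B.pure_add_left)
qed

lemma tensor_map_zero:
  assumes X: "Module.module R X" and Y: "Module.module R Y" and N: "Module.module R N"
    and g: "g \<in> mod_hom R X Y" and t: "t \<in> carrier (tensor R X N)"
    and g0: "\<And>u. u \<in> carrier X \<Longrightarrow> g u = \<zero>\<^bsub>Y\<^esub>"
  shows "tensor_map R Y N g t = \<zero>\<^bsub>tensor R Y N\<^esub>"
proof -
  interpret A: tensor_prod R X N by (rule tensor_prodI[OF X N])
  interpret B: tensor_prod R Y N by (rule tensor_prodI[OF Y N])
  interpret TB: Module.module R "tensor R Y N" by (rule B.module_tensor)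
  have "pure_tensor R Y N \<zero>\<^bsub>Y\<^esub> v = \<zero>\<^bsub>tensor R Y N\<^esub>" if v: "v \<in> carrier N" for v
    using B.pure_smult_left[of "\<zero>\<^bsub>R\<^esub>" "\<zero>\<^bsub>Y\<^esub>" v] v B.pure_closed[of "\<zero>\<^bsub>Y\<^esub>" v] by simp
  then show ?thesis
    by (intro A.tensor_hom_eq[OF B.module_tensor tensor_map_hom[OF X Y N g]
          mod_hom_const_zero[OF B.module_tensor] _ t])
      (simp add: tensor_map_pure[OF X Y N g] g0)
qed

text \<open>The identity of X is also the zero map, so after tensoring it is both the identity and
  zero.\<close>

lemma tensor_trivial:
  assumes X: "Module.module R X" and N: "Module.module R N" and "carrier X = {\<zero>\<^bsub>X\<^esub>}"
  shows "carrier (tensor R X N) = {\<zero>\<^bsub>tensor R X N\<^esub>}"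
proof -
  interpret A: tensor_prod R X N by (rule tensor_prodI[OF X N])
  interpret TA: Module.module R "tensor R X N" by (rule A.module_tensor)
  have "t = \<zero>\<^bsub>tensor R X N\<^esub>" if t: "t \<in> carrier (tensor R X N)" for t
    using tensor_map_zero[OF X X N mod_hom_id t] tensor_map_id[OF X N t] assms(3) by auto
  then show ?thesis by auto
qed

section \<open>Congruence modulo a ring element\<close>

text \<open>Equality in X/xX, expressed by a witness in X itself so that the quotient is never
  formed.\<close>

definition xcong :: "('a, 'b, 'c) module_scheme \<Rightarrow> 'a \<Rightarrow> 'b \<Rightarrow> 'b \<Rightarrow> bool" where
  "xcong X x u v \<longleftrightarrow> (\<exists>z\<in>carrier X. u = v \<oplus>\<^bsub>X\<^esub> x \<odot>\<^bsub>X\<^esub> z)"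

context
  fixes R :: "('r, 'z) ring_scheme" and X :: "('r, 'a) module" and x :: 'r
  assumes X: "Module.module R X" and x: "x \<in> carrier R"
begin

interpretation X: Module.module R X by (rule X)

lemma xcong_refl: "u \<in> carrier X \<Longrightarrow> xcong X x u u"
  unfolding xcong_def using x by (intro bexI[of _ "\<zero>\<^bsub>X\<^esub>"]) auto

lemma xcong_sym: "xcong X x u v \<Longrightarrow> v \<in> carrier X \<Longrightarrow> xcong X x v u"
  unfolding xcong_def
proof (elim bexE)
  fix z assume "v \<in> carrier X" "z \<in> carrier X" "u = v \<oplus>\<^bsub>X\<^esub> x \<odot>\<^bsub>X\<^esub> z"
  then show "\<exists>z\<in>carrier X. v = u \<oplus>\<^bsub>X\<^esub> x \<odot>\<^bsub>X\<^esub> z"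
    using x by (intro bexI[of _ "\<ominus>\<^bsub>X\<^esub> z"]) (auto simp: X.smult_r_minus X.M.a_assoc X.M.r_neg)
qed

lemma xcong_trans: "xcong X x u v \<Longrightarrow> xcong X x v w \<Longrightarrow> w \<in> carrier X \<Longrightarrow> xcong X x u w"
  unfolding xcong_def
proof (elim bexE)
  fix z z' assume "w \<in> carrier X" "z \<in> carrier X" "z' \<in> carrier X"
    "u = v \<oplus>\<^bsub>X\<^esub> x \<odot>\<^bsub>X\<^esub> z" "v = w \<oplus>\<^bsub>X\<^esub> x \<odot>\<^bsub>X\<^esub> z'"
  then show "\<exists>z\<in>carrier X. u = w \<oplus>\<^bsub>X\<^esub> x \<odot>\<^bsub>X\<^esub> z"
    using x by (intro bexI[of _ "z' \<oplus>\<^bsub>X\<^esub> z"]) (auto simp: X.smult_r_distr X.M.a_assoc)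
qed

lemma xcong_add:
  "xcong X x u v \<Longrightarrow> xcong X x u' v' \<Longrightarrow> v \<in> carrier X \<Longrightarrow> v' \<in> carrier X \<Longrightarrow>
    xcong X x (u \<oplus>\<^bsub>X\<^esub> u') (v \<oplus>\<^bsub>X\<^esub> v')"
  unfolding xcong_def
proof (elim bexE)
  fix z z' assume "v \<in> carrier X" "v' \<in> carrier X" "z \<in> carrier X" "z' \<in> carrier X"
    "u = v \<oplus>\<^bsub>X\<^esub> x \<odot>\<^bsub>X\<^esub> z" "u' = v' \<oplus>\<^bsub>X\<^esub> x \<odot>\<^bsub>X\<^esub> z'"
  then show "\<exists>z\<in>carrier X. u \<oplus>\<^bsub>X\<^esub> u' = v \<oplus>\<^bsub>X\<^esub> v' \<oplus>\<^bsub>X\<^esub> x \<odot>\<^bsub>X\<^esub> z"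
    using x by (intro bexI[of _ "z \<oplus>\<^bsub>X\<^esub> z'"]) (auto simp: X.smult_r_distr X.M.a_ac)
qed

lemma xcong_smult:
  "xcong X x u v \<Longrightarrow> a \<in> carrier R \<Longrightarrow> v \<in> carrier X \<Longrightarrow> xcong X x (a \<odot>\<^bsub>X\<^esub> u) (a \<odot>\<^bsub>X\<^esub> v)"
  unfolding xcong_def
proof (elim bexE)
  fix z assume *: "a \<in> carrier R" "v \<in> carrier X" "z \<in> carrier X" "u = v \<oplus>\<^bsub>X\<^esub> x \<odot>\<^bsub>X\<^esub> z"
  have "a \<odot>\<^bsub>X\<^esub> (x \<odot>\<^bsub>X\<^esub> z) = x \<odot>\<^bsub>X\<^esub> (a \<odot>\<^bsub>X\<^esub> z)"
    using x * by (simp add: X.smult_assoc1[symmetric] X.R.m_comm)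
  then show "\<exists>z\<in>carrier X. a \<odot>\<^bsub>X\<^esub> u = a \<odot>\<^bsub>X\<^esub> v \<oplus>\<^bsub>X\<^esub> x \<odot>\<^bsub>X\<^esub> z"
    using x * by (intro bexI[of _ "a \<odot>\<^bsub>X\<^esub> z"]) (auto simp: X.smult_r_distr)
qed

lemma xcong_uminus:
  "xcong X x u v \<Longrightarrow> v \<in> carrier X \<Longrightarrow> u \<in> carrier X \<Longrightarrow> xcong X x (\<ominus>\<^bsub>X\<^esub> u) (\<ominus>\<^bsub>X\<^esub> v)"
  using xcong_smult[of u v "\<ominus>\<^bsub>R\<^esub> \<one>\<^bsub>R\<^esub>"] by (simp add: X.smult_l_minus)

lemma xcong_minus:
  "xcong X x u v \<Longrightarrow> xcong X x u' v' \<Longrightarrow> v \<in> carrier X \<Longrightarrow> u' \<in> carrier X \<Longrightarrow> v' \<in> carrier X \<Longrightarrow>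
    xcong X x (u \<ominus>\<^bsub>X\<^esub> u') (v \<ominus>\<^bsub>X\<^esub> v')"
  unfolding a_minus_def by (intro xcong_add xcong_uminus) auto

lemma xcong_hom:
  assumes "Module.module R Y" "h \<in> mod_hom R X Y" "xcong X x u v" "v \<in> carrier X"
  shows "xcong Y x (h u) (h v)"
proof -
  obtain z where "z \<in> carrier X" "u = v \<oplus>\<^bsub>X\<^esub> x \<odot>\<^bsub>X\<^esub> z" using assms by (auto simp: xcong_def)
  then show ?thesis unfolding xcong_def using x assms
    by (intro bexI[of _ "h z"]) (auto simp: mod_hom_add[OF assms(2)] mod_hom_smult[OF assms(2)]
        mod_hom_closed[OF assms(2)])
qed

lemma xcong_smult_zero: "u \<in> carrier X \<Longrightarrow> xcong X x (x \<odot>\<^bsub>X\<^esub> u) \<zero>\<^bsub>X\<^esub>"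
  unfolding xcong_def using x by (intro bexI[of _ u]) auto

lemma xcong_killed:
  "xcong X x u v \<Longrightarrow> v \<in> carrier X \<Longrightarrow> (\<And>z. z \<in> carrier X \<Longrightarrow> x \<odot>\<^bsub>X\<^esub> z = \<zero>\<^bsub>X\<^esub>) \<Longrightarrow> u = v"
  unfolding xcong_def by auto

end

text \<open>This makes ordinary resolutions the case x = 0 of resolutions modulo x.\<close>

lemma xcong_zero_iff:
  assumes "Module.module R X" "v \<in> carrier X"
  shows "xcong X \<zero>\<^bsub>R\<^esub> u v \<longleftrightarrow> u = v"
proof -
  interpret X: Module.module R X by fact
  show ?thesis using assms(2) by (auto simp: xcong_def)
qed

text \<open>Because x z \<otimes> v = z \<otimes> x v = 0 when x kills N, tensoring with N turns
  congruences into equalities. Every passage from a complex modulo x to an honest complex rests on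
  this.\<close>

lemma tensor_map_xcong:
  assumes X: "Module.module R X" and Y: "Module.module R Y" and N: "Module.module R N"
    and x: "x \<in> carrier R" and xN: "\<forall>v\<in>carrier N. x \<odot>\<^bsub>N\<^esub> v = \<zero>\<^bsub>N\<^esub>"
    and g: "g \<in> mod_hom R X Y" and h: "h \<in> mod_hom R X Y" and t: "t \<in> carrier (tensor R X N)"
    and gh: "\<And>u. u \<in> carrier X \<Longrightarrow> xcong Y x (g u) (h u)"
  shows "tensor_map R Y N g t = tensor_map R Y N h t"
proof -
  interpret A: tensor_prod R X N by (rule tensor_prodI[OF X N])
  interpret B: tensor_prod R Y N by (rule tensor_prodI[OF Y N])
  interpret TB: Module.module R "tensor R Y N" by (rule B.module_tensor)
  have "pure_tensor R Y N (g u) v = pure_tensor R Y N (h u) v"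
    if u: "u \<in> carrier X" and v: "v \<in> carrier N" for u v
  proof -
    obtain z where z: "z \<in> carrier Y" "g u = h u \<oplus>\<^bsub>Y\<^esub> x \<odot>\<^bsub>Y\<^esub> z" using gh[OF u] by (auto simp: xcong_def)
    have "pure_tensor R Y N (x \<odot>\<^bsub>Y\<^esub> z) v = pure_tensor R Y N z (x \<odot>\<^bsub>N\<^esub> v)"
      using x z v by (simp add: B.pure_smult_left B.pure_smult_right)
    \<comment> \<open>The zero vector is rewritten as a multiple by 0, so that the scalar can be
      moved out of the tensor.\<close>
    also have "\<dots> = pure_tensor R Y N z (\<zero>\<^bsub>R\<^esub> \<odot>\<^bsub>N\<^esub> v)" using xN v by simp
    also have "\<dots> = \<zero>\<^bsub>tensor R Y N\<^esub>"
      using z v B.pure_closed by (subst B.pure_smult_right) auto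
    finally show ?thesis
      using x z u v mod_hom_closed[OF h u] B.pure_closed by (simp add: B.pure_add_left)
  qed
  then show ?thesis
    by (intro A.tensor_hom_eq[OF B.module_tensor tensor_map_hom[OF X Y N g] tensor_map_hom[OF X Y N h] _ t])
      (simp add: tensor_map_pure[OF X Y N g] tensor_map_pure[OF X Y N h])
qed

section \<open>Length\<close>

text \<open>Submodules between B and Z correspond to submodules of Z/B. Counting strict chains of
  them gives the length of Z/B while staying inside M.\<close>

definition submodule_chain ::
  "('r, 'z) ring_scheme \<Rightarrow> ('r, 'a) module \<Rightarrow> 'a set \<Rightarrow> 'a set \<Rightarrow> nat \<Rightarrow> bool" where
  "submodule_chain R M B Z n \<longleftrightarrow> (\<exists>C. (\<forall>i\<le>n. submodule (C i) R M \<and> B \<subseteq> C i \<and> C i \<subseteq> Z) \<and>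
     (\<forall>i<n. C i \<subset> C (Suc i)))"

definition rel_length ::
  "('r, 'z) ring_scheme \<Rightarrow> ('r, 'a) module \<Rightarrow> 'a set \<Rightarrow> 'a set \<Rightarrow> enat" where
  "rel_length R M B Z = Sup {enat n | n. submodule_chain R M B Z n}"

lemma module_length_eq_rel_length:
  "module_length R M = rel_length R M {\<zero>\<^bsub>M\<^esub>} (carrier M)"
proof -
  have "submodule_chain R M {\<zero>\<^bsub>M\<^esub>} (carrier M) n \<longleftrightarrow>
      (\<exists>C. (\<forall>i\<le>n. submodule (C i) R M) \<and> (\<forall>i<n. C i \<subset> C (Suc i)))" for n
    unfolding submodule_chain_def using submodule_zero submodule_subset
    by (metis empty_subsetI insert_subset)
  then show ?thesis by (simp add: module_length_def rel_length_def)
qed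

lemma submodule_chain_mono:
  assumes "submodule_chain R M B Z n" "m \<le> n" "Z \<subseteq> Z'"
  shows "submodule_chain R M B Z' m"
proof -
  obtain C where C: "\<And>i. i \<le> n \<Longrightarrow> submodule (C i) R M" "\<And>i. i \<le> n \<Longrightarrow> B \<subseteq> C i"
      "\<And>i. i \<le> n \<Longrightarrow> C i \<subseteq> Z" "\<And>i. i < n \<Longrightarrow> C i \<subset> C (Suc i)"
    using assms(1) unfolding submodule_chain_def by auto
  have "C i \<subseteq> Z'" if "i \<le> m" for i using C(3)[of i] that assms(2,3) by auto
  then show ?thesis
    unfolding submodule_chain_def using C assms(2) by (intro exI[of _ C]) auto
qed

text \<open>If n = k + 1 is at most the supremum, some chain is longer than k and can be truncated
  to n steps. Thus a finite lower bound for the length is always witnessed by a chain.\<close>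

lemma enat_le_rel_length_iff:
  assumes "submodule B R M" "B \<subseteq> Z"
  shows "enat n \<le> rel_length R M B Z \<longleftrightarrow> submodule_chain R M B Z n"
proof
  show "submodule_chain R M B Z n \<Longrightarrow> enat n \<le> rel_length R M B Z"
    unfolding rel_length_def by (auto intro: Sup_upper)
  assume le: "enat n \<le> rel_length R M B Z"
  show "submodule_chain R M B Z n"
  proof (cases n)
    case 0
    then show ?thesis using assms unfolding submodule_chain_def by (intro exI[of _ "\<lambda>_. B"]) auto
  next
    case (Suc k)
    then have "enat k < rel_length R M B Z" using le less_le_trans[of "enat k" "enat n"] by simp
    then obtain m where "submodule_chain R M B Z m" "k < m"
      unfolding rel_length_def less_Sup_iff by auto
    then show ?thesis using Suc submodule_chain_mono[of R M B Z m n Z] by auto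
  qed
qed

text \<open>Testing on finite lower bounds allows finite and infinite lengths to be treated
  together.\<close>

lemma enat_le_by_nats:
  assumes "\<And>n. enat n \<le> a \<Longrightarrow> enat n \<le> b"
  shows "a \<le> (b :: enat)"
proof (cases a)
  case (enat n)
  then show ?thesis using assms[of n] by simp
next
  case infinity
  have "b = \<infinity>"
  proof (rule ccontr)
    assume "b \<noteq> \<infinity>"
    then obtain m where "b = enat m" by auto
    then show False using assms[of "Suc m"] infinity by simp
  qed
  then show ?thesis by simp
qed

lemma submodule_chain_extend:
  assumes "submodule_chain R M B Z n" "submodule Z' R M" "Z \<subset> Z'"
  shows "submodule_chain R M B Z' (Suc n)"
proof -
  obtain C where C: "\<And>i. i \<le> n \<Longrightarrow> submodule (C i) R M" "\<And>i. i \<le> n \<Longrightarrow> B \<subseteq> C i"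
      "\<And>i. i \<le> n \<Longrightarrow> C i \<subseteq> Z" "\<And>i. i < n \<Longrightarrow> C i \<subset> C (Suc i)"
    using assms(1) unfolding submodule_chain_def by auto
  have "B \<subseteq> Z'" using C(2,3)[of n] assms(3) by auto
  have "C i \<subseteq> Z'" if "i \<le> n" for i using C(3)[OF that] assms(3) by auto
  show ?thesis
    unfolding submodule_chain_def
  proof (intro exI[of _ "\<lambda>i. if i \<le> n then C i else Z'"] conjI allI impI)
    fix i assume "i < Suc n"
    then show "(if i \<le> n then C i else Z') \<subset> (if Suc i \<le> n then C (Suc i) else Z')"
      using C(3)[of n] C(4)[of i] assms(3) by (cases "i = n") auto
  qed (use C(1,2) \<open>B \<subseteq> Z'\<close> \<open>\<And>i. i \<le> n \<Longrightarrow> C i \<subseteq> Z'\<close> assms(2) in auto)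
qed

text \<open>A chain C between B and Z gives the two sequences C i \<inter> K and C i + K, and each
  strict step of C is strict in at least one of them. Conversely, a chain below K followed by a
  chain above K is a chain between B and Z.\<close>

lemma rel_length_add:
  assumes M: "Module.module R M" and B: "submodule B R M" and K: "submodule K R M"
    and Z: "submodule Z R M" and "B \<subseteq> K" "K \<subseteq> Z"
  shows "rel_length R M B Z = rel_length R M B K + rel_length R M K Z"
proof (rule antisym)
  interpret M: Module.module R M by fact
  note iff1 = enat_le_rel_length_iff[OF B order_trans[OF \<open>B \<subseteq> K\<close> \<open>K \<subseteq> Z\<close>]]
    and iff2 = enat_le_rel_length_iff[OF B \<open>B \<subseteq> K\<close>] and iff3 = enat_le_rel_length_iff[OF K \<open>K \<subseteq> Z\<close>]
  define S where "S = (\<lambda>C. {c \<oplus>\<^bsub>M\<^esub> k | c k. c \<in> C \<and> k \<in> K})"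
  have subS: "submodule (S C) R M" if "submodule C R M" for C
    unfolding S_def by (rule submodule_sum[OF M that K])
  have KS: "K \<subseteq> S C" and CS: "C \<subseteq> S C" if "submodule C R M" for C
  proof -
    show "K \<subseteq> S C"
    proof
      fix k assume "k \<in> K"
      then have "k = \<zero>\<^bsub>M\<^esub> \<oplus>\<^bsub>M\<^esub> k" using submodule_subset[OF K] by auto
      then show "k \<in> S C" using \<open>k \<in> K\<close> submodule_zero[OF that] unfolding S_def by blast
    qed
    show "C \<subseteq> S C"
    proof
      fix c assume "c \<in> C"
      then have "c = c \<oplus>\<^bsub>M\<^esub> \<zero>\<^bsub>M\<^esub>" using submodule_subset[OF that] by auto
      then show "c \<in> S C" using \<open>c \<in> C\<close> submodule_zero[OF K] unfolding S_def by blast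
    qed
  qed
  have subI: "submodule (C \<inter> K) R M" if "submodule C R M" for C
    using submodule_Inter[OF M, of "{C, K}"] that K by auto
  show "rel_length R M B Z \<le> rel_length R M B K + rel_length R M K Z"
  proof (rule enat_le_by_nats)
    fix n assume "enat n \<le> rel_length R M B Z"
    then obtain C where C: "\<forall>i\<le>n. submodule (C i) R M \<and> B \<subseteq> C i \<and> C i \<subseteq> Z" "\<forall>i<n. C i \<subset> C (Suc i)"
      using iff1 unfolding submodule_chain_def by auto
    \<comment> \<open>The numbers a and b count the strict steps among the first i, in the
      intersections and in the sums.\<close>
    have "\<exists>a b. i \<le> a + b \<and> submodule_chain R M B (C i \<inter> K) a \<and> submodule_chain R M K (S (C i)) b"
      if "i \<le> n" for i
      using that
    proof (induction i)
      case 0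
      then have "submodule_chain R M B (C 0 \<inter> K) 0" "submodule_chain R M K (S (C 0)) 0"
        unfolding submodule_chain_def using C B K \<open>B \<subseteq> K\<close> KS[of "C 0"] by auto
      then show ?case by blast
    next
      case (Suc i)
      then obtain a b where ab: "i \<le> a + b" "submodule_chain R M B (C i \<inter> K) a"
          "submodule_chain R M K (S (C i)) b"
        by auto
      have Ci: "submodule (C i) R M" "submodule (C (Suc i)) R M" "C i \<subset> C (Suc i)"
        using C Suc by auto
      have le: "C i \<inter> K \<subseteq> C (Suc i) \<inter> K" "S (C i) \<subseteq> S (C (Suc i))" using Ci by (auto simp: S_def)
      \<comment> \<open>The modular law: if c = c' + k with c' in C i and k in K, then k = c - c'
        lies in the intersection of C (Suc i) with K. If neither sequence grew, k and hence c would
        lie in C i.\<close>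
      have ne: "C i \<inter> K \<noteq> C (Suc i) \<inter> K \<or> S (C i) \<noteq> S (C (Suc i))"
      proof (rule ccontr)
        assume "\<not> ?thesis"
        then have eq: "C i \<inter> K = C (Suc i) \<inter> K" "S (C i) = S (C (Suc i))" by auto
        have "C (Suc i) \<subseteq> C i"
        proof
          fix c assume c: "c \<in> C (Suc i)"
          then have "c \<in> S (C i)" using CS[OF Ci(2)] eq by auto
          then obtain c' k where ck: "c = c' \<oplus>\<^bsub>M\<^esub> k" "c' \<in> C i" "k \<in> K" by (auto simp: S_def)
          have cr: "c' \<in> carrier M" "k \<in> carrier M"
            using ck submodule_subset[OF Ci(1)] submodule_subset[OF K] by auto
          have "k = c \<ominus>\<^bsub>M\<^esub> c'" using ck cr by (simp add: M.M.add_minus_cancel_left)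
          also have "\<dots> \<in> C (Suc i)" using c ck Ci by (intro submodule_minus[OF Ci(2)]) auto
          finally have "k \<in> C i" using ck eq by auto
          then show "c \<in> C i" using ck submodule_add[OF Ci(1)] by auto
        qed
        then show False using Ci by auto
      qed
      show ?case
      proof (cases "C i \<inter> K = C (Suc i) \<inter> K")
        case True
        then have "submodule_chain R M K (S (C (Suc i))) (Suc b)"
          using ne le by (intro submodule_chain_extend[OF ab(3) subS[OF Ci(2)]]) auto
        then show ?thesis using ab True by (intro exI[of _ a] exI[of _ "Suc b"]) auto
      next
        case False
        then have "submodule_chain R M B (C (Suc i) \<inter> K) (Suc a)"
          using ne le by (intro submodule_chain_extend[OF ab(2) subI[OF Ci(2)]]) auto
        moreover have "submodule_chain R M K (S (C (Suc i))) b"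
          using submodule_chain_mono[OF ab(3) order_refl le(2)] .
        ultimately show ?thesis using ab by (intro exI[of _ "Suc a"] exI[of _ b]) auto
      qed
    qed
    then obtain a b where ab: "n \<le> a + b" "submodule_chain R M B (C n \<inter> K) a"
        "submodule_chain R M K (S (C n)) b"
      by blast
    have "S (C n) \<subseteq> Z"
      using C \<open>K \<subseteq> Z\<close> submodule_add[OF Z] unfolding S_def by blast
    then have "enat a \<le> rel_length R M B K" "enat b \<le> rel_length R M K Z"
      unfolding iff2 iff3 using submodule_chain_mono[OF ab(2) order_refl, of K]
        submodule_chain_mono[OF ab(3) order_refl, of Z] by auto
    then have "enat a + enat b \<le> rel_length R M B K + rel_length R M K Z" by (rule add_mono)
    then show "enat n \<le> rel_length R M B K + rel_length R M K Z"
      using ab(1) by (metis enat_ord_simps(1) order_trans plus_enat_simps(1))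
  qed
  show "rel_length R M B K + rel_length R M K Z \<le> rel_length R M B Z"
  proof (rule enat_le_by_nats)
    fix n assume n: "enat n \<le> rel_length R M B K + rel_length R M K Z"
    \<comment> \<open>If one of the two lengths is infinite, all n steps are taken from it and none
      from the other.\<close>
    obtain a b where ab: "n \<le> a + b" "enat a \<le> rel_length R M B K" "enat b \<le> rel_length R M K Z"
    proof (cases "rel_length R M B K")
      case (enat a)
      show thesis
      proof (cases "rel_length R M K Z")
        case (enat b)
        then show thesis using n that[of a b] \<open>rel_length R M B K = enat a\<close> by auto
      next
        case infinity
        then show thesis using that[of 0 n] by (auto simp: zero_enat_def[symmetric])
      qed
    next
      case infinity
      then show thesis using that[of n 0] by (auto simp: zero_enat_def[symmetric])
    qed
    then obtain C D where C: "\<forall>i\<le>a. submodule (C i) R M \<and> B \<subseteq> C i \<and> C i \<subseteq> K" "\<forall>i<a. C i \<subset> C (Suc i)"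
      and D: "\<forall>i\<le>b. submodule (D i) R M \<and> K \<subseteq> D i \<and> D i \<subseteq> Z" "\<forall>i<b. D i \<subset> D (Suc i)"
      unfolding iff2 iff3 unfolding submodule_chain_def by auto
    \<comment> \<open>The last member C a is replaced by D 0, which contains it, so the combined
      chain still has a + b strict steps.\<close>
    have "submodule (if i < a then C i else D (i - a)) R M \<and> B \<subseteq> (if i < a then C i else D (i - a))
        \<and> (if i < a then C i else D (i - a)) \<subseteq> Z" if "i \<le> a + b" for i
    proof (cases "i < a")
      case True
      then have "submodule (C i) R M \<and> B \<subseteq> C i \<and> C i \<subseteq> K" using C by auto
      then show ?thesis using True \<open>K \<subseteq> Z\<close> by auto
    next
      case False
      then have "submodule (D (i - a)) R M \<and> K \<subseteq> D (i - a) \<and> D (i - a) \<subseteq> Z" using D that by auto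
      then show ?thesis using False \<open>B \<subseteq> K\<close> by auto
    qed
    then have "submodule_chain R M B Z (a + b)"
      unfolding submodule_chain_def
    proof (intro exI[of _ "\<lambda>i. if i < a then C i else D (i - a)"] conjI allI impI)
      fix i assume "i < a + b"
      show "(if i < a then C i else D (i - a)) \<subset> (if Suc i < a then C (Suc i) else D (Suc i - a))"
      proof (cases "i < a")
        case True
        show ?thesis
        proof (cases "Suc i < a")
          case False
          then have [simp]: "Suc i = a" "Suc i - a = 0" using True by auto
          have "C i \<subset> C a" using C(2) True \<open>Suc i = a\<close> by metis
          moreover have "C a \<subseteq> K" "K \<subseteq> D 0" using C D by auto
          ultimately have "C i \<subset> D 0" by blast
          then show ?thesis using True by auto
        qed (use C True in auto)
      next
        case False
        then show ?thesis using D \<open>i < a + b\<close> by (auto simp: Suc_diff_le)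
      qed
    qed blast+
    then show "enat n \<le> rel_length R M B Z"
      unfolding iff1 using ab(1) submodule_chain_mono by blast
  qed
qed

text \<open>The hypotheses say that f induces an isomorphism from Z/B to Z'/B'. Linearity is asked
  on Z, so that maps defined on a submodule qualify, such as the coset map in
  \<open>module_length_quotient\<close>.\<close>

lemma rel_length_hom:
  assumes M: "Module.module R M" and M': "Module.module R M'"
    and B: "submodule B R M" and Z: "submodule Z R M" and BZ: "B \<subseteq> Z"
    and B': "submodule B' R M'" and Z': "submodule Z' R M'" and BZ': "B' \<subseteq> Z'"
    and fZ: "\<And>z. z \<in> Z \<Longrightarrow> f z \<in> Z'"
    and fadd: "\<And>u v. u \<in> Z \<Longrightarrow> v \<in> Z \<Longrightarrow> f (u \<oplus>\<^bsub>M\<^esub> v) = f u \<oplus>\<^bsub>M'\<^esub> f v"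
    and fsm: "\<And>a u. a \<in> carrier R \<Longrightarrow> u \<in> Z \<Longrightarrow> f (a \<odot>\<^bsub>M\<^esub> u) = a \<odot>\<^bsub>M'\<^esub> f u"
    and finj: "\<And>z. z \<in> Z \<Longrightarrow> f z \<in> B' \<longleftrightarrow> z \<in> B"
    and fsurj: "\<And>z'. z' \<in> Z' \<Longrightarrow> \<exists>z\<in>Z. z' \<ominus>\<^bsub>M'\<^esub> f z \<in> B'"
  shows "rel_length R M B Z = rel_length R M' B' Z'"
proof -
  interpret M: Module.module R M by fact
  interpret M': Module.module R M' by fact
  note Zs = submodule_subset[OF Z] and Zs' = submodule_subset[OF Z']
  have f: "f \<in> mod_hom R (M\<lparr>carrier := Z\<rparr>) M'"
    by (rule mod_homI) (use fZ fadd fsm Zs' in auto)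
  have MZ: "Module.module R (M\<lparr>carrier := Z\<rparr>)"
    by (rule submodule.submodule_is_module[OF Z M])
  have sub_Z: "submodule H R (M\<lparr>carrier := Z\<rparr>)" if "submodule H R M" "H \<subseteq> Z" for H
    by (rule submodule_intro[OF MZ])
      (use that submodule_zero[OF that(1)] submodule_add[OF that(1)] submodule_smult[OF that(1)] in auto)
  have sub_M: "submodule H R M" if "submodule H R (M\<lparr>carrier := Z\<rparr>)" for H
    by (rule submodule_intro[OF M])
      (use submodule_subset[OF that] submodule_zero[OF that] submodule_add[OF that] submodule_smult[OF that] Zs in auto)
  have *: "submodule_chain R M B Z n \<longleftrightarrow> submodule_chain R M' B' Z' n" for n
  proof
    assume "submodule_chain R M B Z n"
    then obtain C where C: "\<And>i. i\<le>n \<Longrightarrow> submodule (C i) R M" "\<And>i. i\<le>n \<Longrightarrow> B \<subseteq> C i" "\<And>i. i\<le>n \<Longrightarrow> C i \<subseteq> Z"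
        "\<And>i. i<n \<Longrightarrow> C i \<subset> C (Suc i)"
      unfolding submodule_chain_def by auto
    \<comment> \<open>The image of C i need not contain B', so B' is added.\<close>
    define D where "D i = {h \<oplus>\<^bsub>M'\<^esub> k | h k. h \<in> f ` C i \<and> k \<in> B'}" for i
    have subD: "submodule (D i) R M'" if "i \<le> n" for i
      unfolding D_def
      by (rule submodule_sum[OF M' submodule_image[OF MZ M' f sub_Z] B']) (use C that in auto)
    have BD: "B' \<subseteq> D i" if "i \<le> n" for i
    proof
      fix b assume b: "b \<in> B'"
      have "f \<zero>\<^bsub>M\<^esub> = \<zero>\<^bsub>M'\<^esub>" using mod_hom_zero[OF MZ M' f] by simp
      then have "b = f \<zero>\<^bsub>M\<^esub> \<oplus>\<^bsub>M'\<^esub> b" using b submodule_subset[OF B'] by auto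
      then show "b \<in> D i" using b submodule_zero[OF C(1)[OF that]] unfolding D_def by blast
    qed
    have DZ: "D i \<subseteq> Z'" if "i \<le> n" for i
      using C(3)[OF that] fZ BZ' submodule_add[OF Z'] unfolding D_def by blast
    have DD: "D i \<subset> D (Suc i)" if i: "i < n" for i
    proof
      show "D i \<subseteq> D (Suc i)" using C(4)[OF i] unfolding D_def by blast
      obtain c where c: "c \<in> C (Suc i)" "c \<notin> C i" using C(4)[OF i] by auto
      have sub: "submodule (C i) R M" "B \<subseteq> C i" "C i \<subseteq> Z" "c \<in> Z" using C[of i] C(3)[of "Suc i"] c i by auto
      have fc: "f c \<in> carrier M'" using fZ sub Zs' by auto
      have "f c = f c \<oplus>\<^bsub>M'\<^esub> \<zero>\<^bsub>M'\<^esub>" using fc by simp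
      then have "f c \<in> D (Suc i)" using c submodule_zero[OF B'] unfolding D_def by blast
      moreover have "f c \<notin> D i"
      proof
        assume "f c \<in> D i"
        then obtain c' b where cb: "f c = f c' \<oplus>\<^bsub>M'\<^esub> b" "c' \<in> C i" "b \<in> B'" by (auto simp: D_def)
        have c'Z: "c' \<in> Z" "c' \<in> carrier M" "c \<in> carrier M" using cb sub Zs by auto
        have cr: "f c' \<in> carrier M'" "b \<in> carrier M'"
          using c'Z(1) cb fZ Zs' submodule_subset[OF B'] by auto
        have "f (c \<ominus>\<^bsub>M\<^esub> c') = f c \<ominus>\<^bsub>M'\<^esub> f c'"
        proof -
          have neg: "f (\<ominus>\<^bsub>M\<^esub> c') = \<ominus>\<^bsub>M'\<^esub> f c'"
            using fsm[of "\<ominus>\<^bsub>R\<^esub> \<one>\<^bsub>R\<^esub>" c'] c'Z cr by (simp add: M.smult_l_minus M'.smult_l_minus)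
          show ?thesis unfolding a_minus_def
            using fadd[OF \<open>c \<in> Z\<close> submodule_uminus[OF Z c'Z(1)]] neg by simp
        qed
        also have "\<dots> = b" using cb cr by (simp add: M'.M.add_minus_cancel_left)
        finally have "c \<ominus>\<^bsub>M\<^esub> c' \<in> B" using finj[of "c \<ominus>\<^bsub>M\<^esub> c'"] cb submodule_minus[OF Z \<open>c \<in> Z\<close> c'Z(1)] by simp
        then have "(c \<ominus>\<^bsub>M\<^esub> c') \<oplus>\<^bsub>M\<^esub> c' \<in> C i"
          using sub(2) by (intro submodule_add[OF sub(1) _ cb(2)]) auto
        then show False using c c'Z by (simp add: M.M.minus_add_cancel)
      qed
      ultimately show "D i \<noteq> D (Suc i)" by auto
    qed
    show "submodule_chain R M' B' Z' n"
      unfolding submodule_chain_def using subD BD DZ DD by (intro exI[of _ D]) auto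
  next
    assume "submodule_chain R M' B' Z' n"
    then obtain D where D: "\<And>i. i\<le>n \<Longrightarrow> submodule (D i) R M'" "\<And>i. i\<le>n \<Longrightarrow> B' \<subseteq> D i" "\<And>i. i\<le>n \<Longrightarrow> D i \<subseteq> Z'"
        "\<And>i. i<n \<Longrightarrow> D i \<subset> D (Suc i)"
      unfolding submodule_chain_def by auto
    define C where "C i = {u \<in> Z. f u \<in> D i}" for i
    have subC: "submodule (C i) R M" if "i \<le> n" for i
      using sub_M submodule_preimage[OF MZ M' f D(1)[OF that]] by (simp add: C_def)
    have CC: "C i \<subset> C (Suc i)" if i: "i < n" for i
    proof
      show "C i \<subseteq> C (Suc i)" using D(4)[OF i] by (auto simp: C_def)
      obtain y where y: "y \<in> D (Suc i)" "y \<notin> D i" using D(4)[OF i] by auto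
      \<comment> \<open>y itself may lie outside the image of f; its class modulo B' is hit, and
        every D i contains B', so z separates the two preimages.\<close>
      obtain z where z: "z \<in> Z" "y \<ominus>\<^bsub>M'\<^esub> f z \<in> B'" using fsurj[of y] D(3)[of "Suc i"] i y by auto
      have cr: "y \<in> carrier M'" "f z \<in> carrier M'" using y z fZ D(3)[of "Suc i"] i Zs' by auto
      have sub: "submodule (D i) R M'" "submodule (D (Suc i)) R M'" "B' \<subseteq> D i" "B' \<subseteq> D (Suc i)"
        using D i by auto
      have "f z = y \<ominus>\<^bsub>M'\<^esub> (y \<ominus>\<^bsub>M'\<^esub> f z)"
        using cr by (simp add: M'.M.minus_minus_cancel)
      also have "\<dots> \<in> D (Suc i)" by (rule submodule_minus[OF sub(2) y(1)]) (use z(2) sub(4) in auto)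
      finally have "z \<in> C (Suc i)" using z by (simp add: C_def)
      moreover have "z \<notin> C i"
      proof
        assume "z \<in> C i"
        then have "(y \<ominus>\<^bsub>M'\<^esub> f z) \<oplus>\<^bsub>M'\<^esub> f z \<in> D i" using z sub submodule_add[OF sub(1)] by (auto simp: C_def)
        then show False using y cr by (simp add: M'.M.minus_add_cancel)
      qed
      ultimately show "C i \<noteq> C (Suc i)" by auto
    qed
    have BC: "B \<subseteq> C i" if "i \<le> n" for i
      using D(2)[OF that] finj BZ by (auto simp: C_def)
    show "submodule_chain R M B Z n"
      unfolding submodule_chain_def using subC BC CC by (intro exI[of _ C]) (auto simp: C_def)
  qed
  show ?thesis unfolding rel_length_def by (simp add: *)
qed

text \<open>The quotient has the form used in \<open>homology\<close>: the carrier is shrunk to the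
  cycles Z before dividing by B.\<close>

lemma module_length_quotient:
  assumes M: "Module.module R M" and Z: "submodule Z R M" and B: "submodule B R M" and BZ: "B \<subseteq> Z"
  shows "module_length R (quotient_module R (M\<lparr>carrier := Z\<rparr>) B) = rel_length R M B Z"
proof -
  let ?MZ = "M\<lparr>carrier := Z\<rparr>"
  have MZ: "Module.module R ?MZ" by (rule submodule.submodule_is_module[OF Z M])
  have BM: "submodule B R ?MZ"
    by (rule submodule_intro[OF MZ])
      (use BZ submodule_zero[OF B] submodule_add[OF B] submodule_smult[OF B] in auto)
  interpret q: quotient R ?MZ B by (rule quotientI[OF MZ BM])
  interpret qq: Module.module R "quotient_module R ?MZ B" by (rule q.module_quotient)
  have "rel_length R M B Z = rel_length R (quotient_module R ?MZ B)
      {\<zero>\<^bsub>quotient_module R ?MZ B\<^esub>} (carrier (quotient_module R ?MZ B))"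
  proof (rule rel_length_hom[OF M q.module_quotient B Z BZ
        submodule_singleton_zero[OF q.module_quotient] qq.carrier_is_submodule, where f = "\<lambda>u. B +>\<^bsub>?MZ\<^esub> u"])
    fix U assume U: "U \<in> carrier (quotient_module R ?MZ B)"
    then obtain u where "u \<in> Z" "U = B +>\<^bsub>?MZ\<^esub> u" by (auto simp: q.carrier_quotient)
    then show "\<exists>z\<in>Z. U \<ominus>\<^bsub>quotient_module R ?MZ B\<^esub> (B +>\<^bsub>?MZ\<^esub> z) \<in> {\<zero>\<^bsub>quotient_module R ?MZ B\<^esub>}"
      using U by (intro bexI[of _ u]) (auto simp: a_minus_def qq.M.r_neg)
  next
    show "(B +>\<^bsub>?MZ\<^esub> z \<in> {\<zero>\<^bsub>quotient_module R ?MZ B\<^esub>}) = (z \<in> B)" if "z \<in> Z" for z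
      using that q.cos_eq_zero_iff[of z] by (simp add: q.zero_quotient)
  qed (use q.cos_closed q.cos_add q.cos_smult in auto)
  then show ?thesis by (simp add: module_length_eq_rel_length)
qed

section \<open>Projective modules\<close>

text \<open>By the dual basis lemma, this is equivalent to the usual lifting property, but it does not
  quantify over other modules and hence over other types.\<close>

definition projective :: "('r, 'z) ring_scheme \<Rightarrow> ('r, 'a) module \<Rightarrow> bool" where
  "projective R X \<longleftrightarrow> (\<exists>s \<in> mod_hom R X (free_mod R (carrier X)).
     \<forall>u \<in> carrier X. free_ext R X (\<lambda>b. b) (s u) = u)"

text \<open>A preimage is chosen for every element of X without regard to linearity, extended
  linearly from the free module on the set X, and composed with the section of X. With x = 0 this is
  the usual lifting property.\<close>

lemma projective_lift:
  assumes X: "Module.module R X" and Y: "Module.module R Y" and Z: "Module.module R Z"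
    and x: "x \<in> carrier R" and proj: "projective R X"
    and f: "f \<in> mod_hom R X Y" and p: "p \<in> mod_hom R Z Y"
    and ex: "\<And>u. u \<in> carrier X \<Longrightarrow> \<exists>z\<in>carrier Z. xcong Y x (f u) (p z)"
  shows "\<exists>g\<in>mod_hom R X Z. \<forall>u\<in>carrier X. xcong Y x (f u) (p (g u))"
proof -
  interpret X: Module.module R X by (rule X)
  interpret Y: Module.module R Y by (rule Y)
  have R: "cring R" by unfold_locales
  let ?F = "free_mod R (carrier X)"
  have F: "Module.module R ?F" by (rule module_free_mod[OF R])
  obtain s where s: "s \<in> mod_hom R X ?F" "\<And>u. u \<in> carrier X \<Longrightarrow> free_ext R X (\<lambda>b. b) (s u) = u"
    using proj by (auto simp: projective_def)
  obtain z where z: "\<And>u. u \<in> carrier X \<Longrightarrow> z u \<in> carrier Z" "\<And>u. u \<in> carrier X \<Longrightarrow> xcong Y x (f u) (p (z u))"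
    using ex by metis
  have zP: "z \<in> carrier X \<rightarrow> carrier Z" using z by auto
  have fP: "f \<in> carrier X \<rightarrow> carrier Y" using mod_hom_closed[OF f] by auto
  have idP: "(\<lambda>b. b) \<in> carrier X \<rightarrow> carrier X" by auto
  define ef where "ef = free_ext R Y f"
  define ez where "ez = free_ext R Z z"
  have ef: "ef \<in> mod_hom R ?F Y" unfolding ef_def by (rule free_ext_hom[OF Y fP])
  have ez: "ez \<in> mod_hom R ?F Z" unfolding ez_def by (rule free_ext_hom[OF Z zP])
  have pez: "(\<lambda>c. p (ez c)) \<in> mod_hom R ?F Y" by (rule mod_hom_comp[OF p ez])
  note cl = mod_hom_closed[OF ef] mod_hom_closed[OF pez]
  \<comment> \<open>Congruence of two linear maps is a linear condition, so checking it on the basis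
    is enough.\<close>
  have sub: "submodule {c \<in> carrier ?F. xcong Y x (ef c) (p (ez c))} R ?F"
  proof (rule submodule_intro[OF F])
    have "xcong Y x (ef \<zero>\<^bsub>?F\<^esub>) (p (ez \<zero>\<^bsub>?F\<^esub>))"
      by (simp only: mod_hom_zero[OF F Y ef] mod_hom_zero[OF F Y pez] xcong_refl[OF Y x Y.M.zero_closed])
    then show "\<zero>\<^bsub>?F\<^esub> \<in> {c \<in> carrier ?F. xcong Y x (ef c) (p (ez c))}"
      using submodule_zero[OF Module.module.carrier_is_submodule[OF F]] by blast
  qed (use cl in \<open>auto simp: mod_hom_add[OF ef] mod_hom_add[OF pez] mod_hom_smult[OF ef] mod_hom_smult[OF pez]
        intro!: xcong_add[OF Y x] xcong_smult[OF Y x]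
          submodule_add[OF Module.module.carrier_is_submodule[OF F]]
          submodule_smult[OF Module.module.carrier_is_submodule[OF F]]\<close>)
  have cong: "xcong Y x (ef c) (p (ez c))" if c: "c \<in> carrier ?F" for c
  proof -
    have "c \<in> {c \<in> carrier ?F. xcong Y x (ef c) (p (ez c))}"
    proof (rule free_mod_induct[OF R sub _ c])
      fix b assume b: "b \<in> carrier X"
      then show "delta R b \<in> {c \<in> carrier ?F. xcong Y x (ef c) (p (ez c))}"
        using z delta_closed[OF R b] by (simp add: ef_def ez_def free_ext_delta[OF Y fP] free_ext_delta[OF Z zP])
    qed
    then show ?thesis by simp
  qed
  have "xcong Y x (f u) (p (ez (s u)))" if u: "u \<in> carrier X" for u
  proof -
    have su: "s u \<in> carrier ?F" by (rule mod_hom_closed[OF s(1) u])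
    have "f u = f (free_ext R X (\<lambda>b. b) (s u))" using s(2)[OF u] by simp
    also have "\<dots> = ef (s u)" unfolding ef_def by (rule free_ext_comp[OF X Y f idP su])
    finally show ?thesis using cong[OF su] by simp
  qed
  then show ?thesis by (intro bexI[OF _ mod_hom_comp[OF ez s(1)]] ballI)
qed

text \<open>The section sends the basis function of b to the basis function of that basis
  function.\<close>

lemma projective_free_mod:
  assumes R: "cring R" shows "projective R (free_mod R B)"
proof -
  let ?F = "free_mod R B"
  have F: "Module.module R ?F" by (rule module_free_mod[OF R])
  let ?FF = "free_mod R (carrier ?F)"
  have FF: "Module.module R ?FF" by (rule module_free_mod[OF R])
  have dd: "(\<lambda>b. delta R (delta R b)) \<in> B \<rightarrow> carrier ?FF"
    using delta_closed[OF R delta_closed[OF R]] by auto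
  have d: "(\<lambda>b. delta R b) \<in> B \<rightarrow> carrier ?F" using delta_closed[OF R] by auto
  have idP: "(\<lambda>b. b) \<in> carrier ?F \<rightarrow> carrier ?F" by auto
  let ?s = "free_ext R ?FF (\<lambda>b. delta R (delta R b))"
  have s: "?s \<in> mod_hom R ?F ?FF" by (rule free_ext_hom[OF FF dd])
  note e = free_ext_hom[OF F idP]
  have "free_ext R ?F (\<lambda>b. b) (?s u) = u" if u: "u \<in> carrier ?F" for u
    by (rule free_mod_hom_eq[OF R F mod_hom_comp[OF e s] mod_hom_id _ u])
      (simp add: free_ext_delta[OF FF dd] free_ext_delta[OF F idP] delta_closed[OF R])
  then show ?thesis unfolding projective_def using s by blast
qed

text \<open>The coordinates with respect to a basis B are the section: a coefficient function
  supported in B is also one supported in the carrier of X.\<close>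

lemma projective_free:
  assumes X: "Module.module R X" and "is_free R X" shows "projective R X"
proof -
  interpret X: Module.module R X by (rule X)
  have R: "cring R" by unfold_locales
  obtain B where B: "B \<subseteq> carrier X" "bij_betw (free_ext R X (\<lambda>b. b)) (carrier (free_mod R B)) (carrier X)"
    using assms by (auto simp: is_free_def is_basis_def)
  let ?F = "free_mod R B" and ?e = "free_ext R X (\<lambda>b. b)"
  have F: "Module.module R ?F" by (rule module_free_mod[OF R])
  interpret F: Module.module R ?F by (rule F)
  have e: "?e \<in> mod_hom R ?F X" by (rule free_ext_hom[OF X]) (use B in auto)
  define s where "s = inv_into (carrier ?F) ?e"
  have es: "s u \<in> carrier ?F" "?e (s u) = u" if "u \<in> carrier X" for u
    using that B(2) by (auto simp: s_def bij_betw_def inv_into_into f_inv_into_f)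
  have inj: "c = c'" if "?e c = ?e c'" "c \<in> carrier ?F" "c' \<in> carrier ?F" for c c'
    using that B(2) by (auto simp: bij_betw_def inj_on_def)
  have sF: "s u \<in> carrier (free_mod R (carrier X))" if "u \<in> carrier X" for u
    using es(1)[OF that] B(1) by (auto simp: free_mod_sel(1))
  have "s \<in> mod_hom R X (free_mod R (carrier X))"
  proof (rule mod_homI[OF sF])
    fix u v assume uv: "u \<in> carrier X" "v \<in> carrier X"
    have "s (u \<oplus>\<^bsub>X\<^esub> v) = s u \<oplus>\<^bsub>?F\<^esub> s v"
      by (rule inj) (use uv es in \<open>auto simp: mod_hom_add[OF e] simp del: free_mod_sel\<close>)
    then show "s (u \<oplus>\<^bsub>X\<^esub> v) = s u \<oplus>\<^bsub>free_mod R (carrier X)\<^esub> s v" by (simp add: free_mod_sel(3))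
  next
    fix a u assume uv: "a \<in> carrier R" "u \<in> carrier X"
    have "s (a \<odot>\<^bsub>X\<^esub> u) = a \<odot>\<^bsub>?F\<^esub> s u"
      by (rule inj) (use uv es in \<open>auto simp: mod_hom_smult[OF e] simp del: free_mod_sel\<close>)
    then show "s (a \<odot>\<^bsub>X\<^esub> u) = a \<odot>\<^bsub>free_mod R (carrier X)\<^esub> s u" by (simp add: free_mod_sel(4))
  qed
  then show ?thesis unfolding projective_def using es by blast
qed

text \<open>The section embeds X into a free module, where x acts on each coefficient
  injectively.\<close>

lemma projective_torsion_free:
  assumes X: "Module.module R X" and proj: "projective R X" and x: "non_zerodivisor R x"
    and u: "u \<in> carrier X" "x \<odot>\<^bsub>X\<^esub> u = \<zero>\<^bsub>X\<^esub>"
  shows "u = \<zero>\<^bsub>X\<^esub>"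
proof -
  interpret X: Module.module R X by (rule X)
  have R: "cring R" by unfold_locales
  let ?F = "free_mod R (carrier X)"
  have F: "Module.module R ?F" by (rule module_free_mod[OF R])
  obtain s where s: "s \<in> mod_hom R X ?F" "\<And>u. u \<in> carrier X \<Longrightarrow> free_ext R X (\<lambda>b. b) (s u) = u"
    using proj by (auto simp: projective_def)
  have xR: "x \<in> carrier R" using x by (simp add: non_zerodivisor_def)
  have "x \<odot>\<^bsub>?F\<^esub> s u = \<zero>\<^bsub>?F\<^esub>"
    using u xR mod_hom_smult[OF s(1), of x u] mod_hom_zero[OF X F s(1)] by simp
  then have "x \<otimes>\<^bsub>R\<^esub> s u b = \<zero>\<^bsub>R\<^esub>" for b unfolding free_mod_sel by (rule fun_cong)
  then have "s u = \<zero>\<^bsub>?F\<^esub>"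
    using x free_mod_closed[OF mod_hom_closed[OF s(1) u(1)]] by (auto simp: non_zerodivisor_def free_mod_sel(2))
  then have "s u = s \<zero>\<^bsub>X\<^esub>" using mod_hom_zero[OF X F s(1)] by simp
  then show ?thesis using s(2)[OF u(1)] s(2)[OF X.M.zero_closed] by metis
qed

text \<open>The free cover of A maps to the free cover of X by sending the basis function of b to
  that of i b; composing with the section of A lifts i.\<close>

lemma projective_lift_free_ext:
  assumes X: "Module.module R X" and A: "Module.module R A"
    and pA: "projective R A" and i: "i \<in> mod_hom R A X"
  shows "\<exists>t\<in>mod_hom R A (free_mod R (carrier X)). \<forall>a\<in>carrier A. free_ext R X (\<lambda>b. b) (t a) = i a"
proof -
  interpret X: Module.module R X by (rule X)
  have R: "cring R" by unfold_locales
  let ?F = "free_mod R (carrier X)" and ?e = "free_ext R X (\<lambda>b. b)"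
  have F: "Module.module R ?F" by (rule module_free_mod[OF R])
  have e: "?e \<in> mod_hom R ?F X" by (rule free_ext_hom[OF X]) auto
  obtain s where s: "s \<in> mod_hom R A (free_mod R (carrier A))"
      "\<And>u. u \<in> carrier A \<Longrightarrow> free_ext R A (\<lambda>b. b) (s u) = u"
    using pA by (auto simp: projective_def)
  let ?FA = "free_mod R (carrier A)"
  have idP: "(\<lambda>b. b) \<in> carrier A \<rightarrow> carrier A" by auto
  have iP: "(\<lambda>b. delta R (i b)) \<in> carrier A \<rightarrow> carrier ?F"
    using delta_closed[OF R mod_hom_closed[OF i]] by auto
  define t where "t = free_ext R ?F (\<lambda>b. delta R (i b))"
  have t: "t \<in> mod_hom R ?FA ?F" unfolding t_def by (rule free_ext_hom[OF F iP])
  have ei: "free_ext R A (\<lambda>b. b) \<in> mod_hom R ?FA A" by (rule free_ext_hom[OF A idP])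
  have "?e (t (s a)) = i a" if a: "a \<in> carrier A" for a
  proof -
    have "?e (t (s a)) = i (free_ext R A (\<lambda>b. b) (s a))"
      by (rule free_mod_hom_eq[OF R X mod_hom_comp[OF e t] mod_hom_comp[OF i ei] _ mod_hom_closed[OF s(1) a]])
        (auto simp: t_def free_ext_delta[OF F iP] free_ext_delta[OF A idP] mod_hom_closed[OF i]
          free_ext_delta[OF X, of "\<lambda>b. b" "carrier X"])
    then show ?thesis using s(2)[OF a] by simp
  qed
  then show ?thesis by (intro bexI[OF _ mod_hom_comp[OF t s(1)]] ballI)
qed

text \<open>The identity of X is i p + j q. Each summand factors through a projective module and so
  lifts to the free cover of X; the sum of the two lifts is a section.\<close>

lemma projective_split:
  assumes X: "Module.module R X" and A: "Module.module R A" and B: "Module.module R B"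
    and pA: "projective R A" and pB: "projective R B"
    and i: "i \<in> mod_hom R A X" and p: "p \<in> mod_hom R X A" and j: "j \<in> mod_hom R B X" and q: "q \<in> mod_hom R X B"
    and split: "\<And>u. u \<in> carrier X \<Longrightarrow> i (p u) \<oplus>\<^bsub>X\<^esub> j (q u) = u"
  shows "projective R X"
proof -
  interpret X: Module.module R X by (rule X)
  have R: "cring R" by unfold_locales
  let ?F = "free_mod R (carrier X)" and ?e = "free_ext R X (\<lambda>b. b)"
  have F: "Module.module R ?F" by (rule module_free_mod[OF R])
  have e: "?e \<in> mod_hom R ?F X" by (rule free_ext_hom[OF X]) auto
  obtain t where t: "t \<in> mod_hom R A ?F" "\<And>a. a \<in> carrier A \<Longrightarrow> ?e (t a) = i a" using projective_lift_free_ext[OF X A pA i] by auto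
  obtain t' where t': "t' \<in> mod_hom R B ?F" "\<And>a. a \<in> carrier B \<Longrightarrow> ?e (t' a) = j a" using projective_lift_free_ext[OF X B pB j] by auto
  note tp = mod_hom_comp[OF t(1) p] and tq = mod_hom_comp[OF t'(1) q]
  show ?thesis
    unfolding projective_def
  proof (intro bexI[OF _ mod_hom_plus[OF F tp tq]] ballI)
    fix u assume u: "u \<in> carrier X"
    show "?e (t (p u) \<oplus>\<^bsub>?F\<^esub> t' (q u)) = u"
      using u split[OF u] mod_hom_closed[OF tp] mod_hom_closed[OF tq] mod_hom_closed[OF p] mod_hom_closed[OF q]
      by (subst mod_hom_add[OF e]) (auto simp: t t')
  qed
qed

lemma projective_trivial:
  assumes X: "Module.module R X" and triv: "carrier X = {\<zero>\<^bsub>X\<^esub>}"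
  shows "projective R X"
proof -
  interpret X: Module.module R X by fact
  have R: "cring R" by unfold_locales
  let ?F = "free_mod R (carrier X)"
  have F: "Module.module R ?F" by (rule module_free_mod[OF R])
  have e: "free_ext R X (\<lambda>b. b) \<in> mod_hom R ?F X" by (rule free_ext_hom[OF X]) auto
  show ?thesis unfolding projective_def
    using mod_hom_zero[OF F X e] triv by (intro bexI[OF _ mod_hom_const_zero[OF F]]) auto
qed

section \<open>Resolutions modulo a ring element\<close>

text \<open>A graded projective module with a map \<open>D\<close> of degree \<open>-1\<close> that becomes a resolution of
  \<open>M\<close> modulo \<open>x\<close>.  For \<open>x = 0\<close> this is a projective resolution, for a
  non-zerodivisor \<open>x\<close> it presents a projective resolution over \<open>R/(x)\<close>.\<close>

locale xresolution =
  fixes R :: "('r, 'z) ring_scheme" and M :: "('r, 'm) module" and x :: 'r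
    and X :: "int \<Rightarrow> ('r, 'a) module" and D :: "int \<Rightarrow> 'a \<Rightarrow> 'a" and \<epsilon> :: "'a \<Rightarrow> 'm"
  assumes modM: "Module.module R M"
    and xR: "x \<in> carrier R"
    and modX: "Module.module R (X j)"
    and projX: "projective R (X j)"
    and trivX: "j < 0 \<Longrightarrow> carrier (X j) = {\<zero>\<^bsub>X j\<^esub>}"
    and D: "D j \<in> mod_hom R (X j) (X (j - 1))"
    and \<epsilon>: "\<epsilon> \<in> mod_hom R (X 0) M"
    and \<epsilon>_surj: "m \<in> carrier M \<Longrightarrow> \<exists>u\<in>carrier (X 0). \<epsilon> u = m"
    and exact0: "u \<in> carrier (X 0) \<Longrightarrow>
      \<epsilon> u = \<zero>\<^bsub>M\<^esub> \<longleftrightarrow> (\<exists>v\<in>carrier (X 1). xcong (X 0) x u (D 1 v))"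
    and exact_pos: "0 < j \<Longrightarrow> u \<in> carrier (X j) \<Longrightarrow>
      xcong (X (j - 1)) x (D j u) \<zero>\<^bsub>X (j - 1)\<^esub> \<longleftrightarrow>
      (\<exists>v\<in>carrier (X (j + 1)). xcong (X j) x u (D (j + 1) v))"
begin

lemma D': "D (j + 1) \<in> mod_hom R (X (j + 1)) (X j)"
  using D[of "j + 1"] by simp

text \<open>In degree 0 the augmentation takes the place of the differential, so exactness in all
  degrees n \<ge> 0 becomes the single statement \<open>cyc_iff\<close>.\<close>

definition cyc :: "nat \<Rightarrow> 'a \<Rightarrow> bool" where
  "cyc n u \<longleftrightarrow> (if n = 0 then \<epsilon> u = \<zero>\<^bsub>M\<^esub>
    else xcong (X (int n - 1)) x (D (int n) u) \<zero>\<^bsub>X (int n - 1)\<^esub>)"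

lemma cyc_iff:
  "u \<in> carrier (X (int n)) \<Longrightarrow> cyc n u \<longleftrightarrow> (\<exists>v\<in>carrier (X (int n + 1)). xcong (X (int n)) x u (D (int n + 1) v))"
  using exact0[of u] exact_pos[of "int n" u] by (auto simp: cyc_def)

lemma cyc_D: "v \<in> carrier (X (int n + 1)) \<Longrightarrow> cyc n (D (int n + 1) v)"
  using mod_hom_closed[OF D'] xcong_refl[OF modX xR] cyc_iff by blast

lemma cyc_Suc: "cyc (Suc n) u \<longleftrightarrow> xcong (X (int n)) x (D (int n + 1) u) \<zero>\<^bsub>X (int n)\<^esub>"
  by (simp add: cyc_def add.commute)

text \<open>Exactness in degree 0 is stated modulo x: x u is congruent to D 1 of zero, so its
  augmentation vanishes, and the augmentation is onto.\<close>

lemma x_kills: assumes m: "m \<in> carrier M" shows "x \<odot>\<^bsub>M\<^esub> m = \<zero>\<^bsub>M\<^esub>"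
proof -
  interpret X0: Module.module R "X 0" by (rule modX)
  interpret X1: Module.module R "X 1" by (rule modX)
  obtain u where u: "u \<in> carrier (X 0)" "\<epsilon> u = m" using \<epsilon>_surj[OF m] by auto
  have D1: "D 1 \<in> mod_hom R (X 1) (X 0)" using D[of 1] by simp
  have "xcong (X 0) x (x \<odot>\<^bsub>X 0\<^esub> u) (D 1 \<zero>\<^bsub>X 1\<^esub>)"
    using xcong_smult_zero[OF modX xR u(1)] mod_hom_zero[OF modX modX D1] by simp
  then have "\<epsilon> (x \<odot>\<^bsub>X 0\<^esub> u) = \<zero>\<^bsub>M\<^esub>"
    using exact0[of "x \<odot>\<^bsub>X 0\<^esub> u"] u xR X1.M.zero_closed by auto
  then show ?thesis using u xR mod_hom_smult[OF \<epsilon>] by simp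
qed

lemma DD: "u \<in> carrier (X (j + 1)) \<Longrightarrow> xcong (X (j - 1)) x (D j (D (j + 1) u)) \<zero>\<^bsub>X (j - 1)\<^esub>"
proof (cases "0 < j")
  case True
  assume "u \<in> carrier (X (j + 1))"
  then show ?thesis
    using exact_pos[OF True mod_hom_closed[OF D']] mod_hom_closed[OF D'] xcong_refl[OF modX xR] by blast
next
  \<comment> \<open>Here the target has negative degree and is therefore trivial.\<close>
  case False
  assume u: "u \<in> carrier (X (j + 1))"
  interpret X0: Module.module R "X (j - 1)" by (rule modX)
  have "D j (D (j + 1) u) \<in> carrier (X (j - 1))" by (intro mod_hom_closed[OF D] mod_hom_closed[OF D'] u)
  then show ?thesis using trivX[of "j - 1"] False xcong_refl[OF modX xR X0.M.zero_closed] by auto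
qed

end

lemma xresolution_zeroI:
  assumes M: "Module.module R M" and X: "\<And>j. Module.module R (X j)" and projX: "\<And>j. projective R (X j)"
    and trivX: "\<And>j. j < 0 \<Longrightarrow> carrier (X j) = {\<zero>\<^bsub>X j\<^esub>}"
    and D: "\<And>j. D j \<in> mod_hom R (X j) (X (j - 1))"
    and \<epsilon>: "\<epsilon> \<in> mod_hom R (X 0) M" "carrier M \<subseteq> \<epsilon> ` carrier (X 0)"
    and ex0: "D 1 ` carrier (X 1) = {u \<in> carrier (X 0). \<epsilon> u = \<zero>\<^bsub>M\<^esub>}"
    and ex: "\<And>j. 0 < j \<Longrightarrow> D (j + 1) ` carrier (X (j + 1)) = {u \<in> carrier (X j). D j u = \<zero>\<^bsub>X (j - 1)\<^esub>}"
  shows "xresolution R M \<zero>\<^bsub>R\<^esub> X D \<epsilon>"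
proof (rule xresolution.intro[OF M _ X projX trivX D \<epsilon>(1)])
  interpret M: Module.module R M by (rule M)
  interpret X: Module.module R "X j" for j by (rule X)
  have D': "D (j + 1) \<in> mod_hom R (X (j + 1)) (X j)" for j using D[of "j + 1"] by simp
  have x: "xcong (X j) \<zero>\<^bsub>R\<^esub> u (D (j + 1) v) \<longleftrightarrow> u = D (j + 1) v" if "v \<in> carrier (X (j + 1))" for j u v
    by (rule xcong_zero_iff[OF X mod_hom_closed[OF D' that]])
  show "\<zero>\<^bsub>R\<^esub> \<in> carrier R" by simp
  show "\<exists>u\<in>carrier (X 0). \<epsilon> u = m" if "m \<in> carrier M" for m using \<epsilon>(2) that by auto
  show "\<epsilon> u = \<zero>\<^bsub>M\<^esub> \<longleftrightarrow> (\<exists>v\<in>carrier (X 1). xcong (X 0) \<zero>\<^bsub>R\<^esub> u (D 1 v))" if u: "u \<in> carrier (X 0)" for u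
  proof -
    have "\<epsilon> u = \<zero>\<^bsub>M\<^esub> \<longleftrightarrow> u \<in> D 1 ` carrier (X 1)" using ex0 u by simp
    then show ?thesis using x[of _ 0 u] by auto
  qed
  show "xcong (X (j - 1)) \<zero>\<^bsub>R\<^esub> (D j u) \<zero>\<^bsub>X (j - 1)\<^esub> \<longleftrightarrow>
      (\<exists>v\<in>carrier (X (j + 1)). xcong (X j) \<zero>\<^bsub>R\<^esub> u (D (j + 1) v))"
    if j: "0 < j" and u: "u \<in> carrier (X j)" for j u
  proof -
    have "D j u = \<zero>\<^bsub>X (j - 1)\<^esub> \<longleftrightarrow> u \<in> D (j + 1) ` carrier (X (j + 1))" using ex[OF j] u by simp
    then show ?thesis using x[of _ j u] xcong_zero_iff[OF X X.M.zero_closed] by auto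
  qed
qed

lemma free_resolution_xresolution:
  assumes "free_resolution R F d \<epsilon> M" and "Module.module R M"
  shows "xresolution R M \<zero>\<^bsub>R\<^esub> F d \<epsilon>"
  using assms projective_free by (intro xresolution_zeroI) (auto simp: free_resolution_def)

section \<open>Homology of the tensored complex and its length\<close>

context xresolution
begin

definition cycles :: "('r, 'n) module \<Rightarrow> int \<Rightarrow> ('a \<times> 'n \<Rightarrow> 'r) set set" where
  "cycles N j = {t \<in> carrier (tensor R (X j) N). tensor_map R (X (j - 1)) N (D j) t = \<zero>\<^bsub>tensor R (X (j - 1)) N\<^esub>}"

definition boundaries :: "('r, 'n) module \<Rightarrow> int \<Rightarrow> ('a \<times> 'n \<Rightarrow> 'r) set set" where
  "boundaries N j = tensor_map R (X j) N (D (j + 1)) ` carrier (tensor R (X (j + 1)) N)"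

definition hlength :: "('r, 'n) module \<Rightarrow> int \<Rightarrow> enat" where
  "hlength N j = rel_length R (tensor R (X j) N) (boundaries N j) (cycles N j)"

context
  fixes N :: "('r, 'n) module"
  assumes N: "Module.module R N" and xN: "\<forall>v\<in>carrier N. x \<odot>\<^bsub>N\<^esub> v = \<zero>\<^bsub>N\<^esub>"
begin

lemma module_TX: "Module.module R (tensor R (X j) N)"
  by (rule tensor_prod.module_tensor[OF tensor_prodI[OF modX N]])

lemma TD: "tensor_map R (X (j - 1)) N (D j) \<in> mod_hom R (tensor R (X j) N) (tensor R (X (j - 1)) N)"
  by (rule tensor_map_hom[OF modX modX N D])

lemma TD': "tensor_map R (X j) N (D (j + 1)) \<in> mod_hom R (tensor R (X (j + 1)) N) (tensor R (X j) N)"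
  by (rule tensor_map_hom[OF modX modX N D'])

text \<open>The composite of two differentials is merely congruent to zero modulo x; it vanishes
  after tensoring because x kills N.\<close>

lemma TDD:
  assumes t: "t \<in> carrier (tensor R (X (j + 1)) N)"
  shows "tensor_map R (X (j - 1)) N (D j) (tensor_map R (X j) N (D (j + 1)) t) = \<zero>\<^bsub>tensor R (X (j - 1)) N\<^esub>"
  unfolding tensor_map_comp[OF modX modX modX N D' D t, symmetric]
  using tensor_map_xcong[OF modX modX N xR xN mod_hom_comp[OF D D'] mod_hom_const_zero[OF modX] t DD]
    tensor_map_zero[OF modX modX N mod_hom_const_zero[OF modX] t] by simp

lemma submodule_cycles: "submodule (cycles N j) R (tensor R (X j) N)"
  unfolding cycles_def by (rule submodule_kernel[OF module_TX module_TX TD])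

lemma submodule_boundaries: "submodule (boundaries N j) R (tensor R (X j) N)"
  unfolding boundaries_def
  by (rule submodule_image[OF module_TX module_TX TD' Module.module.carrier_is_submodule[OF module_TX]])

lemma boundaries_subset_cycles: "boundaries N j \<subseteq> cycles N j"
  unfolding boundaries_def cycles_def using TDD mod_hom_closed[OF TD'] by auto

lemma module_length_homology:
  "module_length R (homology R (\<lambda>i. tensor R (X i) N) (\<lambda>i. tensor_map R (X (i - 1)) N (D i)) j) = hlength N j"
  unfolding homology_def hlength_def
  using module_length_quotient[OF module_TX submodule_cycles submodule_boundaries boundaries_subset_cycles]
  by (simp add: cycles_def boundaries_def)

end
end

lemma (in xresolution) hlength_negative:
  assumes N: "Module.module R N" and xN: "\<forall>v\<in>carrier N. x \<odot>\<^bsub>N\<^esub> v = \<zero>\<^bsub>N\<^esub>" and j: "j < 0"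
  shows "hlength N j = 0"
proof -
  have triv: "carrier (tensor R (X j) N) = {\<zero>\<^bsub>tensor R (X j) N\<^esub>}"
    by (rule tensor_trivial[OF modX N trivX[OF j]])
  note c = submodule_cycles[OF N xN, of j] and b = submodule_boundaries[OF N xN, of j]
  have eq: "cycles N j = {\<zero>\<^bsub>tensor R (X j) N\<^esub>}" "boundaries N j = {\<zero>\<^bsub>tensor R (X j) N\<^esub>}"
    using submodule_subset[OF c] submodule_zero[OF c] submodule_subset[OF b] submodule_zero[OF b] triv by auto
  have "\<not> submodule_chain R (tensor R (X j) N) (boundaries N j) (cycles N j) 1"
  proof
    assume "submodule_chain R (tensor R (X j) N) (boundaries N j) (cycles N j) 1"
    then obtain C where C: "\<forall>i\<le>1. submodule (C i) R (tensor R (X j) N) \<and> {\<zero>\<^bsub>tensor R (X j) N\<^esub>} \<subseteq> C i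
        \<and> C i \<subseteq> {\<zero>\<^bsub>tensor R (X j) N\<^esub>}" "\<forall>i<1. C i \<subset> C (Suc i)"
      unfolding submodule_chain_def eq by (elim exE conjE) (rule that)
    have "{\<zero>\<^bsub>tensor R (X j) N\<^esub>} \<subseteq> C 0" "C 0 \<subset> C 1" "C 1 \<subseteq> {\<zero>\<^bsub>tensor R (X j) N\<^esub>}"
      using C(1)[rule_format, of 0] C(1)[rule_format, of 1] C(2)[rule_format, of 0] by auto
    then show False by blast
  qed
  then have "\<not> enat 1 \<le> hlength N j"
    unfolding hlength_def using enat_le_rel_length_iff[OF b boundaries_subset_cycles[OF N xN]] by blast
  then show ?thesis by (metis i0_lb ileI1 iless_Suc_eq not_le one_eSuc one_enat_def zero_enat_def le_less)
qed

section \<open>Comparison of resolutions\<close>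

locale xresolution_pair = X: xresolution R M x X D \<epsilon> + Y: xresolution R M x Y E \<eta>
  for R :: "('r, 'z) ring_scheme" and M :: "('r, 'm) module" and x
    and X :: "int \<Rightarrow> ('r, 'a) module" and D \<epsilon>
    and Y :: "int \<Rightarrow> ('r, 'b) module" and E \<eta>
begin

text \<open>A lift of the identity of M. It commutes with the differentials modulo x but with the
  augmentations exactly, because x kills M.\<close>

definition chain_map :: "(int \<Rightarrow> 'a \<Rightarrow> 'b) \<Rightarrow> bool" where
  "chain_map f \<longleftrightarrow> (\<forall>j. f j \<in> mod_hom R (X j) (Y j)) \<and>
    (\<forall>j. \<forall>u\<in>carrier (X j). xcong (Y (j - 1)) x (E j (f j u)) (f (j - 1) (D j u))) \<and>
    (\<forall>u\<in>carrier (X 0). \<eta> (f 0 u) = \<epsilon> u)"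

text \<open>The comparison theorem by recursion on the degree: f (D u) is a cycle, hence by
  exactness a boundary modulo x, and projectivity makes the choice of preimages linear.\<close>

lemma chain_map_exists: "\<exists>f. chain_map f"
proof -
  \<comment> \<open>The clause that cycles go to cycles is the invariant that makes the next step
    possible: it places f (D u) among the boundaries of Y.\<close>
  define P where "P = (\<lambda>(n::nat) f. f \<in> mod_hom R (X (int n)) (Y (int n)) \<and>
     (n = 0 \<longrightarrow> (\<forall>u\<in>carrier (X 0). \<eta> (f u) = \<epsilon> u)) \<and>
     (\<forall>u\<in>carrier (X (int n)). X.cyc n u \<longrightarrow> Y.cyc n (f u)))"
  define Q where "Q = (\<lambda>(n::nat) f f'. \<forall>u\<in>carrier (X (int n + 1)).
     xcong (Y (int n)) x (E (int n + 1) (f' u)) (f (D (int n + 1) u)))"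
  have "\<exists>f. \<forall>n. P n (f n) \<and> Q n (f n) (f (Suc n))"
  proof (rule dependent_nat_choice)
    have "\<exists>z\<in>carrier (Y 0). xcong M x (\<epsilon> u) (\<eta> z)" if "u \<in> carrier (X 0)" for u
      using Y.\<epsilon>_surj[OF mod_hom_closed[OF X.\<epsilon> that]] xcong_refl[OF X.modM X.xR mod_hom_closed[OF X.\<epsilon> that]]
      by metis
    then obtain g where g: "g \<in> mod_hom R (X 0) (Y 0)" "\<And>u. u \<in> carrier (X 0) \<Longrightarrow> xcong M x (\<epsilon> u) (\<eta> (g u))"
      using projective_lift[OF X.modX X.modM Y.modX X.xR X.projX X.\<epsilon> Y.\<epsilon>] by metis
    \<comment> \<open>The lift is found up to congruence in M, where congruence modulo x is
      equality.\<close>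
    have "\<eta> (g u) = \<epsilon> u" if "u \<in> carrier (X 0)" for u
      using xcong_killed[OF X.modM X.xR g(2)[OF that]] X.x_kills
        mod_hom_closed[OF Y.\<epsilon> mod_hom_closed[OF g(1) that]] by auto
    then have "P 0 g" using g(1) by (auto simp: P_def X.cyc_def Y.cyc_def)
    then show "\<exists>f. P 0 f" by blast
  next
    fix f n assume P: "P n f"
    then have f: "f \<in> mod_hom R (X (int n)) (Y (int n))"
      and cyc: "\<And>u. u \<in> carrier (X (int n)) \<Longrightarrow> X.cyc n u \<Longrightarrow> Y.cyc n (f u)" by (auto simp: P_def)
    have "\<exists>v\<in>carrier (Y (int n + 1)). xcong (Y (int n)) x (f (D (int n + 1) u)) (E (int n + 1) v)"
      if u: "u \<in> carrier (X (int n + 1))" for u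
    proof -
      have Du: "D (int n + 1) u \<in> carrier (X (int n))" by (rule mod_hom_closed[OF X.D' u])
      have "Y.cyc n (f (D (int n + 1) u))" by (rule cyc[OF Du X.cyc_D[OF u]])
      then show ?thesis using Y.cyc_iff[OF mod_hom_closed[OF f Du]] by simp
    qed
    then obtain g where g: "g \<in> mod_hom R (X (int n + 1)) (Y (int n + 1))"
        "\<And>u. u \<in> carrier (X (int n + 1)) \<Longrightarrow> xcong (Y (int n)) x (f (D (int n + 1) u)) (E (int n + 1) (g u))"
      using projective_lift[OF X.modX Y.modX Y.modX X.xR X.projX mod_hom_comp[OF f X.D'] Y.D'] by metis
    have Q: "Q n f g"
      unfolding Q_def
      using xcong_sym[OF Y.modX Y.xR g(2)] mod_hom_closed[OF Y.D' mod_hom_closed[OF g(1)]] by blast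
    have "Y.cyc (Suc n) (g u)" if u: "u \<in> carrier (X (int n + 1))" and c: "X.cyc (Suc n) u" for u
    proof -
      interpret Xn: Module.module R "X (int n)" by (rule X.modX)
      interpret Yn: Module.module R "Y (int n)" by (rule Y.modX)
      \<comment> \<open>For a cycle u the element D u is congruent to zero, hence so is f (D u), and
        by commutation so is E (g u).\<close>
      have "xcong (Y (int n)) x (f (D (int n + 1) u)) (f \<zero>\<^bsub>X (int n)\<^esub>)"
        by (rule xcong_hom[OF X.modX X.xR Y.modX f]) (use c in \<open>auto simp: X.cyc_Suc\<close>)
      then have "xcong (Y (int n)) x (f (D (int n + 1) u)) \<zero>\<^bsub>Y (int n)\<^esub>"
        by (simp add: mod_hom_zero[OF X.modX Y.modX f])
      then show ?thesis
        unfolding Y.cyc_Suc using Q u by (auto simp: Q_def intro: xcong_trans[OF Y.modX Y.xR])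
    qed
    then have "P (Suc n) g" using g(1) by (auto simp: P_def add.commute)
    then show "\<exists>f'. P (Suc n) f' \<and> Q n f f'" using Q by blast
  qed
  then obtain f where f: "\<And>n. P n (f n)" "\<And>n. Q n (f n) (f (Suc n))" by blast
  define F where "F = (\<lambda>j. if j < 0 then (\<lambda>_. \<zero>\<^bsub>Y j\<^esub>) else f (nat j))"
  have F: "F j \<in> mod_hom R (X j) (Y j)" for j
    using f(1)[of "nat j"] mod_hom_const_zero[OF Y.modX] by (auto simp: F_def P_def)
  have "xcong (Y (j - 1)) x (E j (F j u)) (F (j - 1) (D j u))" if u: "u \<in> carrier (X j)" for j u
  proof (cases "0 < j")
    case True
    define n where "n = nat (j - 1)"
    have n: "j = int n + 1" "nat j = Suc n" using True by (auto simp: n_def)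
    then show ?thesis using f(2)[of n] u by (auto simp: Q_def F_def)
  next
    case False
    interpret Yn: Module.module R "Y (j - 1)" by (rule Y.modX)
    have "E j (F j u) \<in> carrier (Y (j - 1))" "F (j - 1) (D j u) \<in> carrier (Y (j - 1))"
      using mod_hom_closed[OF Y.D mod_hom_closed[OF F u]] mod_hom_closed[OF F mod_hom_closed[OF X.D u]] .
    then show ?thesis using False Y.trivX[of "j - 1"] xcong_refl[OF Y.modX Y.xR Yn.M.zero_closed] by auto
  qed
  then have "chain_map F" using F f(1)[of 0] by (auto simp: chain_map_def F_def P_def)
  then show ?thesis by blast
qed

text \<open>The difference h of two lifts has augmentation zero. Recursively, h - s D consists of
  cycles, so it can be lifted through the next differential of Y to give the next component of
  s.\<close>

lemma homotopy_exists:
  assumes f: "chain_map f" and f': "chain_map f'"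
  shows "\<exists>s. (\<forall>j. s j \<in> mod_hom R (X j) (Y (j + 1))) \<and>
    (\<forall>j. \<forall>u\<in>carrier (X j). xcong (Y j) x (f j u) (f' j u \<oplus>\<^bsub>Y j\<^esub> (E (j + 1) (s j u) \<oplus>\<^bsub>Y j\<^esub> s (j - 1) (D j u))))"
proof -
  define h where "h = (\<lambda>j u. f j u \<ominus>\<^bsub>Y j\<^esub> f' j u)"
  have fh: "f j \<in> mod_hom R (X j) (Y j)" "f' j \<in> mod_hom R (X j) (Y j)" for j
    using f f' by (auto simp: chain_map_def)
  have h: "h j \<in> mod_hom R (X j) (Y j)" for j
    unfolding h_def by (rule mod_hom_diff[OF Y.modX fh])
  have hD: "xcong (Y (j - 1)) x (E j (h j u)) (h (j - 1) (D j u))" if u: "u \<in> carrier (X j)" for j u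
    unfolding h_def
    using u f f' mod_hom_closed[OF fh(1) u] mod_hom_closed[OF fh(2) u]
      mod_hom_closed[OF fh(1) mod_hom_closed[OF X.D u]] mod_hom_closed[OF fh(2) mod_hom_closed[OF X.D u]]
      mod_hom_closed[OF Y.D mod_hom_closed[OF fh(2) u]]
    by (auto simp: mod_hom_minus[OF Y.modX Y.modX Y.D] chain_map_def intro!: xcong_minus[OF Y.modX Y.xR])
  interpret M: Module.module R M by (rule X.modM)
  have h\<eta>: "\<eta> (h 0 u) = \<zero>\<^bsub>M\<^esub>" if u: "u \<in> carrier (X 0)" for u
    unfolding h_def using u f f' mod_hom_closed[OF fh(1) u] mod_hom_closed[OF fh(2) u] mod_hom_closed[OF X.\<epsilon> u]
    by (subst mod_hom_minus[OF Y.modX X.modM Y.\<epsilon>]) (auto simp: chain_map_def a_minus_def M.M.r_neg)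
  \<comment> \<open>On cycles the summand s D disappears modulo x, so the invariant is h \<equiv> E
    s there. In degree 0 this congruence is recorded on all of X 0, since s vanishes in degree
    -1.\<close>
  define P where "P = (\<lambda>(n::nat) s. s \<in> mod_hom R (X (int n)) (Y (int n + 1)) \<and>
     (n = 0 \<longrightarrow> (\<forall>u\<in>carrier (X 0). xcong (Y 0) x (h 0 u) (E 1 (s u)))) \<and>
     (\<forall>u\<in>carrier (X (int n)). X.cyc n u \<longrightarrow> xcong (Y (int n)) x (h (int n) u) (E (int n + 1) (s u))))"
  define Q where "Q = (\<lambda>(n::nat) s s'. \<forall>u\<in>carrier (X (int n + 1)).
     xcong (Y (int n + 1)) x (h (int n + 1) u) (E (int n + 1 + 1) (s' u) \<oplus>\<^bsub>Y (int n + 1)\<^esub> s (D (int n + 1) u)))"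
  have "\<exists>s. \<forall>n. P n (s n) \<and> Q n (s n) (s (Suc n))"
  proof (rule dependent_nat_choice)
    have E1: "E 1 \<in> mod_hom R (Y 1) (Y 0)" using Y.D[of 1] by simp
    have "\<exists>z\<in>carrier (Y 1). xcong (Y 0) x (h 0 u) (E 1 z)" if "u \<in> carrier (X 0)" for u
      using Y.exact0[OF mod_hom_closed[OF h that]] h\<eta>[OF that] by simp
    then obtain g where g: "g \<in> mod_hom R (X 0) (Y 1)" "\<And>u. u \<in> carrier (X 0) \<Longrightarrow> xcong (Y 0) x (h 0 u) (E 1 (g u))"
      using projective_lift[OF X.modX Y.modX Y.modX X.xR X.projX h E1] by metis
    then have "P 0 g" by (auto simp: P_def)
    then show "\<exists>s. P 0 s" by blast
  next
    fix s n assume P: "P n s"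
    then have s: "s \<in> mod_hom R (X (int n)) (Y (int n + 1))"
      and hs: "\<And>u. u \<in> carrier (X (int n)) \<Longrightarrow> X.cyc n u \<Longrightarrow> xcong (Y (int n)) x (h (int n) u) (E (int n + 1) (s u))"
      by (auto simp: P_def)
    interpret Yn: Module.module R "Y (int n)" by (rule Y.modX)
    interpret Yn1: Module.module R "Y (int n + 1)" by (rule Y.modX)
    define y where "y = (\<lambda>u. h (int n + 1) u \<ominus>\<^bsub>Y (int n + 1)\<^esub> s (D (int n + 1) u))"
    have sD: "(\<lambda>u. s (D (int n + 1) u)) \<in> mod_hom R (X (int n + 1)) (Y (int n + 1))"
      by (rule mod_hom_comp[OF s X.D'])
    have y: "y \<in> mod_hom R (X (int n + 1)) (Y (int n + 1))"
      unfolding y_def by (rule mod_hom_diff[OF Y.modX h sD])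
    have "\<exists>v\<in>carrier (Y (int n + 1 + 1)). xcong (Y (int n + 1)) x (y u) (E (int n + 1 + 1) v)"
      if u: "u \<in> carrier (X (int n + 1))" for u
    proof -
      have Du: "D (int n + 1) u \<in> carrier (X (int n))" by (rule mod_hom_closed[OF X.D' u])
      have cl: "h (int n + 1) u \<in> carrier (Y (int n + 1))" "s (D (int n + 1) u) \<in> carrier (Y (int n + 1))"
        using mod_hom_closed[OF h u] mod_hom_closed[OF sD u] .
      have cl': "E (int n + 1) (h (int n + 1) u) \<in> carrier (Y (int n))"
          "E (int n + 1) (s (D (int n + 1) u)) \<in> carrier (Y (int n))"
        using mod_hom_closed[OF Y.D' cl(1)] mod_hom_closed[OF Y.D' cl(2)] .
      \<comment> \<open>E (h u) \<equiv> h (D u) \<equiv> E (s (D u)): first because h commutes with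
        the differentials modulo x, then by the invariant at the cycle D u. Hence y u is a
        cycle.\<close>
      have "xcong (Y (int n)) x (E (int n + 1) (h (int n + 1) u)) (h (int n) (D (int n + 1) u))"
        using hD[OF u] by simp
      then have "xcong (Y (int n)) x (E (int n + 1) (h (int n + 1) u)) (E (int n + 1) (s (D (int n + 1) u)))"
        by (rule xcong_trans[OF Y.modX Y.xR _ hs[OF Du X.cyc_D[OF u]] cl'(2)])
      then have "xcong (Y (int n)) x (E (int n + 1) (h (int n + 1) u) \<ominus>\<^bsub>Y (int n)\<^esub> E (int n + 1) (s (D (int n + 1) u)))
          (E (int n + 1) (s (D (int n + 1) u)) \<ominus>\<^bsub>Y (int n)\<^esub> E (int n + 1) (s (D (int n + 1) u)))"
        by (rule xcong_minus[OF Y.modX Y.xR _ xcong_refl[OF Y.modX Y.xR cl'(2)] cl'(2) cl'(2) cl'(2)])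
      then have "Y.cyc (Suc n) (y u)"
        unfolding Y.cyc_Suc y_def mod_hom_minus[OF Y.modX Y.modX Y.D' cl]
        using cl' by (simp add: a_minus_def Yn.M.r_neg)
      then show ?thesis
        using Y.cyc_iff[of "y u" "Suc n"] mod_hom_closed[OF y u] by (simp add: add.commute)
    qed
    then obtain g where g: "g \<in> mod_hom R (X (int n + 1)) (Y (int n + 1 + 1))"
        "\<And>u. u \<in> carrier (X (int n + 1)) \<Longrightarrow> xcong (Y (int n + 1)) x (y u) (E (int n + 1 + 1) (g u))"
      using projective_lift[OF X.modX Y.modX Y.modX X.xR X.projX y Y.D'] by metis
    have Q: "Q n s g"
      unfolding Q_def
    proof
      fix u assume u: "u \<in> carrier (X (int n + 1))"
      have cl: "h (int n + 1) u \<in> carrier (Y (int n + 1))" "s (D (int n + 1) u) \<in> carrier (Y (int n + 1))"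
        using mod_hom_closed[OF h u] mod_hom_closed[OF sD u] .
      have "xcong (Y (int n + 1)) x (y u \<oplus>\<^bsub>Y (int n + 1)\<^esub> s (D (int n + 1) u))
          (E (int n + 1 + 1) (g u) \<oplus>\<^bsub>Y (int n + 1)\<^esub> s (D (int n + 1) u))"
        by (rule xcong_add[OF Y.modX Y.xR g(2)[OF u] xcong_refl[OF Y.modX Y.xR cl(2)]
              mod_hom_closed[OF Y.D' mod_hom_closed[OF g(1) u]] cl(2)])
      then show "xcong (Y (int n + 1)) x (h (int n + 1) u)
          (E (int n + 1 + 1) (g u) \<oplus>\<^bsub>Y (int n + 1)\<^esub> s (D (int n + 1) u))"
        using cl by (simp add: y_def Yn1.M.minus_add_cancel)
    qed
    have "xcong (Y (int n + 1)) x (h (int n + 1) u) (E (int n + 1 + 1) (g u))"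
      if u: "u \<in> carrier (X (int n + 1))" and c: "X.cyc (Suc n) u" for u
    proof -
      interpret Xn: Module.module R "X (int n)" by (rule X.modX)
      have Eg: "E (int n + 1 + 1) (g u) \<in> carrier (Y (int n + 1))"
        by (rule mod_hom_closed[OF Y.D' mod_hom_closed[OF g(1) u]])
      \<comment> \<open>Restricting Q to cycles removes the term s (D u) and restores the invariant
        one degree higher.\<close>
      have "xcong (Y (int n + 1)) x (s (D (int n + 1) u)) (s \<zero>\<^bsub>X (int n)\<^esub>)"
        by (rule xcong_hom[OF X.modX X.xR Y.modX s]) (use c in \<open>auto simp: X.cyc_Suc\<close>)
      then have "xcong (Y (int n + 1)) x (s (D (int n + 1) u)) \<zero>\<^bsub>Y (int n + 1)\<^esub>"
        by (simp add: mod_hom_zero[OF X.modX Y.modX s])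
      then have "xcong (Y (int n + 1)) x (E (int n + 1 + 1) (g u) \<oplus>\<^bsub>Y (int n + 1)\<^esub> s (D (int n + 1) u))
          (E (int n + 1 + 1) (g u) \<oplus>\<^bsub>Y (int n + 1)\<^esub> \<zero>\<^bsub>Y (int n + 1)\<^esub>)"
        using xcong_add[OF Y.modX Y.xR xcong_refl[OF Y.modX Y.xR Eg] _ Eg Yn1.M.zero_closed] by blast
      then show ?thesis
        using xcong_trans[OF Y.modX Y.xR Q[unfolded Q_def, rule_format, OF u]] Eg by simp
    qed
    then have "P (Suc n) g" using g(1) by (auto simp: P_def add.commute)
    then show "\<exists>f'. P (Suc n) f' \<and> Q n s f'" using Q by blast
  qed
  then obtain s where s: "\<And>n. P n (s n)" "\<And>n. Q n (s n) (s (Suc n))" by blast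
  define S where "S = (\<lambda>j. if j < 0 then (\<lambda>_. \<zero>\<^bsub>Y (j + 1)\<^esub>) else s (nat j))"
  have S: "S j \<in> mod_hom R (X j) (Y (j + 1))" for j
    using s(1)[of "nat j"] mod_hom_const_zero[OF Y.modX] by (auto simp: S_def P_def)
  have hS: "xcong (Y j) x (h j u) (E (j + 1) (S j u) \<oplus>\<^bsub>Y j\<^esub> S (j - 1) (D j u))" if u: "u \<in> carrier (X j)" for j u
  proof -
    interpret Yj: Module.module R "Y j" by (rule Y.modX)
    consider "0 < j" | "j = 0" | "j < 0" by linarith
    then show ?thesis
    proof cases
      case 1
      define n where "n = nat (j - 1)"
      have n: "j = int n + 1" "nat j = Suc n" using 1 by (auto simp: n_def)
      then show ?thesis using s(2)[of n] u by (auto simp: Q_def S_def)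
    next
      case 2
      then have "xcong (Y 0) x (h 0 u) (E 1 (s 0 u))" using s(1)[of 0] u by (auto simp: P_def)
      moreover have "E 1 (s 0 u) \<in> carrier (Y 0)"
        using mod_hom_closed[OF Y.D' mod_hom_closed[OF S u]] 2 by (simp add: S_def)
      ultimately show ?thesis using 2 Yj.M.r_zero by (simp add: S_def)
    next
      case 3
      have "h j u \<in> carrier (Y j)" "E (j + 1) (S j u) \<oplus>\<^bsub>Y j\<^esub> S (j - 1) (D j u) \<in> carrier (Y j)"
        using mod_hom_closed[OF h u] mod_hom_closed[OF Y.D' mod_hom_closed[OF S u]]
          mod_hom_closed[OF S mod_hom_closed[OF X.D u]] by auto
      then show ?thesis using 3 Y.trivX[of j] xcong_refl[OF Y.modX Y.xR Yj.M.zero_closed] by auto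
    qed
  qed
  have "xcong (Y j) x (f j u) (f' j u \<oplus>\<^bsub>Y j\<^esub> (E (j + 1) (S j u) \<oplus>\<^bsub>Y j\<^esub> S (j - 1) (D j u)))"
    if u: "u \<in> carrier (X j)" for j u
  proof -
    interpret Yj: Module.module R "Y j" by (rule Y.modX)
    have cl: "f j u \<in> carrier (Y j)" "f' j u \<in> carrier (Y j)"
      "E (j + 1) (S j u) \<oplus>\<^bsub>Y j\<^esub> S (j - 1) (D j u) \<in> carrier (Y j)"
      using mod_hom_closed[OF fh(1) u] mod_hom_closed[OF fh(2) u] mod_hom_closed[OF Y.D' mod_hom_closed[OF S u]]
          mod_hom_closed[OF S mod_hom_closed[OF X.D u]] by auto
    have "xcong (Y j) x (f' j u \<oplus>\<^bsub>Y j\<^esub> h j u) (f' j u \<oplus>\<^bsub>Y j\<^esub> (E (j + 1) (S j u) \<oplus>\<^bsub>Y j\<^esub> S (j - 1) (D j u)))"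
      by (rule xcong_add[OF Y.modX Y.xR xcong_refl[OF Y.modX Y.xR cl(2)] hS[OF u] cl(2,3)])
    moreover have "f' j u \<oplus>\<^bsub>Y j\<^esub> h j u = f j u"
      using cl by (simp add: h_def Yj.M.a_comm[of "f' j u"] Yj.M.minus_add_cancel)
    ultimately show ?thesis by simp
  qed
  then show ?thesis using S by (intro exI[of _ S]) simp
qed


section \<open>Comparison maps on homology after tensoring\<close>

context
  fixes N :: "('r, 'n) module"
  assumes N: "Module.module R N" and xN: "\<forall>v\<in>carrier N. x \<odot>\<^bsub>N\<^esub> v = \<zero>\<^bsub>N\<^esub>"
begin

lemma tensor_chain_map:
  assumes f: "chain_map f" and t: "t \<in> carrier (tensor R (X j) N)"
  shows "tensor_map R (Y (j - 1)) N (E j) (tensor_map R (Y j) N (f j) t)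
    = tensor_map R (Y (j - 1)) N (f (j - 1)) (tensor_map R (X (j - 1)) N (D j) t)"
proof -
  have fh: "f j \<in> mod_hom R (X j) (Y j)" for j using f by (auto simp: chain_map_def)
  show ?thesis
    unfolding tensor_map_comp[OF X.modX Y.modX Y.modX N fh Y.D t, symmetric]
      tensor_map_comp[OF X.modX X.modX Y.modX N X.D fh t, symmetric]
    by (rule tensor_map_xcong[OF X.modX Y.modX N X.xR xN mod_hom_comp[OF Y.D fh] mod_hom_comp[OF fh X.D] t])
      (use f in \<open>auto simp: chain_map_def\<close>)
qed

lemma tensor_cycles:
  assumes f: "chain_map f" and t: "t \<in> X.cycles N j"
  shows "tensor_map R (Y j) N (f j) t \<in> Y.cycles N j"
proof -
  have fh: "f j \<in> mod_hom R (X j) (Y j)" for j using f by (auto simp: chain_map_def)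
  note Tf = tensor_map_hom[OF X.modX Y.modX N fh]
  show ?thesis
    using t tensor_chain_map[OF f, of t j] mod_hom_closed[OF Tf]
      mod_hom_zero[OF X.module_TX[OF N xN] Y.module_TX[OF N xN] Tf]
    by (auto simp: Y.cycles_def X.cycles_def)
qed

lemma tensor_boundaries:
  assumes f: "chain_map f" and t: "t \<in> X.boundaries N j"
  shows "tensor_map R (Y j) N (f j) t \<in> Y.boundaries N j"
proof -
  have fh: "f j \<in> mod_hom R (X j) (Y j)" for j using f by (auto simp: chain_map_def)
  show ?thesis
    using t tensor_chain_map[OF f, of _ "j + 1"] mod_hom_closed[OF tensor_map_hom[OF X.modX Y.modX N fh, of "j + 1"]]
    by (auto simp: Y.boundaries_def X.boundaries_def intro!: image_eqI)
qed

text \<open>On a cycle the part s D of the homotopy vanishes, and the part E s contributes a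
  boundary.\<close>

lemma tensor_homotopy:
  assumes f: "chain_map f" and f': "chain_map f'" and t: "t \<in> carrier (tensor R (X j) N)"
    and cycle: "tensor_map R (X (j - 1)) N (D j) t = \<zero>\<^bsub>tensor R (X (j - 1)) N\<^esub>"
  shows "\<exists>s\<in>carrier (tensor R (Y (j + 1)) N). tensor_map R (Y j) N (f j) t
    = tensor_map R (Y j) N (f' j) t \<oplus>\<^bsub>tensor R (Y j) N\<^esub> tensor_map R (Y j) N (E (j + 1)) s"
proof -
  obtain s where s: "\<And>j. s j \<in> mod_hom R (X j) (Y (j + 1))"
    and hs: "\<And>j u. u \<in> carrier (X j) \<Longrightarrow> xcong (Y j) x (f j u)
      (f' j u \<oplus>\<^bsub>Y j\<^esub> (E (j + 1) (s j u) \<oplus>\<^bsub>Y j\<^esub> s (j - 1) (D j u)))"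
    using homotopy_exists[OF f f'] by blast
  have fh: "f j \<in> mod_hom R (X j) (Y j)" "f' j \<in> mod_hom R (X j) (Y j)" for j
    using f f' by (auto simp: chain_map_def)
  have s': "s (j - 1) \<in> mod_hom R (X (j - 1)) (Y j)" using s[of "j - 1"] by simp
  note Es = mod_hom_comp[OF Y.D' s] and sD = mod_hom_comp[OF s' X.D]
  interpret TY: tensor_prod R "Y j" N by (rule tensor_prodI[OF Y.modX N])
  interpret TX: tensor_prod R "X (j - 1)" N by (rule tensor_prodI[OF X.modX N])
  interpret T: Module.module R "tensor R (Y j) N" by (rule TY.module_tensor)
  have st: "tensor_map R (Y (j + 1)) N (s j) t \<in> carrier (tensor R (Y (j + 1)) N)"
    by (rule mod_hom_closed[OF tensor_map_hom[OF X.modX Y.modX N s] t])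
  have "tensor_map R (Y j) N (f j) t
      = tensor_map R (Y j) N (\<lambda>u. f' j u \<oplus>\<^bsub>Y j\<^esub> (E (j + 1) (s j u) \<oplus>\<^bsub>Y j\<^esub> s (j - 1) (D j u))) t"
    by (rule tensor_map_xcong[OF X.modX Y.modX N X.xR xN fh(1) mod_hom_plus[OF Y.modX fh(2) mod_hom_plus[OF Y.modX Es sD]] t hs])
  also have "\<dots> = tensor_map R (Y j) N (f' j) t \<oplus>\<^bsub>tensor R (Y j) N\<^esub>
      (tensor_map R (Y j) N (\<lambda>u. E (j + 1) (s j u)) t \<oplus>\<^bsub>tensor R (Y j) N\<^esub> tensor_map R (Y j) N (\<lambda>u. s (j - 1) (D j u)) t)"
    by (subst tensor_map_plus[OF X.modX Y.modX N fh(2) mod_hom_plus[OF Y.modX Es sD] t],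
        subst tensor_map_plus[OF X.modX Y.modX N Es sD t]) (rule refl)
  also have "tensor_map R (Y j) N (\<lambda>u. s (j - 1) (D j u)) t = \<zero>\<^bsub>tensor R (Y j) N\<^esub>"
    using tensor_map_comp[OF X.modX X.modX Y.modX N X.D s' t] cycle
      mod_hom_zero[OF TX.module_tensor TY.module_tensor tensor_map_hom[OF X.modX Y.modX N s']] by simp
  also have "tensor_map R (Y j) N (\<lambda>u. E (j + 1) (s j u)) t
      = tensor_map R (Y j) N (E (j + 1)) (tensor_map R (Y (j + 1)) N (s j) t)"
    by (rule tensor_map_comp[OF X.modX Y.modX Y.modX N s Y.D' t])
  finally show ?thesis
    using st mod_hom_closed[OF tensor_map_hom[OF Y.modX Y.modX N Y.D'] st] T.M.r_zero
    by (intro bexI[OF _ st]) simp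
qed

end

end

lemma chain_map_comp:
  assumes XY: "xresolution_pair R M x X D \<epsilon> Y E \<eta>" and YX: "xresolution_pair R M x Y E \<eta> X D \<epsilon>"
    and f: "xresolution_pair.chain_map R x X D \<epsilon> Y E \<eta> f"
    and g: "xresolution_pair.chain_map R x Y E \<eta> X D \<epsilon> g"
  shows "xresolution_pair.chain_map R x X D \<epsilon> X D \<epsilon> (\<lambda>j u. g j (f j u))"
proof -
  interpret XY: xresolution_pair R M x X D \<epsilon> Y E \<eta> by fact
  interpret YX: xresolution_pair R M x Y E \<eta> X D \<epsilon> by fact
  interpret XX: xresolution_pair R M x X D \<epsilon> X D \<epsilon> by unfold_locales
  have fh: "f j \<in> mod_hom R (X j) (Y j)" and gh: "g j \<in> mod_hom R (Y j) (X j)" for j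
    using f g by (auto simp: XY.chain_map_def YX.chain_map_def)
  have "xcong (X (j - 1)) x (D j (g j (f j u))) (g (j - 1) (f (j - 1) (D j u)))" if u: "u \<in> carrier (X j)" for j u
  proof -
    have fDu: "f (j - 1) (D j u) \<in> carrier (Y (j - 1))" by (intro mod_hom_closed[OF fh] mod_hom_closed[OF XY.X.D] u)
    have "xcong (X (j - 1)) x (D j (g j (f j u))) (g (j - 1) (E j (f j u)))"
      using g mod_hom_closed[OF fh u] by (auto simp: YX.chain_map_def)
    moreover have "xcong (X (j - 1)) x (g (j - 1) (E j (f j u))) (g (j - 1) (f (j - 1) (D j u)))"
      using f u fDu by (intro xcong_hom[OF XY.Y.modX XY.X.xR XY.X.modX gh]) (auto simp: XY.chain_map_def)
    ultimately show ?thesis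
      using xcong_trans[OF XY.X.modX XY.X.xR] mod_hom_closed[OF gh fDu] by blast
  qed
  then show ?thesis
    unfolding XX.chain_map_def using mod_hom_comp[OF gh fh] f g mod_hom_closed[OF fh]
    by (auto simp: XY.chain_map_def YX.chain_map_def)
qed

lemma chain_map_id:
  assumes "xresolution R M x X D \<epsilon>"
  shows "xresolution_pair.chain_map R x X D \<epsilon> X D \<epsilon> (\<lambda>j u. u)"
proof -
  interpret X: xresolution R M x X D \<epsilon> by fact
  interpret XX: xresolution_pair R M x X D \<epsilon> X D \<epsilon> by unfold_locales
  show ?thesis unfolding XX.chain_map_def
    by (auto intro: mod_hom_id xcong_refl[OF X.modX X.xR] mod_hom_closed[OF X.D])
qed

text \<open>Both g f and the identity lift the identity of M from X to X, so they are homotopic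
  modulo x.\<close>

lemma tensor_chain_map_inverse:
  assumes XY: "xresolution_pair R M x X D \<epsilon> Y E \<eta>" and YX: "xresolution_pair R M x Y E \<eta> X D \<epsilon>"
    and N: "Module.module R N" and xN: "\<forall>v\<in>carrier N. x \<odot>\<^bsub>N\<^esub> v = \<zero>\<^bsub>N\<^esub>"
    and f: "xresolution_pair.chain_map R x X D \<epsilon> Y E \<eta> f"
    and g: "xresolution_pair.chain_map R x Y E \<eta> X D \<epsilon> g"
    and t: "t \<in> xresolution.cycles R X D N j"
  shows "\<exists>b\<in>xresolution.boundaries R X D N j.
    tensor_map R (X j) N (g j) (tensor_map R (Y j) N (f j) t) = t \<oplus>\<^bsub>tensor R (X j) N\<^esub> b"
proof -
  interpret XY: xresolution_pair R M x X D \<epsilon> Y E \<eta> by (rule XY)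
  interpret YX: xresolution_pair R M x Y E \<eta> X D \<epsilon> by (rule YX)
  interpret XX: xresolution_pair R M x X D \<epsilon> X D \<epsilon> by unfold_locales
  have fh: "f j \<in> mod_hom R (X j) (Y j)" and gh: "g j \<in> mod_hom R (Y j) (X j)"
    using f g by (auto simp: XY.chain_map_def YX.chain_map_def)
  have tc: "t \<in> carrier (tensor R (X j) N)" using t by (auto simp: XY.X.cycles_def)
  show ?thesis
    using XX.tensor_homotopy[OF N xN chain_map_comp[OF XY YX f g] chain_map_id[OF XY.X.xresolution_axioms] tc]
      t tensor_map_id[OF XY.X.modX N tc] tensor_map_comp[OF XY.X.modX XY.Y.modX XY.X.modX N fh gh tc]
    by (auto simp: XY.X.cycles_def XY.X.boundaries_def)
qed

text \<open>Comparison maps in both directions are inverse to each other on homology. In terms of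
  \<open>rel_length_hom\<close>, g f gives injectivity of f modulo boundaries and f g gives
  surjectivity.\<close>

theorem hlength_unique:
  assumes X: "xresolution R M x X D \<epsilon>" and Y: "xresolution R M x Y E \<eta>"
    and N: "Module.module R N" and xN: "\<forall>v\<in>carrier N. x \<odot>\<^bsub>N\<^esub> v = \<zero>\<^bsub>N\<^esub>"
  shows "xresolution.hlength R X D N j = xresolution.hlength R Y E N j"
proof -
  interpret X: xresolution R M x X D \<epsilon> by fact
  interpret Y: xresolution R M x Y E \<eta> by fact
  interpret XY: xresolution_pair R M x X D \<epsilon> Y E \<eta> by unfold_locales
  interpret YX: xresolution_pair R M x Y E \<eta> X D \<epsilon> by unfold_locales
  obtain f where f: "XY.chain_map f" using XY.chain_map_exists by blast
  obtain g where g: "YX.chain_map g" using YX.chain_map_exists by blast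
  define Tf where "Tf = tensor_map R (Y j) N (f j)"
  define Tg where "Tg = tensor_map R (X j) N (g j)"
  have Tf: "Tf \<in> mod_hom R (tensor R (X j) N) (tensor R (Y j) N)"
    unfolding Tf_def using f by (intro tensor_map_hom[OF X.modX Y.modX N]) (simp add: XY.chain_map_def)
  note fcyc = XY.tensor_cycles[OF N xN f, of _ j, folded Tf_def] and gcyc = YX.tensor_cycles[OF N xN g, of _ j, folded Tg_def]
  note fbd = XY.tensor_boundaries[OF N xN f, of _ j, folded Tf_def] and gbd = YX.tensor_boundaries[OF N xN g, of _ j, folded Tg_def]
  note gf = tensor_chain_map_inverse[OF XY.xresolution_pair_axioms YX.xresolution_pair_axioms N xN f g, of _ j, folded Tf_def Tg_def]
  note fg = tensor_chain_map_inverse[OF YX.xresolution_pair_axioms XY.xresolution_pair_axioms N xN g f, of _ j, folded Tf_def Tg_def]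
  interpret TX: Module.module R "tensor R (X j) N" by (rule X.module_TX[OF N xN])
  interpret TY: Module.module R "tensor R (Y j) N" by (rule Y.module_TX[OF N xN])
  note sub = X.submodule_cycles[OF N xN, of j] X.submodule_boundaries[OF N xN, of j] X.boundaries_subset_cycles[OF N xN, of j]
     Y.submodule_cycles[OF N xN, of j] Y.submodule_boundaries[OF N xN, of j] Y.boundaries_subset_cycles[OF N xN, of j]
  note cX = subsetD[OF submodule_subset[OF sub(1)]] subsetD[OF submodule_subset[OF sub(2)]]
  note cY = subsetD[OF submodule_subset[OF sub(4)]] subsetD[OF submodule_subset[OF sub(5)]]
  show ?thesis
    unfolding X.hlength_def Y.hlength_def
  proof (rule rel_length_hom[OF X.module_TX[OF N xN] Y.module_TX[OF N xN] sub(2,1,3,5,4,6) fcyc])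
    fix t assume t: "t \<in> X.cycles N j"
    show "(Tf t \<in> Y.boundaries N j) = (t \<in> X.boundaries N j)"
    proof
      assume "Tf t \<in> Y.boundaries N j"
      then have b': "Tg (Tf t) \<in> X.boundaries N j" by (rule gbd)
      obtain b where b: "b \<in> X.boundaries N j" "Tg (Tf t) = t \<oplus>\<^bsub>tensor R (X j) N\<^esub> b" using gf[OF t] by blast
      have "(b \<oplus>\<^bsub>tensor R (X j) N\<^esub> t) \<ominus>\<^bsub>tensor R (X j) N\<^esub> b = t"
        using cX(1)[OF t] cX(2)[OF b(1)] by (rule TX.M.add_minus_cancel_left[rotated])
      then have "t = Tg (Tf t) \<ominus>\<^bsub>tensor R (X j) N\<^esub> b"
        using b cX(1)[OF t] cX(2)[OF b(1)] by (simp add: TX.M.a_comm[of b])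
      then show "t \<in> X.boundaries N j" using submodule_minus[OF sub(2) b' b(1)] by simp
    qed (rule fbd)
  next
    fix t assume t: "t \<in> Y.cycles N j"
    obtain b where b: "b \<in> Y.boundaries N j" "Tf (Tg t) = t \<oplus>\<^bsub>tensor R (Y j) N\<^esub> b" using fg[OF t] by blast
    have "t \<ominus>\<^bsub>tensor R (Y j) N\<^esub> (t \<oplus>\<^bsub>tensor R (Y j) N\<^esub> b) = \<ominus>\<^bsub>tensor R (Y j) N\<^esub> b"
      using cY(1)[OF t] cY(2)[OF b(1)] by (simp add: a_minus_def TY.M.minus_add TY.M.r_neg2 TY.M.a_assoc[symmetric] TY.M.r_neg)
    then show "\<exists>z\<in>X.cycles N j. t \<ominus>\<^bsub>tensor R (Y j) N\<^esub> Tf z \<in> Y.boundaries N j"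
      using gcyc[OF t] submodule_uminus[OF sub(5) b(1)] b(2) by (intro bexI[of _ "Tg t"]) auto
  qed (use mod_hom_add[OF Tf] mod_hom_smult[OF Tf] cX in auto)
qed

section \<open>The resolution built from higher homotopies\<close>

locale homotopy_resolution =
  fixes Q :: "('q, 'z) ring_scheme" and x :: 'q and M :: "('q, 'm) module"
    and F :: "int \<Rightarrow> ('q, 'f) module" and d \<epsilon> \<sigma>
  assumes M: "Module.module Q M" and xM: "\<forall>m\<in>carrier M. x \<odot>\<^bsub>M\<^esub> m = \<zero>\<^bsub>M\<^esub>"
    and nzd: "non_zerodivisor Q x"
    and res: "free_resolution Q F d \<epsilon> M"
    and hom: "higher_homotopies Q x F d \<sigma>"
begin

sublocale F: xresolution Q M "\<zero>\<^bsub>Q\<^esub>" F d \<epsilon>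
  by (rule free_resolution_xresolution[OF res M])

lemma x: "x \<in> carrier Q" using nzd by (simp add: non_zerodivisor_def)

lemma modF: "Module.module Q (F j)" by (rule F.modX)

lemma higher:
  assumes "1 < m" "u \<in> carrier (F j)"
  shows "(\<Oplus>\<^bsub>F (j + (2 * int m - 2))\<^esub> k \<in> {..m}. \<sigma> k (j + (2 * int (m - k) - 1)) (\<sigma> (m - k) j u))
    = \<zero>\<^bsub>F (j + (2 * int m - 2))\<^esub>"
  using hom assms unfolding higher_homotopies_def by (elim conjE) (drule spec, drule mp, assumption, simp only: Ball_def)

lemma zeroF: "\<zero>\<^bsub>F j\<^esub> \<in> carrier (F j)"
  using submodule_zero[OF Module.module.carrier_is_submodule[OF modF]] .

text \<open>The indexing that makes the homotopies act on G: \<open>\<sigma>\<^sub>k\<close> leads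
  from the summand of index i + k in degree n to the summand of index i in degree n - 1.\<close>

lemma \<sigma>_hom: "\<sigma> k (n - 2 * int (i + k)) \<in> mod_hom Q (F (n - 2 * int (i + k))) (F (n - 1 - 2 * int i))"
proof -
  have "n - 2 * int (i + k) + (2 * int k - 1) = n - 1 - 2 * int i" by simp
  moreover have "\<sigma> k (n - 2 * int (i + k)) \<in>
      mod_hom Q (F (n - 2 * int (i + k))) (F (n - 2 * int (i + k) + (2 * int k - 1)))"
    using hom unfolding higher_homotopies_def by blast
  ultimately show ?thesis by (simp only:)
qed

definition G :: "int \<Rightarrow> ('q, nat \<Rightarrow> 'f) module" where
  "G n = \<lparr>carrier = {u. \<forall>i. u i \<in> carrier (F (n - 2 * int i))}, mult = undefined, one = undefined,
     zero = (\<lambda>i. \<zero>\<^bsub>F (n - 2 * int i)\<^esub>), add = (\<lambda>u v i. u i \<oplus>\<^bsub>F (n - 2 * int i)\<^esub> v i),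
     smult = (\<lambda>a u i. a \<odot>\<^bsub>F (n - 2 * int i)\<^esub> u i)\<rparr>"

lemma G_sel:
  "u \<in> carrier (G n) \<longleftrightarrow> (\<forall>i. u i \<in> carrier (F (n - 2 * int i)))"
  "\<zero>\<^bsub>G n\<^esub> = (\<lambda>i. \<zero>\<^bsub>F (n - 2 * int i)\<^esub>)"
  "u \<oplus>\<^bsub>G n\<^esub> v = (\<lambda>i. u i \<oplus>\<^bsub>F (n - 2 * int i)\<^esub> v i)"
  "a \<odot>\<^bsub>G n\<^esub> u = (\<lambda>i. a \<odot>\<^bsub>F (n - 2 * int i)\<^esub> u i)"
  by (auto simp: G_def)

lemma modG: "Module.module Q (G n)"
proof -
  interpret FF: Module.module Q "F j" for j by (rule modF)
  show ?thesis
  proof (intro moduleI abelian_groupI)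
    show "cring Q" by unfold_locales
    show "\<exists>v\<in>carrier (G n). v \<oplus>\<^bsub>G n\<^esub> u = \<zero>\<^bsub>G n\<^esub>" if "u \<in> carrier (G n)" for u
      using that by (intro bexI[of _ "\<lambda>i. \<ominus>\<^bsub>F (n - 2 * int i)\<^esub> u i"]) (auto simp: G_sel FF.M.l_neg)
  qed (auto simp: G_sel FF.M.a_ac FF.smult_l_distr FF.smult_r_distr FF.smult_assoc1)
qed

lemma G_trivial: "u \<in> carrier (G n) \<Longrightarrow> n - 2 * int i < 0 \<Longrightarrow> u i = \<zero>\<^bsub>F (n - 2 * int i)\<^esub>"
  using F.trivX[of "n - 2 * int i"] by (auto simp: G_sel)

text \<open>Terms with k above \<open>nat n\<close> would start in a negative degree of F. The bound
  is chosen independently of i.\<close>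

definition D :: "int \<Rightarrow> (nat \<Rightarrow> 'f) \<Rightarrow> nat \<Rightarrow> 'f" where
  "D n u = (\<lambda>i. \<Oplus>\<^bsub>F (n - 1 - 2 * int i)\<^esub> k \<in> {..nat n}. \<sigma> k (n - 2 * int (i + k)) (u (i + k)))"

lemma \<sigma>_closed: "u \<in> carrier (G n) \<Longrightarrow> \<sigma> k (n - 2 * int (i + k)) (u (i + k)) \<in> carrier (F (n - 1 - 2 * int i))"
  using mod_hom_closed[OF \<sigma>_hom, of "u (i + k)" n i k] unfolding G_sel by blast

lemma \<sigma>_trivial:
  assumes "u \<in> carrier (G n)" "n - 2 * int (i + k) < 0"
  shows "\<sigma> k (n - 2 * int (i + k)) (u (i + k)) = \<zero>\<^bsub>F (n - 1 - 2 * int i)\<^esub>"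
  unfolding G_trivial[OF assms] by (rule mod_hom_zero[OF modF modF \<sigma>_hom])

text \<open>The condition on K says that the first omitted term, k = K + 1, starts in negative
  degree. It allows sums truncated at different bounds to be compared.\<close>

lemma D_eq:
  assumes u: "u \<in> carrier (G n)" and K: "n - 2 * int i < 2 * int K + 2"
  shows "D n u i = (\<Oplus>\<^bsub>F (n - 1 - 2 * int i)\<^esub> k \<in> {..K}. \<sigma> k (n - 2 * int (i + k)) (u (i + k)))"
proof -
  interpret FF: Module.module Q "F (n - 1 - 2 * int i)" by (rule modF)
  have "n - 2 * int (i + k) < 0" if "k \<in> {..K} - {..nat n} \<or> k \<in> {..nat n} - {..K}" for k
    using that K by (auto; presburger)
  then show ?thesis unfolding D_def
    by (intro FF.M.add.finprod_mono_neutral_cong)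
      (use \<sigma>_closed[OF u] in \<open>auto intro!: \<sigma>_trivial[OF u] simp del: of_nat_add\<close>)
qed

lemma D_closed: "u \<in> carrier (G n) \<Longrightarrow> D n u \<in> carrier (G (n - 1))"
proof -
  assume u: "u \<in> carrier (G n)"
  interpret FF: Module.module Q "F j" for j by (rule modF)
  show ?thesis
    unfolding G_sel D_def using \<sigma>_closed[OF u] by (auto intro!: FF.M.finsum_closed)
qed

lemma D_hom: "D n \<in> mod_hom Q (G n) (G (n - 1))"
proof -
  interpret FF: Module.module Q "F j" for j by (rule modF)
  show ?thesis
  proof (rule mod_homI[OF D_closed])
    fix u v assume uv: "u \<in> carrier (G n)" "v \<in> carrier (G n)"
    show "D n (u \<oplus>\<^bsub>G n\<^esub> v) = D n u \<oplus>\<^bsub>G (n - 1)\<^esub> D n v"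
    proof
      fix i
      have "\<sigma> k (n - 2 * int (i + k)) ((u \<oplus>\<^bsub>G n\<^esub> v) (i + k)) = \<sigma> k (n - 2 * int (i + k)) (u (i + k))
          \<oplus>\<^bsub>F (n - 1 - 2 * int i)\<^esub> \<sigma> k (n - 2 * int (i + k)) (v (i + k))" for k
        using uv by (simp only: G_sel(3) mod_hom_add[OF \<sigma>_hom] G_sel(1))
      then have "D n (u \<oplus>\<^bsub>G n\<^esub> v) i = (\<Oplus>\<^bsub>F (n - 1 - 2 * int i)\<^esub> k \<in> {..nat n}. \<sigma> k (n - 2 * int (i + k)) (u (i + k))
          \<oplus>\<^bsub>F (n - 1 - 2 * int i)\<^esub> \<sigma> k (n - 2 * int (i + k)) (v (i + k)))"
        unfolding D_def by (simp only:)
      also have "\<dots> = D n u i \<oplus>\<^bsub>F (n - 1 - 2 * int i)\<^esub> D n v i"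
        unfolding D_def by (rule FF.M.finsum_addf) (use \<sigma>_closed[OF uv(1)] \<sigma>_closed[OF uv(2)] in blast)+
      finally show "D n (u \<oplus>\<^bsub>G n\<^esub> v) i = (D n u \<oplus>\<^bsub>G (n - 1)\<^esub> D n v) i"
        by (simp only: G_sel(3))
    qed
  next
    fix a u assume uv: "a \<in> carrier Q" "u \<in> carrier (G n)"
    show "D n (a \<odot>\<^bsub>G n\<^esub> u) = a \<odot>\<^bsub>G (n - 1)\<^esub> D n u"
    proof
      fix i
      have "\<sigma> k (n - 2 * int (i + k)) ((a \<odot>\<^bsub>G n\<^esub> u) (i + k)) =
          a \<odot>\<^bsub>F (n - 1 - 2 * int i)\<^esub> \<sigma> k (n - 2 * int (i + k)) (u (i + k))" for k
        using uv by (simp only: G_sel(4) mod_hom_smult[OF \<sigma>_hom] G_sel(1))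
      then have "D n (a \<odot>\<^bsub>G n\<^esub> u) i = (\<Oplus>\<^bsub>F (n - 1 - 2 * int i)\<^esub> k \<in> {..nat n}.
          a \<odot>\<^bsub>F (n - 1 - 2 * int i)\<^esub> \<sigma> k (n - 2 * int (i + k)) (u (i + k)))"
        unfolding D_def by (simp only:)
      also have "\<dots> = a \<odot>\<^bsub>F (n - 1 - 2 * int i)\<^esub> D n u i"
        unfolding D_def by (rule FF.finsum_smult_ldistr[symmetric]) (use \<sigma>_closed[OF uv(2)] uv(1) in blast)+
      finally show "D n (a \<odot>\<^bsub>G n\<^esub> u) i = (a \<odot>\<^bsub>G (n - 1)\<^esub> D n u) i"
        by (simp only: G_sel(4))
    qed
  qed
qed

text \<open>Together with \<open>unshift\<close>, \<open>incl\<close> and the projection to index 0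
  this realises the split sequence 0 \<rightarrow> F n \<rightarrow> G n \<rightarrow> G (n - 2)
  \<rightarrow> 0. Inclusion and shift are compatible with the differentials; the splitting maps are
  just linear.\<close>

definition shift :: "(nat \<Rightarrow> 'f) \<Rightarrow> nat \<Rightarrow> 'f" where "shift u = (\<lambda>i. u (Suc i))"

definition unshift :: "int \<Rightarrow> (nat \<Rightarrow> 'f) \<Rightarrow> nat \<Rightarrow> 'f" where
  "unshift n w = (\<lambda>i. case i of 0 \<Rightarrow> \<zero>\<^bsub>F n\<^esub> | Suc i \<Rightarrow> w i)"

definition incl :: "int \<Rightarrow> 'f \<Rightarrow> nat \<Rightarrow> 'f" where
  "incl n a = (\<lambda>i. case i of 0 \<Rightarrow> a | Suc i \<Rightarrow> \<zero>\<^bsub>F (n - 2 * int (Suc i))\<^esub>)"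

lemma index_Suc: "n - 2 * int (Suc i) = n - 2 - 2 * int i" by simp

lemma shift_hom: "shift \<in> mod_hom Q (G n) (G (n - 2))"
  by (rule mod_homI) (auto simp: G_sel shift_def index_Suc[symmetric] simp del: of_nat_Suc)

lemma unshift_hom: "unshift n \<in> mod_hom Q (G (n - 2)) (G n)"
proof -
  interpret FF: Module.module Q "F j" for j by (rule modF)
  show ?thesis
    by (rule mod_homI)
      (auto simp: G_sel unshift_def index_Suc fun_eq_iff simp del: of_nat_Suc split: nat.splits)
qed

lemma incl_hom: "incl n \<in> mod_hom Q (F n) (G n)"
proof -
  interpret FF: Module.module Q "F j" for j by (rule modF)
  show ?thesis
    by (rule mod_homI)
      (auto simp: G_sel incl_def fun_eq_iff simp del: of_nat_Suc split: nat.splits)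
qed

lemma proj_hom: "(\<lambda>u. u 0) \<in> mod_hom Q (G n) (F n)"
  by (rule mod_homI) (auto simp: G_sel dest: spec[of _ 0])

lemma decompose: "u \<in> carrier (G n) \<Longrightarrow> incl n (u 0) \<oplus>\<^bsub>G n\<^esub> unshift n (shift u) = u"
proof -
  interpret FF: Module.module Q "F j" for j by (rule modF)
  assume u: "u \<in> carrier (G n)"
  then have u0: "u i \<in> carrier (F (n - 2 * int i))" for i by (simp add: G_sel)
  have "u 0 \<in> carrier (F n)" using u0[of 0] by simp
  then show ?thesis
    using u0 by (auto simp: G_sel incl_def unshift_def shift_def fun_eq_iff simp del: of_nat_Suc split: nat.splits)
qed

text \<open>The homotopy \<open>\<sigma>\<^sub>k\<close> is applied in the same way at every index
  i, so shifting the indices changes nothing but the truncation bounds.\<close>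

lemma shift_D: "u \<in> carrier (G n) \<Longrightarrow> shift (D n u) = D (n - 2) (shift u)"
proof
  fix i assume u: "u \<in> carrier (G n)"
  have su: "shift u \<in> carrier (G (n - 2))" by (rule mod_hom_closed[OF shift_hom u])
  \<comment> \<open>One bound that is valid for both sums.\<close>
  define K where "K = nat n"
  have e: "n - 1 - 2 * int (Suc i) = n - 2 - 1 - 2 * int i" "\<And>k. n - 2 * int (Suc (i + k)) = n - 2 - 2 * int (i + k)"
    by auto
  show "shift (D n u) i = D (n - 2) (shift u) i"
    unfolding shift_def[of "D n u"]
    by (subst D_eq[OF u, of _ K], simp add: K_def, subst D_eq[OF su, of _ K], simp add: K_def)
      (simp only: e shift_def add_Suc)
qed

text \<open>Separates \<open>\<sigma>\<^sub>0\<close> = d from the terms that rigidity will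
  kill.\<close>

lemma D_proj: "u \<in> carrier (G n) \<Longrightarrow> n - 2 < 2 * int K + 2 \<Longrightarrow>
  D n u 0 = d n (u 0) \<oplus>\<^bsub>F (n - 1)\<^esub> (\<Oplus>\<^bsub>F (n - 1)\<^esub> k \<in> {..K}. \<sigma> (Suc k) (n - 2 * int (Suc k)) (u (Suc k)))"
proof -
  assume u: "u \<in> carrier (G n)" and K: "n - 2 < 2 * int K + 2"
  interpret FF: Module.module Q "F j" for j by (rule modF)
  have cl: "\<sigma> k (n - 2 * int k) (u k) \<in> carrier (F (n - 1))" for k
    using \<sigma>_closed[OF u, of k 0] by simp
  have "D n u 0 = (\<Oplus>\<^bsub>F (n - 1)\<^esub> k \<in> {..Suc K}. \<sigma> k (n - 2 * int k) (u k))"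
    using K D_eq[OF u, of 0 "Suc K"] by simp
  also have "\<dots> = (\<Oplus>\<^bsub>F (n - 1)\<^esub> k \<in> {..K}. \<sigma> (Suc k) (n - 2 * int (Suc k)) (u (Suc k))) \<oplus>\<^bsub>F (n - 1)\<^esub> \<sigma> 0 n (u 0)"
    using FF.M.finsum_Suc2[of "\<lambda>k. \<sigma> k (n - 2 * int k) (u k)" K "n - 1"] cl by (simp add: Pi_def)
  also have "\<sigma> 0 n (u 0) = d n (u 0)"
    using hom u unfolding higher_homotopies_def G_sel by (metis diff_zero mult_zero_right of_nat_0)
  finally have "D n u 0 = (\<Oplus>\<^bsub>F (n - 1)\<^esub> k \<in> {..K}. \<sigma> (Suc k) (n - 2 * int (Suc k)) (u (Suc k))) \<oplus>\<^bsub>F (n - 1)\<^esub> d n (u 0)" .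
  moreover have "(\<Oplus>\<^bsub>F (n - 1)\<^esub> k \<in> {..K}. \<sigma> (Suc k) (n - 2 * int (Suc k)) (u (Suc k))) \<in> carrier (F (n - 1))"
    using cl by (intro FF.M.finsum_closed) blast
  ultimately show ?thesis
    using cl[of 0] \<open>\<sigma> 0 n (u 0) = d n (u 0)\<close> FF.M.a_comm by simp
qed

text \<open>When every component of positive index is zero, \<open>\<sigma>\<^sub>0\<close> alone
  contributes, so F sits inside G as a subcomplex.\<close>

lemma D_incl: "a \<in> carrier (F n) \<Longrightarrow> D n (incl n a) = incl (n - 1) (d n a)"
proof
  fix i assume a: "a \<in> carrier (F n)"
  interpret FF: Module.module Q "F j" for j by (rule modF)
  have ia: "incl n a \<in> carrier (G n)" by (rule mod_hom_closed[OF incl_hom a])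
  have z: "\<sigma> k (n - 2 * int (i + k)) (incl n a (i + k)) = \<zero>\<^bsub>F (n - 1 - 2 * int i)\<^esub>" if "0 < i + k" for i k
  proof -
    have "incl n a (i + k) = \<zero>\<^bsub>F (n - 2 * int (i + k))\<^esub>"
      using that by (auto simp: incl_def simp del: of_nat_Suc of_nat_add split: nat.splits)
    then show ?thesis using mod_hom_zero[OF modF modF \<sigma>_hom] by simp
  qed
  show "D n (incl n a) i = incl (n - 1) (d n a) i"
  proof (cases i)
    case 0
    have "d n a \<in> carrier (F (n - 1))" by (rule mod_hom_closed[OF F.D a])
    then show ?thesis
      using D_proj[OF ia, of "nat n"] FF.M.add.finprod_one_eqI[of "{..nat n}" "\<lambda>k. \<sigma> (Suc k) (n - 2 * int (Suc k)) (incl n a (Suc k))" "n - 1"]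
        z[of 0 "Suc k" for k] 0
      by (simp add: incl_def)
  next
    case (Suc i')
    then show ?thesis unfolding D_def using z[of i] by (simp add: incl_def FF.M.add.finprod_one_eqI)
  qed
qed


text \<open>Expanding gives a triangular double sum; \<open>finsum_triangle\<close> collects on the
  diagonal m the products \<open>\<sigma>\<^sub>k \<sigma>\<^sub>l\<close> with k + l = m, applied
  to the component i + m. The homotopy relations make m = 0 vanish, turn m = 1 into multiplication
  by x, and make all later diagonals vanish.\<close>

lemma D_D: "u \<in> carrier (G n) \<Longrightarrow> D (n - 1) (D n u) = x \<odot>\<^bsub>G (n - 2)\<^esub> shift u"
proof
  fix i assume u: "u \<in> carrier (G n)"
  interpret FF: Module.module Q "F j" for j by (rule modF)
  \<comment> \<open>The extra 1 puts the diagonal m = 1 into the range even when n \<le> 0, and K -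
    k remains a valid bound for the inner sums.\<close>
  define K where "K = Suc (nat n)"
  define j where "j = n - 2 - 2 * int i"
  define a where "a k l = \<sigma> k (n - 1 - 2 * int (i + k)) (\<sigma> l (n - 2 * int (i + k + l)) (u (i + k + l)))" for k l
  have Du: "D n u \<in> carrier (G (n - 1))" by (rule D_closed[OF u])
  have jj: "n - 1 - 1 - 2 * int i = j" by (simp add: j_def)
  have acl: "a k l \<in> carrier (F j)" for k l
    using mod_hom_closed[OF \<sigma>_hom \<sigma>_closed[OF u], of k i l] unfolding a_def jj .
  have inner: "\<sigma> k (n - 1 - 2 * int (i + k)) (D n u (i + k)) = (\<Oplus>\<^bsub>F j\<^esub> l \<in> {..K - k}. a k l)" if "k \<le> K" for k
  proof -
    have "n - 2 * int (i + k) < 2 * int (K - k) + 2" using that by (auto simp: K_def of_nat_diff)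
    then have "D n u (i + k) = (\<Oplus>\<^bsub>F (n - 1 - 2 * int (i + k))\<^esub> l \<in> {..K - k}. \<sigma> l (n - 2 * int (i + k + l)) (u (i + k + l)))"
      by (rule D_eq[OF u])
    then show ?thesis
      using mod_hom_finsum_distrib[OF modF modF \<sigma>_hom[of k "n - 1" i], of "\<lambda>l. \<sigma> l (n - 2 * int (i + k + l)) (u (i + k + l))" "{..K - k}"]
        \<sigma>_closed[OF u, of _ "i + k"]
      unfolding a_def jj by (simp add: Pi_iff del: of_nat_add)
  qed
  have "D (n - 1) (D n u) i = (\<Oplus>\<^bsub>F j\<^esub> k \<in> {..K}. \<sigma> k (n - 1 - 2 * int (i + k)) (D n u (i + k)))"
    using D_eq[OF Du, of i K] unfolding jj by (simp add: K_def)
  also have "\<dots> = (\<Oplus>\<^bsub>F j\<^esub> k \<in> {..K}. \<Oplus>\<^bsub>F j\<^esub> l \<in> {..K - k}. a k l)"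
    by (rule FF.M.finsum_cong') (use inner acl in \<open>auto intro!: FF.M.finsum_closed\<close>)
  also have "\<dots> = (\<Oplus>\<^bsub>F j\<^esub> m \<in> {..K}. \<Oplus>\<^bsub>F j\<^esub> k \<in> {..m}. a k (m - k))"
    by (rule FF.M.finsum_triangle[OF acl])
  also have "\<dots> = (\<Oplus>\<^bsub>F j\<^esub> m \<in> {..K}. if m = 1 then x \<odot>\<^bsub>F j\<^esub> u (Suc i) else \<zero>\<^bsub>F j\<^esub>)"
  proof (rule FF.M.finsum_cong')
    have us: "u (Suc i) \<in> carrier (F j)" using u unfolding G_sel j_def by (metis index_Suc)
    then show "(\<lambda>m. if m = 1 then x \<odot>\<^bsub>F j\<^esub> u (Suc i) else \<zero>\<^bsub>F j\<^esub>) \<in> {..K} \<rightarrow> carrier (F j)"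
      using x by auto
    fix m assume "m \<in> {..K}"
    \<comment> \<open>The degree of F in which the component of index i + m lives.\<close>
    define p where "p = n - 2 * int (i + m)"
    have um: "u (i + m) \<in> carrier (F p)" using u unfolding G_sel p_def by blast
    have pj: "p + (2 * int m - 2) = j" by (simp add: p_def j_def)
    have am: "a k (m - k) = \<sigma> k (p + (2 * int (m - k) - 1)) (\<sigma> (m - k) p (u (i + m)))" if "k \<le> m" for k
    proof -
      have e1: "n - 1 - 2 * int (i + k) = p + (2 * int (m - k) - 1)" using that by (simp add: p_def of_nat_diff)
      have e2: "i + k + (m - k) = i + m" using that by simp
      show ?thesis by (simp only: a_def e1 e2 p_def[symmetric])
    qed
    consider "m = 0" | "m = 1" | "1 < m" by linarith
    then show "(\<Oplus>\<^bsub>F j\<^esub> k \<in> {..m}. a k (m - k)) = (if m = 1 then x \<odot>\<^bsub>F j\<^esub> u (Suc i) else \<zero>\<^bsub>F j\<^esub>)"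
    proof cases
      case 1
      have "\<sigma> 0 (p - 1) (\<sigma> 0 p (u i)) = d (p - 1) (d p (u i))"
        using hom um 1 mod_hom_closed[OF F.D um] unfolding higher_homotopies_def by auto
      also have "\<dots> = \<zero>\<^bsub>F j\<^esub>"
        using F.DD[of "u i" "p - 1"] um 1 pj xcong_zero_iff[OF modF zeroF] by (simp add: algebra_simps)
      finally show ?thesis using am[of 0] acl[of 0 0] 1 by (simp add: Pi_def)
    next
      case 2
      have "\<sigma> 0 (p + 1) (\<sigma> 1 p (u (i + 1))) \<oplus>\<^bsub>F p\<^esub> \<sigma> 1 (p - 1) (\<sigma> 0 p (u (i + 1))) = x \<odot>\<^bsub>F p\<^esub> u (i + 1)"
        using hom um 2 unfolding higher_homotopies_def by auto
      then have "a 0 1 \<oplus>\<^bsub>F j\<^esub> a 1 0 = x \<odot>\<^bsub>F j\<^esub> u (Suc i)"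
        using am[of 0] am[of 1] 2 pj by simp
      then have "a 1 0 \<oplus>\<^bsub>F j\<^esub> a 0 1 = x \<odot>\<^bsub>F j\<^esub> u (Suc i)" by (subst FF.M.a_comm) (auto intro: acl)
      then show ?thesis using 2 acl by (simp add: Pi_def)
    next
      case 3
      have "(\<Oplus>\<^bsub>F j\<^esub> k \<in> {..m}. a k (m - k))
          = (\<Oplus>\<^bsub>F j\<^esub> k \<in> {..m}. \<sigma> k (p + (2 * int (m - k) - 1)) (\<sigma> (m - k) p (u (i + m))))"
        by (rule FF.M.finsum_cong'[OF refl]) (auto simp: am[symmetric] acl simp del: of_nat_diff)
      also have "\<dots> = \<zero>\<^bsub>F j\<^esub>"
        using higher[OF 3 um] unfolding pj .
      finally show ?thesis using 3 by simp
    qed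
  qed simp
  also have "\<dots> = x \<odot>\<^bsub>F j\<^esub> u (Suc i)"
  proof -
    have us: "u (Suc i) \<in> carrier (F j)" using u unfolding G_sel j_def by (metis index_Suc)
    then show ?thesis
      using FF.M.add.finprod_singleton_swap[of 1 "{..K}" "\<lambda>_. x \<odot>\<^bsub>F j\<^esub> u (Suc i)" j] x
      by (simp add: K_def)
  qed
  finally show "D (n - 1) (D n u) i = (x \<odot>\<^bsub>G (n - 2)\<^esub> shift u) i"
    by (simp add: G_sel shift_def j_def)
qed

definition \<epsilon>G :: "(nat \<Rightarrow> 'f) \<Rightarrow> 'm" where "\<epsilon>G u = \<epsilon> (u 0)"

text \<open>Built up in steps of 2 along the split sequence, starting from the trivial modules in
  negative degrees.\<close>

lemma projective_G: "projective Q (G n)"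
\<comment> \<open>The offset 2 keeps the measure decreasing from n = 0 to n = -2.\<close>
proof (induction "nat (n + 2)" arbitrary: n rule: less_induct)
  case less
  show ?case
  proof (cases "n < 0")
    case True
    then have "carrier (G n) = {\<zero>\<^bsub>G n\<^esub>}" using F.trivX by (auto simp: G_sel fun_eq_iff)
    then show ?thesis by (rule projective_trivial[OF modG])
  next
    case False
    then have "projective Q (G (n - 2))" by (intro less) auto
    then show ?thesis
      by (rule projective_split[OF modG modF modG F.projX _ incl_hom proj_hom unshift_hom shift_hom])
        (rule decompose)
  qed
qed

lemma torsion_freeG:
  assumes "u \<in> carrier (G n)" "x \<odot>\<^bsub>G n\<^esub> u = \<zero>\<^bsub>G n\<^esub>" shows "u = \<zero>\<^bsub>G n\<^esub>"
  by (rule projective_torsion_free[OF modG projective_G nzd assms])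

lemma shift_unshift: "shift (unshift n w) = w" by (simp add: shift_def unshift_def)

text \<open>If \<open>D u = x w\<close>, then \<open>x D w = D\<^sup>2 u = x (shift u)\<close>, so \<open>shift u = D w\<close>.  Hence
  \<open>u\<close> and \<open>D (unshift w)\<close> differ only in the component of index \<open>0\<close>, and there by
  a cycle of \<open>F\<close>.\<close>

lemma exactG:
  assumes n: "0 < n" and u: "u \<in> carrier (G n)" and w: "w \<in> carrier (G (n - 1))"
    and Du: "D n u = x \<odot>\<^bsub>G (n - 1)\<^esub> w"
  shows "\<exists>v\<in>carrier (G (n + 1)). u = D (n + 1) v"
proof -
  interpret GG: Module.module Q "G j" for j by (rule modG)
  interpret FF: Module.module Q "F j" for j by (rule modF)
  have Dw: "D (n - 1) w \<in> carrier (G (n - 2))" and su: "shift u \<in> carrier (G (n - 2))"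
    using D_closed[OF w] mod_hom_closed[OF shift_hom u] by simp_all
  have "x \<odot>\<^bsub>G (n - 2)\<^esub> D (n - 1) w = x \<odot>\<^bsub>G (n - 2)\<^esub> shift u"
    using D_D[OF u] mod_hom_smult[OF D_hom x w] by (simp add: Du)
  then have "x \<odot>\<^bsub>G (n - 2)\<^esub> (D (n - 1) w \<ominus>\<^bsub>G (n - 2)\<^esub> shift u) = \<zero>\<^bsub>G (n - 2)\<^esub>"
    using Dw su x by (simp add: a_minus_def GG.smult_r_distr GG.smult_r_minus GG.M.r_neg)
  then have "D (n - 1) w \<ominus>\<^bsub>G (n - 2)\<^esub> shift u = \<zero>\<^bsub>G (n - 2)\<^esub>"
    by (rule torsion_freeG[OF GG.M.minus_closed[OF Dw su]])
  then have Dwu: "D (n - 1) w = shift u"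
    using Dw su GG.M.minus_add_cancel[OF su Dw] by simp
  define v where "v = unshift (n + 1) w"
  have w': "w \<in> carrier (G (n + 1 - 2))" using w by simp
  have v: "v \<in> carrier (G (n + 1))" unfolding v_def by (rule mod_hom_closed[OF unshift_hom w'])
  have Dv: "D (n + 1) v \<in> carrier (G n)" using D_closed[OF v] by simp
  define e where "e = u \<ominus>\<^bsub>G n\<^esub> D (n + 1) v"
  have e: "e \<in> carrier (G n)" unfolding e_def using u Dv by simp
  have sv: "shift v = w" by (simp add: v_def shift_unshift)
  have "shift (D (n + 1) v) = shift u"
    using shift_D[OF v] Dwu by (simp add: sv)
  then have se: "shift e = \<zero>\<^bsub>G (n - 2)\<^esub>"
    unfolding e_def mod_hom_minus[OF modG modG shift_hom u Dv] using su by (simp add: a_minus_def GG.M.r_neg)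
  have "unshift n \<zero>\<^bsub>G (n - 2)\<^esub> = \<zero>\<^bsub>G n\<^esub>" by (rule mod_hom_zero[OF modG modG unshift_hom])
  then have e_eq: "e = incl n (e 0)"
    using decompose[OF e] se mod_hom_closed[OF incl_hom mod_hom_closed[OF proj_hom e]] by simp
  have e0: "e 0 \<in> carrier (F n)" by (rule mod_hom_closed[OF proj_hom e])
  have "D n (D (n + 1) v) = x \<odot>\<^bsub>G (n - 1)\<^esub> w" using D_D[OF v] sv by simp
  then have "D n e = \<zero>\<^bsub>G (n - 1)\<^esub>"
    unfolding e_def mod_hom_minus[OF modG modG D_hom u Dv] using Du w x by (simp add: a_minus_def GG.M.r_neg)
  then have "incl (n - 1) (d n (e 0)) = \<zero>\<^bsub>G (n - 1)\<^esub>" using D_incl[OF e0] e_eq by simp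
  then have "incl (n - 1) (d n (e 0)) 0 = \<zero>\<^bsub>G (n - 1)\<^esub> 0" by simp
  then have "d n (e 0) = \<zero>\<^bsub>F (n - 1)\<^esub>" by (simp add: incl_def G_sel)
  then obtain a where a: "a \<in> carrier (F (n + 1))" "e 0 = d (n + 1) a"
    using F.exact_pos[OF n e0] xcong_zero_iff[OF modF zeroF] xcong_zero_iff[OF modF mod_hom_closed[OF F.D']] by auto
  have ia: "incl (n + 1) a \<in> carrier (G (n + 1))" by (rule mod_hom_closed[OF incl_hom a(1)])
  have "D (n + 1) (incl (n + 1) a \<oplus>\<^bsub>G (n + 1)\<^esub> v) = e \<oplus>\<^bsub>G n\<^esub> D (n + 1) v"
    using mod_hom_add[OF D_hom ia v] D_incl[OF a(1)] a(2) e_eq by simp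
  also have "\<dots> = u" unfolding e_def using u Dv by (simp add: GG.M.minus_add_cancel)
  finally show ?thesis using ia v by (intro bexI[of _ "incl (n + 1) a \<oplus>\<^bsub>G (n + 1)\<^esub> v"]) auto
qed

text \<open>Modulo x, \<open>D_D\<close> makes G a complex and \<open>exactG\<close> makes it exact
  in positive degrees. In degrees 0 and 1 the summand F is all there is, so the augmentation is
  handled as for F.\<close>

sublocale G: xresolution Q M x G D \<epsilon>G
proof (rule xresolution.intro)
  interpret GG: Module.module Q "G j" for j by (rule modG)
  interpret FF: Module.module Q "F j" for j by (rule modF)
  interpret M: Module.module Q M by (rule M)
  show \<epsilon>h: "\<epsilon>G \<in> mod_hom Q (G 0) M"
    unfolding \<epsilon>G_def[abs_def] by (rule mod_hom_comp[OF F.\<epsilon> proj_hom])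
  show "carrier (G j) = {\<zero>\<^bsub>G j\<^esub>}" if "j < 0" for j
    using that F.trivX by (auto simp: G_sel fun_eq_iff)
  show "\<exists>u\<in>carrier (G 0). \<epsilon>G u = m" if "m \<in> carrier M" for m
  proof -
    obtain a where "a \<in> carrier (F 0)" "\<epsilon> a = m" using F.\<epsilon>_surj[OF \<open>m \<in> carrier M\<close>] by auto
    then show ?thesis using mod_hom_closed[OF incl_hom]
      by (intro bexI[of _ "incl 0 a"]) (auto simp: \<epsilon>G_def incl_def)
  qed
  show "\<epsilon>G u = \<zero>\<^bsub>M\<^esub> \<longleftrightarrow> (\<exists>v\<in>carrier (G 1). xcong (G 0) x u (D 1 v))" if u: "u \<in> carrier (G 0)" for u
  proof
    have u0: "u 0 \<in> carrier (F 0)" by (rule mod_hom_closed[OF proj_hom u])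
    assume "\<epsilon>G u = \<zero>\<^bsub>M\<^esub>"
    then obtain a where a: "a \<in> carrier (F 1)" "u 0 = d 1 a"
      using F.exact0[OF u0] xcong_zero_iff[OF modF mod_hom_closed[OF F.D'[of 0]]] by (auto simp: \<epsilon>G_def)
    have ia: "incl 1 a \<in> carrier (G 1)" by (rule mod_hom_closed[OF incl_hom a(1)])
    \<comment> \<open>In degree 0 all components of positive index lie in negative degrees of
      F.\<close>
    have "u = incl 0 (u 0)"
    proof
      fix i show "u i = incl 0 (u 0) i"
        using G_trivial[OF u, of i] by (cases i) (auto simp: incl_def)
    qed
    then have "u = D 1 (incl 1 a)" using D_incl[OF a(1)] a(2) by simp
    then show "\<exists>v\<in>carrier (G 1). xcong (G 0) x u (D 1 v)"
      using ia xcong_refl[OF modG x u] by (intro bexI[of _ "incl 1 a"]) auto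
  next
    assume "\<exists>v\<in>carrier (G 1). xcong (G 0) x u (D 1 v)"
    then obtain v where v: "v \<in> carrier (G 1)" "xcong (G 0) x u (D 1 v)" by blast
    have Dv: "D 1 v \<in> carrier (G 0)" using D_closed[OF v(1)] by simp
    have v0: "v 0 \<in> carrier (F 1)" by (rule mod_hom_closed[OF proj_hom v(1)])
    \<comment> \<open>The first correction term starts in degree -1, so on the component of index 0
      the map D 1 is d 1.\<close>
    have "\<sigma> (Suc 0) (1 - 2 * int (Suc 0)) (v (Suc 0)) = \<zero>\<^bsub>F 0\<^esub>"
      using \<sigma>_trivial[OF v(1), of 0 "Suc 0"] by simp
    then have "D 1 v 0 = d 1 (v 0)"
      using D_proj[OF v(1), of 0] mod_hom_closed[OF F.D v0] by (simp add: Pi_def)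
    moreover have "\<epsilon> (d 1 (v 0)) = \<zero>\<^bsub>M\<^esub>"
      using F.exact0[of "d 1 (v 0)"] v0 mod_hom_closed[OF F.D v0] xcong_zero_iff[OF modF mod_hom_closed[OF F.D v0]] by auto
    ultimately have "\<epsilon>G (D 1 v) = \<zero>\<^bsub>M\<^esub>" by (simp add: \<epsilon>G_def)
    moreover have "xcong M x (\<epsilon>G u) (\<epsilon>G (D 1 v))" by (rule xcong_hom[OF modG x M \<epsilon>h v(2) Dv])
    ultimately show "\<epsilon>G u = \<zero>\<^bsub>M\<^esub>" using xcong_killed[OF M x] xM by auto
  qed
  show "xcong (G (j - 1)) x (D j u) \<zero>\<^bsub>G (j - 1)\<^esub> \<longleftrightarrow> (\<exists>v\<in>carrier (G (j + 1)). xcong (G j) x u (D (j + 1) v))"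
    if j: "0 < j" and u: "u \<in> carrier (G j)" for j u
  proof
    assume "xcong (G (j - 1)) x (D j u) \<zero>\<^bsub>G (j - 1)\<^esub>"
    then obtain w where "w \<in> carrier (G (j - 1))" "D j u = x \<odot>\<^bsub>G (j - 1)\<^esub> w" using x by (auto simp: xcong_def)
    then obtain v where "v \<in> carrier (G (j + 1))" "u = D (j + 1) v" using exactG[OF j u] by blast
    then show "\<exists>v\<in>carrier (G (j + 1)). xcong (G j) x u (D (j + 1) v)"
      using xcong_refl[OF modG x u] by auto
  next
    assume "\<exists>v\<in>carrier (G (j + 1)). xcong (G j) x u (D (j + 1) v)"
    then obtain v where v: "v \<in> carrier (G (j + 1))" "xcong (G j) x u (D (j + 1) v)" by blast
    have Dv: "D (j + 1) v \<in> carrier (G j)" using D_closed[OF v(1)] by simp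
    have sv: "shift v \<in> carrier (G (j - 1))" using mod_hom_closed[OF shift_hom v(1)] by simp
    have "xcong (G (j - 1)) x (D j u) (D j (D (j + 1) v))" by (rule xcong_hom[OF modG x modG D_hom v(2) Dv])
    moreover have "D j (D (j + 1) v) = x \<odot>\<^bsub>G (j - 1)\<^esub> shift v" using D_D[OF v(1)] by simp
    moreover have "xcong (G (j - 1)) x (x \<odot>\<^bsub>G (j - 1)\<^esub> shift v) \<zero>\<^bsub>G (j - 1)\<^esub>"
      by (rule xcong_smult_zero[OF modG x sv])
    ultimately show "xcong (G (j - 1)) x (D j u) \<zero>\<^bsub>G (j - 1)\<^esub>"
      using xcong_trans[OF modG x _ _ GG.M.zero_closed, of "j - 1" "D j u" "D j (D (j + 1) v)"] by simp
  qed
qed (use M x modG projective_G D_hom in auto)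

end

section \<open>Splitting of the homology under pre-rigidity\<close>

text \<open>Rigidity is assumed in every degree j, which the final proof obtains from pre-rigidity
  of degree 0 and the vanishing of F in negative degrees.\<close>

locale rigid_homotopy_resolution = homotopy_resolution Q x M F d \<epsilon> \<sigma>
  for Q :: "('q, 'z) ring_scheme" and x :: 'q and M :: "('q, 'm) module"
    and F :: "int \<Rightarrow> ('q, 'f) module" and d \<epsilon> \<sigma> +
  fixes N :: "('q, 'n) module"
  assumes N: "Module.module Q N" and xN: "\<forall>v\<in>carrier N. x \<odot>\<^bsub>N\<^esub> v = \<zero>\<^bsub>N\<^esub>"
    and rigid: "1 \<le> i \<Longrightarrow> t \<in> carrier (tensor Q (F j) N) \<Longrightarrow>
      tensor_map Q (F (j + (2 * int i - 1))) N (\<sigma> i j) t = \<zero>\<^bsub>tensor Q (F (j + (2 * int i - 1))) N\<^esub>"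
begin

lemma zeroN: "\<forall>v\<in>carrier N. \<zero>\<^bsub>Q\<^esub> \<odot>\<^bsub>N\<^esub> v = \<zero>\<^bsub>N\<^esub>"
proof -
  interpret N: Module.module Q N by (rule N)
  show ?thesis by simp
qed

section \<open>The split sequence of F, G and shifted G after tensoring\<close>

abbreviation "TG n \<equiv> tensor Q (G n) N"
abbreviation "TF n \<equiv> tensor Q (F n) N"
abbreviation "TD n \<equiv> tensor_map Q (G (n - 1)) N (D n)"
abbreviation "Td n \<equiv> tensor_map Q (F (n - 1)) N (d n)"
abbreviation "T\<iota> n \<equiv> tensor_map Q (G n) N (incl n)"
abbreviation "T\<pi> n \<equiv> tensor_map Q (F n) N (\<lambda>u. u 0)"
abbreviation "Tsh n \<equiv> tensor_map Q (G n) N shift"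
abbreviation "Tun n \<equiv> tensor_map Q (G n) N (unshift n)"

lemma modTG: "Module.module Q (TG n)" by (rule G.module_TX[OF N xN])
lemma modTF: "Module.module Q (TF n)" by (rule F.module_TX[OF N zeroN])

lemma T\<iota>: "T\<iota> n \<in> mod_hom Q (TF n) (TG n)" by (rule tensor_map_hom[OF modF modG N incl_hom])
lemma T\<pi>: "T\<pi> n \<in> mod_hom Q (TG n) (TF n)" by (rule tensor_map_hom[OF modG modF N proj_hom])
lemma Tsh: "Tsh (n - 2) \<in> mod_hom Q (TG n) (TG (n - 2))" by (rule tensor_map_hom[OF modG modG N shift_hom])
lemma Tun: "Tun n \<in> mod_hom Q (TG (n - 2)) (TG n)" by (rule tensor_map_hom[OF modG modG N unshift_hom])
lemma TD: "TD n \<in> mod_hom Q (TG n) (TG (n - 1))" by (rule tensor_map_hom[OF modG modG N D_hom])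
lemma Td: "Td n \<in> mod_hom Q (TF n) (TF (n - 1))" by (rule tensor_map_hom[OF modF modF N F.D])

lemma tensor_cong:
  assumes "Module.module Q X" "Module.module Q Y" "g \<in> mod_hom Q X Y" "h \<in> mod_hom Q X Y"
    "t \<in> carrier (tensor Q X N)" "\<And>u. u \<in> carrier X \<Longrightarrow> g u = h u"
  shows "tensor_map Q Y N g t = tensor_map Q Y N h t"
proof -
  interpret X: Module.module Q X by fact
  interpret Y: Module.module Q Y by fact
  show ?thesis
    by (rule tensor_map_xcong[OF assms(1,2) N X.R.zero_closed zeroN assms(3-5)])
      (simp add: xcong_zero_iff[OF assms(2) mod_hom_closed[OF assms(4)]] assms(6))
qed

lemma T\<pi>_T\<iota>: "t \<in> carrier (TF n) \<Longrightarrow> T\<pi> n (T\<iota> n t) = t"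
proof -
  assume t: "t \<in> carrier (TF n)"
  have "T\<pi> n (T\<iota> n t) = tensor_map Q (F n) N (\<lambda>a. incl n a 0) t"
    by (rule tensor_map_comp[OF modF modG modF N incl_hom proj_hom t, symmetric])
  also have "\<dots> = tensor_map Q (F n) N (\<lambda>a. a) t"
    by (rule tensor_cong[OF modF modF mod_hom_comp[OF proj_hom incl_hom] mod_hom_id t]) (simp add: incl_def)
  finally show ?thesis by (simp add: tensor_map_id[OF modF N t])
qed

lemma Tsh_T\<iota>: "t \<in> carrier (TF n) \<Longrightarrow> Tsh (n - 2) (T\<iota> n t) = \<zero>\<^bsub>TG (n - 2)\<^esub>"
  unfolding tensor_map_comp[OF modF modG modG N incl_hom shift_hom, symmetric]
  by (rule tensor_map_zero[OF modF modG N mod_hom_comp[OF shift_hom incl_hom]])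
    (auto simp: incl_def shift_def G_sel index_Suc simp del: of_nat_Suc)

lemma Tsh_Tun: "t \<in> carrier (TG (n - 2)) \<Longrightarrow> Tsh (n - 2) (Tun n t) = t"
proof -
  assume t: "t \<in> carrier (TG (n - 2))"
  have "Tsh (n - 2) (Tun n t) = tensor_map Q (G (n - 2)) N (\<lambda>w. shift (unshift n w)) t"
    by (rule tensor_map_comp[OF modG modG modG N unshift_hom shift_hom t, symmetric])
  then show ?thesis by (simp add: shift_unshift tensor_map_id[OF modG N t])
qed

lemma T\<pi>_Tun: "t \<in> carrier (TG (n - 2)) \<Longrightarrow> T\<pi> n (Tun n t) = \<zero>\<^bsub>TF n\<^esub>"
  unfolding tensor_map_comp[OF modG modG modF N unshift_hom proj_hom, symmetric]
  by (rule tensor_map_zero[OF modG modF N mod_hom_comp[OF proj_hom unshift_hom]]) (auto simp: unshift_def)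

lemma T_decompose: "t \<in> carrier (TG n) \<Longrightarrow> T\<iota> n (T\<pi> n t) \<oplus>\<^bsub>TG n\<^esub> Tun n (Tsh (n - 2) t) = t"
proof -
  assume t: "t \<in> carrier (TG n)"
  note ip = mod_hom_comp[OF incl_hom proj_hom] and us = mod_hom_comp[OF unshift_hom shift_hom]
  have "T\<iota> n (T\<pi> n t) \<oplus>\<^bsub>TG n\<^esub> Tun n (Tsh (n - 2) t)
      = tensor_map Q (G n) N (\<lambda>u. incl n (u 0)) t \<oplus>\<^bsub>TG n\<^esub> tensor_map Q (G n) N (\<lambda>u. unshift n (shift u)) t"
    by (simp only: tensor_map_comp[OF modG modF modG N proj_hom incl_hom t]
        tensor_map_comp[OF modG modG modG N shift_hom unshift_hom t])
  also have "\<dots> = tensor_map Q (G n) N (\<lambda>u. incl n (u 0) \<oplus>\<^bsub>G n\<^esub> unshift n (shift u)) t"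
    by (rule tensor_map_plus[OF modG modG N ip us t, symmetric])
  also have "\<dots> = tensor_map Q (G n) N (\<lambda>u. u) t"
    by (rule tensor_cong[OF modG modG mod_hom_plus[OF modG ip us] mod_hom_id t]) (rule decompose)
  finally show ?thesis by (simp add: tensor_map_id[OF modG N t])
qed

lemma TD_T\<iota>: "t \<in> carrier (TF n) \<Longrightarrow> TD n (T\<iota> n t) = T\<iota> (n - 1) (Td n t)"
  by (simp only: tensor_map_comp[OF modF modG modG N incl_hom D_hom, symmetric]
      tensor_map_comp[OF modF modF modG N F.D incl_hom, symmetric])
    (rule tensor_cong[OF modF modG mod_hom_comp[OF D_hom incl_hom] mod_hom_comp[OF incl_hom F.D]], auto simp: D_incl)

lemma Tsh_TD: "t \<in> carrier (TG n) \<Longrightarrow> Tsh (n - 1 - 2) (TD n t) = TD (n - 2) (Tsh (n - 2) t)"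
proof -
  assume t: "t \<in> carrier (TG n)"
  have idx: "n - 2 - 1 = n - 1 - 2" by simp
  have D': "D (n - 2) \<in> mod_hom Q (G (n - 2)) (G (n - 1 - 2))" using D_hom[of "n - 2"] unfolding idx .
  show ?thesis
    unfolding idx tensor_map_comp[OF modG modG modG N D_hom shift_hom t, symmetric]
      tensor_map_comp[OF modG modG modG N shift_hom D' t, symmetric]
    by (rule tensor_cong[OF modG modG mod_hom_comp[OF shift_hom D_hom] mod_hom_comp[OF D' shift_hom] t]) (rule shift_D)
qed

text \<open>This is where rigidity acts: the correction terms in component 0 of D u tensor to zero,
  so the projection onto F becomes a chain map.\<close>

lemma T\<pi>_TD: "t \<in> carrier (TG n) \<Longrightarrow> T\<pi> (n - 1) (TD n t) = Td n (T\<pi> n t)"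
proof -
  assume t: "t \<in> carrier (TG n)"
  interpret GN: tensor_prod Q "G n" N by (rule tensor_prodI[OF modG N])
  interpret FN: tensor_prod Q "F (n - 1)" N by (rule tensor_prodI[OF modF N])
  interpret TFn: Module.module Q "TF (n - 1)" by (rule modTF)
  interpret FF: Module.module Q "F (n - 1)" by (rule modF)
  \<comment> \<open>The elements whose pure tensors with N all vanish form a submodule, so the whole
    correction sum lies in H once each of its terms does.\<close>
  define H where "H = {a \<in> carrier (F (n - 1)). \<forall>v\<in>carrier N. pure_tensor Q (F (n - 1)) N a v = \<zero>\<^bsub>TF (n - 1)\<^esub>}"
  have pz: "pure_tensor Q (F (n - 1)) N \<zero>\<^bsub>F (n - 1)\<^esub> v = \<zero>\<^bsub>TF (n - 1)\<^esub>" if "v \<in> carrier N" for v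
    using FN.pure_smult_left[of "\<zero>\<^bsub>Q\<^esub>" "\<zero>\<^bsub>F (n - 1)\<^esub>" v] that FN.pure_closed[of "\<zero>\<^bsub>F (n - 1)\<^esub>" v] by simp
  have H: "submodule H Q (F (n - 1))"
    by (rule submodule_intro[OF modF])
      (auto simp: H_def pz FN.pure_add_left FN.pure_smult_left)
  have *: "D n u 0 = d n (u 0) \<oplus>\<^bsub>F (n - 1)\<^esub> (\<Oplus>\<^bsub>F (n - 1)\<^esub> k \<in> {..nat n}. \<sigma> (Suc k) (n - 2 * int (Suc k)) (u (Suc k)))"
    and mem: "(\<Oplus>\<^bsub>F (n - 1)\<^esub> k \<in> {..nat n}. \<sigma> (Suc k) (n - 2 * int (Suc k)) (u (Suc k))) \<in> H"
    if u: "u \<in> carrier (G n)" for u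
  proof -
    show "D n u 0 = d n (u 0) \<oplus>\<^bsub>F (n - 1)\<^esub> (\<Oplus>\<^bsub>F (n - 1)\<^esub> k \<in> {..nat n}. \<sigma> (Suc k) (n - 2 * int (Suc k)) (u (Suc k)))"
      by (rule D_proj[OF u]) simp
    show "(\<Oplus>\<^bsub>F (n - 1)\<^esub> k \<in> {..nat n}. \<sigma> (Suc k) (n - 2 * int (Suc k)) (u (Suc k))) \<in> H"
    proof (rule submodule_finsum[OF modF H])
      fix k assume "k \<in> {..nat n}"
      define p where "p = n - 2 * int (Suc k)"
      have up: "u (Suc k) \<in> carrier (F p)" using u unfolding G_sel p_def by blast
      have idx: "p + (2 * int (Suc k) - 1) = n - 1" by (simp add: p_def)
      have \<sigma>p: "\<sigma> (Suc k) p \<in> mod_hom Q (F p) (F (n - 1))"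
        using \<sigma>_hom[of "Suc k" n 0] by (simp add: p_def)
      interpret FP: tensor_prod Q "F p" N by (rule tensor_prodI[OF modF N])
      have "pure_tensor Q (F (n - 1)) N (\<sigma> (Suc k) p (u (Suc k))) v = \<zero>\<^bsub>TF (n - 1)\<^esub>" if v: "v \<in> carrier N" for v
        using tensor_map_pure[OF modF modF N \<sigma>p up v] rigid[of "Suc k" _ p, unfolded idx, OF _ FP.pure_closed[OF up v]] by simp
      then show "\<sigma> (Suc k) (n - 2 * int (Suc k)) (u (Suc k)) \<in> H"
        using mod_hom_closed[OF \<sigma>p up] unfolding H_def p_def[symmetric] by simp
    qed
  qed
  have "tensor_map Q (F (n - 1)) N (\<lambda>u. D n u 0) t = tensor_map Q (F (n - 1)) N (\<lambda>u. d n (u 0)) t"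
  proof (rule GN.tensor_hom_eq[OF FN.module_tensor tensor_map_hom[OF modG modF N mod_hom_comp[OF proj_hom D_hom]]
        tensor_map_hom[OF modG modF N mod_hom_comp[OF F.D proj_hom]] _ t])
    fix u v assume uv: "u \<in> carrier (G n)" "v \<in> carrier N"
    have "d n (u 0) \<in> carrier (F (n - 1))" by (rule mod_hom_closed[OF mod_hom_comp[OF F.D proj_hom] uv(1)])
    then have "pure_tensor Q (F (n - 1)) N (D n u 0) v = pure_tensor Q (F (n - 1)) N (d n (u 0)) v"
      using mem[OF uv(1)] uv(2) FN.pure_closed unfolding *[OF uv(1)] H_def by (simp add: FN.pure_add_left)
    then show "tensor_map Q (F (n - 1)) N (\<lambda>u. D n u 0) (pure_tensor Q (G n) N u v)
        = tensor_map Q (F (n - 1)) N (\<lambda>u. d n (u 0)) (pure_tensor Q (G n) N u v)"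
      unfolding tensor_map_pure[OF modG modF N mod_hom_comp[OF proj_hom D_hom] uv]
        tensor_map_pure[OF modG modF N mod_hom_comp[OF F.D proj_hom] uv] .
  qed
  then show ?thesis
    unfolding tensor_map_comp[OF modG modG modF N D_hom proj_hom t, symmetric]
      tensor_map_comp[OF modG modF modF N proj_hom F.D t, symmetric] .
qed

text \<open>By \<open>T_decompose\<close> an element is determined by its projection to F and its
  shift. The projection of the left-hand side vanishes by \<open>T\<pi>_TD\<close>, and its shift is
  the differential of t. Hence the splitting of the shift is now a chain map.\<close>

lemma TD_Tun: "t \<in> carrier (TG (n - 2)) \<Longrightarrow> TD n (Tun n t) = Tun (n - 1) (TD (n - 2) t)"
proof -
  assume t: "t \<in> carrier (TG (n - 2))"
  interpret T: Module.module Q "TG (n - 1)" by (rule modTG)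
  have idx: "n - 2 - 1 = n - 1 - 2" by simp
  have ut: "Tun n t \<in> carrier (TG n)" by (rule mod_hom_closed[OF Tun t])
  have DUt: "TD n (Tun n t) \<in> carrier (TG (n - 1))" by (rule mod_hom_closed[OF TD ut])
  have "T\<pi> (n - 1) (TD n (Tun n t)) = \<zero>\<^bsub>TF (n - 1)\<^esub>"
    unfolding T\<pi>_TD[OF ut] T\<pi>_Tun[OF t] by (rule mod_hom_zero[OF modTF modTF Td])
  then have "T\<iota> (n - 1) (T\<pi> (n - 1) (TD n (Tun n t))) = \<zero>\<^bsub>TG (n - 1)\<^esub>"
    using mod_hom_zero[OF modTF modTG T\<iota>] by simp
  moreover have "Tsh (n - 1 - 2) (TD n (Tun n t)) = TD (n - 2) t"
    unfolding Tsh_TD[OF ut] Tsh_Tun[OF t] ..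
  moreover have "Tun (n - 1) (TD (n - 2) t) \<in> carrier (TG (n - 1))"
    using mod_hom_closed[OF Tun mod_hom_closed[OF TD t, unfolded idx]] unfolding idx .
  ultimately show ?thesis using T_decompose[OF DUt] by (simp add: idx)
qed

text \<open>Since both splitting maps commute with the differentials, the homology splits:
  boundaries \<subseteq> K \<subseteq> cycles has H_n(F \<otimes> N) as its lower and H_{n-2}(G
  \<otimes> N) as its upper quotient.\<close>

theorem hlength_step: "G.hlength N n = F.hlength N n + G.hlength N (n - 2)"
proof -
  interpret T: Module.module Q "TG j" for j by (rule modTG)
  interpret TF: Module.module Q "TF j" for j by (rule modTF)
  note cyc = G.submodule_cycles[OF N xN] and bd = G.submodule_boundaries[OF N xN]
    and sub = G.boundaries_subset_cycles[OF N xN]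
  note cycF = F.submodule_cycles[OF N zeroN] and bdF = F.submodule_boundaries[OF N zeroN]
    and subF = F.boundaries_subset_cycles[OF N zeroN]
  have idx: "n - 2 - 1 = n - 1 - 2" "n + 1 - 2 = n - 2 + 1" "n - 1 + 1 = n" by simp_all
  have TD': "TD (n + 1) s = tensor_map Q (G n) N (D (n + 1)) s" for s by simp
  have Td': "Td (n + 1) s = tensor_map Q (F n) N (d (n + 1)) s" for s by simp
  have sh: "Tsh (n - 2) \<in> mod_hom Q (TG n) (TG (n - 2))" by (rule Tsh)
  have sh_cyc: "Tsh (n - 2) t \<in> G.cycles N (n - 2)" if "t \<in> G.cycles N n" for t
    using that Tsh_TD[of t n] mod_hom_closed[OF sh] mod_hom_zero[OF modTG modTG Tsh[of "n - 1"]]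
    unfolding G.cycles_def idx by auto
  have sh_bd: "Tsh (n - 2) t \<in> G.boundaries N (n - 2)" if t: "t \<in> G.boundaries N n" for t
  proof -
    obtain s where s: "s \<in> carrier (TG (n + 1))" "t = TD (n + 1) s" using t by (auto simp: G.boundaries_def)
    have "Tsh (n + 1 - 1 - 2) (TD (n + 1) s) = TD (n + 1 - 2) (Tsh (n + 1 - 2) s)" by (rule Tsh_TD[OF s(1)])
    then have "Tsh (n - 2) t = tensor_map Q (G (n - 2)) N (D (n - 2 + 1)) (Tsh (n + 1 - 2) s)"
      using s(2) by (simp add: algebra_simps)
    moreover have "Tsh (n + 1 - 2) s \<in> carrier (TG (n - 2 + 1))"
      using mod_hom_closed[OF Tsh s(1)] unfolding idx .
    ultimately show ?thesis unfolding G.boundaries_def by blast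
  qed
  \<comment> \<open>The cycles whose class is killed by the map that the shift induces on
    homology.\<close>
  define K where "K = {t \<in> G.cycles N n. Tsh (n - 2) t \<in> G.boundaries N (n - 2)}"
  have K: "submodule K Q (TG n)"
  proof -
    have "K = G.cycles N n \<inter> {t \<in> carrier (TG n). Tsh (n - 2) t \<in> G.boundaries N (n - 2)}"
      using submodule_subset[OF cyc] by (auto simp: K_def)
    then show ?thesis
      using submodule_Inter[OF modTG, of "{G.cycles N n, {t \<in> carrier (TG n). Tsh (n - 2) t \<in> G.boundaries N (n - 2)}}"]
        cyc submodule_preimage[OF modTG modTG sh bd] by auto
  qed
  have BK: "G.boundaries N n \<subseteq> K" using sub sh_bd by (auto simp: K_def)
  have KZ: "K \<subseteq> G.cycles N n" by (auto simp: K_def)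
  have "rel_length Q (TF n) (F.boundaries N n) (F.cycles N n) = rel_length Q (TG n) (G.boundaries N n) K"
  proof (rule rel_length_hom[OF modTF modTG bdF cycF subF bd K BK, where f = "T\<iota> n"])
    fix t assume t: "t \<in> F.cycles N n"
    then have tc: "t \<in> carrier (TF n)" and dt: "Td n t = \<zero>\<^bsub>TF (n - 1)\<^esub>" by (auto simp: F.cycles_def)
    have "TD n (T\<iota> n t) = \<zero>\<^bsub>TG (n - 1)\<^esub>"
      unfolding TD_T\<iota>[OF tc] dt by (rule mod_hom_zero[OF modTF modTG T\<iota>])
    then show "T\<iota> n t \<in> K"
      using mod_hom_closed[OF T\<iota> tc] Tsh_T\<iota>[OF tc] submodule_zero[OF bd] by (simp add: K_def G.cycles_def)
    show "T\<iota> n t \<in> G.boundaries N n \<longleftrightarrow> t \<in> F.boundaries N n"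
    proof
      assume "t \<in> F.boundaries N n"
      then obtain s where s: "s \<in> carrier (TF (n + 1))" "t = Td (n + 1) s" by (auto simp: F.boundaries_def)
      then have "T\<iota> n t = TD (n + 1) (T\<iota> (n + 1) s)" using TD_T\<iota>[OF s(1)] by simp
      then show "T\<iota> n t \<in> G.boundaries N n"
        using mod_hom_closed[OF T\<iota> s(1)] unfolding G.boundaries_def TD' by blast
    next
      \<comment> \<open>The projection is a chain map with T\<pi> T\<iota> = id, so it carries a
        bounding element in G to one in F.\<close>
      assume "T\<iota> n t \<in> G.boundaries N n"
      then obtain s where s: "s \<in> carrier (TG (n + 1))" "T\<iota> n t = TD (n + 1) s" by (auto simp: G.boundaries_def)
      then have "t = Td (n + 1) (T\<pi> (n + 1) s)" using T\<pi>_TD[OF s(1)] T\<pi>_T\<iota>[OF tc] by simp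
      then show "t \<in> F.boundaries N n"
        using mod_hom_closed[OF T\<pi> s(1)] unfolding F.boundaries_def Td' by blast
    qed
  next
    fix t assume t: "t \<in> K"
    then have tc: "t \<in> carrier (TG n)" and dt: "TD n t = \<zero>\<^bsub>TG (n - 1)\<^esub>" by (auto simp: K_def G.cycles_def)
    obtain w where w: "w \<in> carrier (TG (n + 1 - 2))" "Tsh (n - 2) t = TD (n + 1 - 2) w"
      using t unfolding K_def G.boundaries_def idx by (auto simp: algebra_simps)
    \<comment> \<open>The unshift of w has a boundary b with the same shift as t, so t - b has shift
      zero and comes from F.\<close>
    define b where "b = TD (n + 1) (Tun (n + 1) w)"
    have uw: "Tun (n + 1) w \<in> carrier (TG (n + 1))" by (rule mod_hom_closed[OF Tun w(1)])
    have b: "b \<in> G.boundaries N n" unfolding b_def G.boundaries_def TD' using uw by blast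
    have bc: "b \<in> carrier (TG n)" "b \<in> G.cycles N n" using b sub submodule_subset[OF cyc] by auto
    have shb: "Tsh (n - 2) b = Tsh (n - 2) t"
      using Tsh_TD[OF uw] Tsh_Tun[OF w(1)] w(2) unfolding b_def by simp
    define s where "s = t \<ominus>\<^bsub>TG n\<^esub> b"
    have s: "s \<in> carrier (TG n)" "s \<in> G.cycles N n"
      using tc bc submodule_minus[OF cyc, of t n b] t by (auto simp: s_def K_def)
    have "Tsh (n - 2) s = \<zero>\<^bsub>TG (n - 2)\<^esub>"
      unfolding s_def mod_hom_minus[OF modTG modTG sh tc bc(1)] shb
      using mod_hom_closed[OF sh tc] by (simp add: a_minus_def T.M.r_neg)
    then have "s = T\<iota> n (T\<pi> n s)"
      using T_decompose[OF s(1)] mod_hom_zero[OF modTG modTG Tun]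
        mod_hom_closed[OF T\<iota> mod_hom_closed[OF T\<pi> s(1)]] by simp
    moreover have "T\<pi> n s \<in> F.cycles N n"
      using T\<pi>_TD[OF s(1)] s mod_hom_closed[OF T\<pi> s(1)] mod_hom_zero[OF modTG modTF T\<pi>]
      by (simp add: F.cycles_def G.cycles_def)
    moreover have "t \<ominus>\<^bsub>TG n\<^esub> s = b" unfolding s_def using tc bc by (simp add: T.M.minus_minus_cancel)
    ultimately show "\<exists>z\<in>F.cycles N n. t \<ominus>\<^bsub>TG n\<^esub> T\<iota> n z \<in> G.boundaries N n"
      using b by (intro bexI[of _ "T\<pi> n s"]) auto
  qed (use submodule_subset[OF cycF] in \<open>auto simp: mod_hom_add[OF T\<iota>] mod_hom_smult[OF T\<iota>] subset_iff\<close>)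
  moreover have "rel_length Q (TG n) K (G.cycles N n)
      = rel_length Q (TG (n - 2)) (G.boundaries N (n - 2)) (G.cycles N (n - 2))"
  proof (rule rel_length_hom[OF modTG modTG K cyc KZ bd cyc sub, where f = "Tsh (n - 2)"])
    fix t assume t: "t \<in> G.cycles N (n - 2)"
    then have tc: "t \<in> carrier (TG (n - 2))" and dt: "TD (n - 2) t = \<zero>\<^bsub>TG (n - 1 - 2)\<^esub>"
      unfolding G.cycles_def idx by auto
    have uc: "Tun n t \<in> carrier (TG n)" by (rule mod_hom_closed[OF Tun tc])
    \<comment> \<open>Unshifting commutes with the differentials, so cycles lift to cycles and no
      connecting map arises.\<close>
    have "TD n (Tun n t) = \<zero>\<^bsub>TG (n - 1)\<^esub>"
      unfolding TD_Tun[OF tc] dt by (rule mod_hom_zero[OF modTG modTG Tun])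
    then have "Tun n t \<in> G.cycles N n" using uc by (simp add: G.cycles_def)
    then show "\<exists>z\<in>G.cycles N n. t \<ominus>\<^bsub>TG (n - 2)\<^esub> Tsh (n - 2) z \<in> G.boundaries N (n - 2)"
      using Tsh_Tun[OF tc] tc submodule_zero[OF bd]
      by (intro bexI[of _ "Tun n t"]) (auto simp: a_minus_def T.M.r_neg)
  next
    show "Tsh (n - 2) t \<in> G.boundaries N (n - 2) \<longleftrightarrow> t \<in> K" if "t \<in> G.cycles N n" for t
      using that by (simp add: K_def)
  qed (use submodule_subset[OF cyc] sh_cyc in \<open>auto simp: mod_hom_add[OF sh] mod_hom_smult[OF sh] subset_iff\<close>)
  ultimately show ?thesis
    unfolding G.hlength_def F.hlength_def rel_length_add[OF modTG bd K cyc BK KZ] by simp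
qed

end

lemma (in rigid_homotopy_resolution) hlength_sum:
  "G.hlength N n = (\<Sum>i. F.hlength N (n - 2 * int i))"
proof -
  have neg: "F.hlength N j = 0" "G.hlength N j = 0" if "j < 0" for j
    using F.hlength_negative[OF N zeroN that] G.hlength_negative[OF N xN that] .
  have "G.hlength N n = (\<Sum>i<k. F.hlength N (n - 2 * int i)) + G.hlength N (n - 2 * int k)" for k
  proof (induction k)
    case (Suc k)
    have "G.hlength N (n - 2 * int k) = F.hlength N (n - 2 * int k) + G.hlength N (n - 2 * int (Suc k))"
      using hlength_step[of "n - 2 * int k"] by (simp add: algebra_simps)
    then show ?case using Suc by (simp add: add.assoc del: of_nat_Suc)
  qed simp
  \<comment> \<open>After \<open>nat n\<close> + 1 steps the degree is negative for every integer n,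
    so the remaining length is 0.\<close>
  from this[of "Suc (nat n)"] have "G.hlength N n = (\<Sum>i<Suc (nat n). F.hlength N (n - 2 * int i))"
    using neg(2)[of "n - 2 * int (Suc (nat n))"] by simp
  also have "\<dots> = (\<Sum>i. F.hlength N (n - 2 * int i))"
  proof (rule suminf_finite[symmetric])
    fix i assume "i \<notin> {..<Suc (nat n)}"
    then have "n - 2 * int i < 0" by auto
    then show "F.hlength N (n - 2 * int i) = 0" by (rule neg(1))
  qed simp
  finally show ?thesis .
qed

section \<open>The standard resolution\<close>

text \<open>The graph over the support determines c, whose other values are zero; finiteness of the
  support makes \<open>Abs_fset\<close> faithful on that graph.\<close>

lemma cycle_of_gen_of_cycle:
  assumes "finite (supp R c)"
  shows "cycle_of_gen R (gen_of_cycle R c) = c"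
proof
  fix g
  have *: "(g, a) |\<in>| Abs_fset ((\<lambda>g. (g, c g)) ` supp R c) \<longleftrightarrow> g \<in> supp R c \<and> a = c g" for a
    using assms by (auto simp: Abs_fset_inverse)
  have "g \<notin> supp R c \<Longrightarrow> c g = \<zero>\<^bsub>R\<^esub>" by (simp add: supp_def)
  then show "cycle_of_gen R (gen_of_cycle R c) g = c g"
    by (auto simp: cycle_of_gen_def gen_of_cycle_def *)
qed

text \<open>With H the module of cycles this is one stage of the standard resolution. The generator
  naming c maps to c, so the image contains H, and it stays inside H because H is a
  submodule.\<close>

lemma free_ext_cycle_of_gen:
  assumes R: "cring R" and H: "submodule H R (free_mod R B)"
  shows free_ext_cycle_of_gen_hom:
      "free_ext R (free_mod R B) (cycle_of_gen R) \<in> mod_hom R (free_mod R (gen_of_cycle R ` H)) (free_mod R B)"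
    and free_ext_cycle_of_gen_image:
      "free_ext R (free_mod R B) (cycle_of_gen R) ` carrier (free_mod R (gen_of_cycle R ` H)) = H"
proof -
  let ?F = "free_mod R B" and ?F' = "free_mod R (gen_of_cycle R ` H)"
  let ?e = "free_ext R ?F (cycle_of_gen R)"
  note F = module_free_mod[OF R, of B] and F' = module_free_mod[OF R, of "gen_of_cycle R ` H"]
  have cg: "cycle_of_gen R (gen_of_cycle R c) = c" if "c \<in> H" for c
    using submodule_subset[OF H] that by (intro cycle_of_gen_of_cycle) (auto simp: free_mod_sel(1))
  then have g: "cycle_of_gen R \<in> gen_of_cycle R ` H \<rightarrow> carrier ?F" using submodule_subset[OF H] by auto
  show e: "?e \<in> mod_hom R ?F' ?F" by (rule free_ext_hom[OF F g])
  show "?e ` carrier ?F' = H"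
  proof
    have "c \<in> {c \<in> carrier ?F'. ?e c \<in> H}" if "c \<in> carrier ?F'" for c
      by (rule free_mod_induct[OF R submodule_preimage[OF F' F e H] _ that])
        (auto simp: delta_closed[OF R] free_ext_delta[OF F g] cg)
    then show "?e ` carrier ?F' \<subseteq> H" by auto
    show "H \<subseteq> ?e ` carrier ?F'"
    proof
      fix c assume c: "c \<in> H"
      then have "?e (delta R (gen_of_cycle R c)) = c" by (simp add: free_ext_delta[OF F g] cg)
      then show "c \<in> ?e ` carrier ?F'" using delta_closed[OF R, of "gen_of_cycle R c"] c by (metis imageI)
    qed
  qed
qed

context
  fixes R :: "('r, 'z) ring_scheme" and M :: "('r, 'm) module"
  assumes M: "Module.module R M"
begin

interpretation M: Module.module R M by (rule M)

lemma cring_base: "cring R" by unfold_locales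

lemma std_mod_int: "std_mod R M (int n) = free_mod R (std_basis R M n)"
  by (simp add: std_mod_def)

lemma std_aug_hom: "std_aug R M \<in> mod_hom R (free_mod R (std_basis R M 0)) M"
  unfolding std_aug_def by (rule free_ext_hom[OF M]) auto

text \<open>Linearity and image are proved together: the next stage needs the cycles to form a
  submodule, which rests on linearity of the differential just constructed.\<close>

lemma std_step:
  "std_diff R M (int n + 1) \<in> mod_hom R (free_mod R (std_basis R M (Suc n))) (free_mod R (std_basis R M n)) \<and>
   std_diff R M (int n + 1) ` carrier (free_mod R (std_basis R M (Suc n))) =
     (if n = 0 then {c \<in> carrier (free_mod R (std_basis R M 0)). std_aug R M c = \<zero>\<^bsub>M\<^esub>}
      else {c \<in> carrier (free_mod R (std_basis R M n)).
         std_diff R M (int n) c = \<zero>\<^bsub>free_mod R (std_basis R M (n - 1))\<^esub>})"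
proof (induction n)
  case 0
  let ?H = "{c \<in> carrier (free_mod R (std_basis R M 0)). std_aug R M c = \<zero>\<^bsub>M\<^esub>}"
  have H: "submodule ?H R (free_mod R (std_basis R M 0))"
    by (rule submodule_kernel[OF module_free_mod[OF cring_base] M std_aug_hom])
  have "std_diff R M 1 = free_ext R (free_mod R (std_basis R M 0)) (cycle_of_gen R)"
    by (simp add: std_diff_def std_mod_def)
  then show ?case using free_ext_cycle_of_gen[OF cring_base H] by simp
next
  case (Suc n)
  have d: "std_diff R M (int n + 1) = free_ext R (free_mod R (std_basis R M n)) (cycle_of_gen R)" for n
    by (simp add: std_diff_def std_mod_def)
  let ?H = "{c \<in> carrier (free_mod R (std_basis R M (Suc n))).
      std_diff R M (int n + 1) c = \<zero>\<^bsub>free_mod R (std_basis R M n)\<^esub>}"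
  have H: "submodule ?H R (free_mod R (std_basis R M (Suc n)))"
    using Suc by (intro submodule_kernel[OF module_free_mod[OF cring_base] module_free_mod[OF cring_base]]) auto
  have basis: "std_basis R M (Suc (Suc n)) = gen_of_cycle R ` ?H" by (simp add: d)
  show ?case
    using free_ext_cycle_of_gen[OF cring_base H] d[of "Suc n"] unfolding basis by (simp add: add.commute)
qed

lemma std_resolution: "xresolution R M \<zero>\<^bsub>R\<^esub> (std_mod R M) (std_diff R M) (std_aug R M)"
proof (rule xresolution_zeroI[OF M])
  have modS: "Module.module R (std_mod R M j)" for j unfolding std_mod_def by (rule module_free_mod[OF cring_base])
  then show "Module.module R (std_mod R M j)" for j .
  show "projective R (std_mod R M j)" for j unfolding std_mod_def by (rule projective_free_mod[OF cring_base])
  show "carrier (std_mod R M j) = {\<zero>\<^bsub>std_mod R M j\<^esub>}" if "j < 0" for j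
    using that by (auto simp: std_mod_def free_mod_sel supp_def fun_eq_iff)
  show "std_diff R M j \<in> mod_hom R (std_mod R M j) (std_mod R M (j - 1))" for j
  proof (cases "j \<le> 0")
    case True
    then show ?thesis using mod_hom_const_zero[OF modS] by (simp add: std_diff_def)
  next
    case False
    then have "j = int (nat (j - 1)) + 1" "std_mod R M (int (nat (j - 1)) + 1) = free_mod R (std_basis R M (Suc (nat (j - 1))))"
      by (simp_all add: std_mod_def Suc_nat_eq_nat_zadd1 add.commute)
    then show ?thesis using std_step[of "nat (j - 1)"] std_mod_int[of "nat (j - 1)"] by (metis add_diff_cancel_right')
  qed
  show "std_aug R M \<in> mod_hom R (std_mod R M 0) M"
    using std_aug_hom std_mod_int[of 0] by simp
  show "carrier M \<subseteq> std_aug R M ` carrier (std_mod R M 0)"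
  proof
    fix m assume m: "m \<in> carrier M"
    have "delta R (Elt m) \<in> carrier (std_mod R M 0)"
      using m by (auto simp: std_mod_def intro: delta_closed[OF cring_base])
    moreover have "std_aug R M (delta R (Elt m)) = m"
      unfolding std_aug_def using m by (subst free_ext_delta[OF M, where B = "Elt ` carrier M"]) auto
    ultimately show "m \<in> std_aug R M ` carrier (std_mod R M 0)" by (metis imageI)
  qed
  show "std_diff R M 1 ` carrier (std_mod R M 1) = {c \<in> carrier (std_mod R M 0). std_aug R M c = \<zero>\<^bsub>M\<^esub>}"
    using std_step[of 0] std_mod_int[of 0] std_mod_int[of 1] by simp
  show "std_diff R M (j + 1) ` carrier (std_mod R M (j + 1)) =
      {c \<in> carrier (std_mod R M j). std_diff R M j c = \<zero>\<^bsub>std_mod R M (j - 1)\<^esub>}" if j: "0 < j" for j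
  proof -
    obtain n where n: "j = int (Suc n)" using j by (metis gr0_implies_Suc zero_less_imp_eq_int)
    have "std_mod R M (j + 1) = free_mod R (std_basis R M (Suc (Suc n)))" "std_mod R M j = free_mod R (std_basis R M (Suc n))"
      "std_mod R M (j - 1) = free_mod R (std_basis R M n)"
      using std_mod_int[of "Suc (Suc n)"] std_mod_int[of "Suc n"] std_mod_int[of n] n by (simp_all add: add.commute)
    then show ?thesis using std_step[of "Suc n"] by (simp only: n) simp
  qed
qed

end

section \<open>Passage to the quotient ring\<close>

locale quotient_ring = Q: cring Q for Q :: "('q, 'z) ring_scheme" +
  fixes x :: 'q
  assumes x: "x \<in> carrier Q"
begin

abbreviation (input) "I \<equiv> PIdl\<^bsub>Q\<^esub> x"
abbreviation (input) "R \<equiv> Q Quot I"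
abbreviation (input) "\<phi> \<equiv> \<lambda>q. I +>\<^bsub>Q\<^esub> q"

sublocale I: ideal I Q by (rule Q.cgenideal_ideal[OF x])

lemma cring_quotient: "cring R" by (rule I.quotient_is_cring[OF Q.is_cring])

sublocale R: cring R by (rule cring_quotient)

lemma \<phi>:
  "q \<in> carrier Q \<Longrightarrow> \<phi> q \<in> carrier R"
  "q \<in> carrier Q \<Longrightarrow> q' \<in> carrier Q \<Longrightarrow> \<phi> (q \<oplus>\<^bsub>Q\<^esub> q') = \<phi> q \<oplus>\<^bsub>R\<^esub> \<phi> q'"
  "q \<in> carrier Q \<Longrightarrow> q' \<in> carrier Q \<Longrightarrow> \<phi> (q \<otimes>\<^bsub>Q\<^esub> q') = \<phi> q \<otimes>\<^bsub>R\<^esub> \<phi> q'"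
  "\<phi> \<one>\<^bsub>Q\<^esub> = \<one>\<^bsub>R\<^esub>"
  using I.rcos_ring_hom by (auto simp: ring_hom_def)

lemma \<phi>_surj: "r \<in> carrier R \<Longrightarrow> \<exists>q\<in>carrier Q. \<phi> q = r"
  by (auto simp: FactRing_def A_RCOSETS_def')

lemma zero_quotient_ring: "\<zero>\<^bsub>R\<^esub> = I" by (simp add: FactRing_def)

lemma \<phi>_eq_zero_iff: "q \<in> carrier Q \<Longrightarrow> \<phi> q = \<zero>\<^bsub>R\<^esub> \<longleftrightarrow> q \<in> I"
  unfolding zero_quotient_ring
  using I.a_rcos_const I.a_rcos_self by blast

lemma \<phi>_zero: "\<phi> \<zero>\<^bsub>Q\<^esub> = \<zero>\<^bsub>R\<^esub>" by (simp add: \<phi>_eq_zero_iff)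

lemma \<phi>_x: "\<phi> x = \<zero>\<^bsub>R\<^esub>" using Q.cgenideal_self[OF x] x by (simp add: \<phi>_eq_zero_iff)

lemma over_base_sel [simp]:
  "carrier (over_base Q x L) = carrier L" "\<zero>\<^bsub>over_base Q x L\<^esub> = \<zero>\<^bsub>L\<^esub>"
  "u \<oplus>\<^bsub>over_base Q x L\<^esub> v = u \<oplus>\<^bsub>L\<^esub> v" "q \<odot>\<^bsub>over_base Q x L\<^esub> u = \<phi> q \<odot>\<^bsub>L\<^esub> u"
  by (simp_all add: over_base_def restrict_scalars_def)

lemma module_over_base:
  assumes L: "Module.module R L" shows "Module.module Q (over_base Q x L)"
proof -
  interpret L: Module.module R L by (rule L)
  show ?thesis
  proof (intro moduleI abelian_groupI)
    show "\<exists>v\<in>carrier (over_base Q x L). v \<oplus>\<^bsub>over_base Q x L\<^esub> u = \<zero>\<^bsub>over_base Q x L\<^esub>"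
      if "u \<in> carrier (over_base Q x L)" for u
      using that by (intro bexI[of _ "\<ominus>\<^bsub>L\<^esub> u"]) (auto simp: L.M.l_neg)
  qed (auto simp: Q.is_cring \<phi> L.M.a_ac L.smult_l_distr L.smult_r_distr L.smult_assoc1)
qed

lemma over_base_killed:
  assumes L: "Module.module R L" shows "\<forall>v\<in>carrier (over_base Q x L). x \<odot>\<^bsub>over_base Q x L\<^esub> v = \<zero>\<^bsub>over_base Q x L\<^esub>"
proof -
  interpret L: Module.module R L by (rule L)
  show ?thesis by (simp add: \<phi>_x)
qed

text \<open>Every scalar of the quotient ring is the class of a scalar of Q, so lengths over the two
  rings agree.\<close>

lemma submodule_over_base:
  assumes L: "Module.module R L"
  shows "submodule H Q (over_base Q x L) \<longleftrightarrow> submodule H R L"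
proof
  assume H: "submodule H Q (over_base Q x L)"
  show "submodule H R L"
  proof (rule submodule_intro[OF L])
    fix r u assume "r \<in> carrier R" "u \<in> H"
    then obtain q where "q \<in> carrier Q" "\<phi> q = r" using \<phi>_surj by auto
    then show "r \<odot>\<^bsub>L\<^esub> u \<in> H" using submodule_smult[OF H _ \<open>u \<in> H\<close>] by auto
  qed (use submodule_subset[OF H] submodule_zero[OF H] submodule_add[OF H] in auto)
next
  assume H: "submodule H R L"
  show "submodule H Q (over_base Q x L)"
    by (rule submodule_intro[OF module_over_base[OF L]])
      (use submodule_subset[OF H] submodule_zero[OF H] submodule_add[OF H] submodule_smult[OF H] \<phi> in auto)
qed

lemma rel_length_over_base:
  assumes L: "Module.module R L"
  shows "rel_length Q (over_base Q x L) B Z = rel_length R L B Z"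
  by (simp add: rel_length_def submodule_chain_def submodule_over_base[OF L])

lemma mod_hom_over_base:
  "h \<in> mod_hom R L L' \<Longrightarrow> h \<in> mod_hom Q (over_base Q x L) (over_base Q x L')"
  by (rule mod_homI) (auto simp: mod_hom_closed mod_hom_add mod_hom_smult \<phi>)

end

section \<open>Reduction modulo x of free modules, tensor products and resolutions\<close>

context quotient_ring
begin

lemma mem_I_D: "q \<in> I \<Longrightarrow> \<exists>z\<in>carrier Q. q = z \<otimes>\<^bsub>Q\<^esub> x"
  unfolding cgenideal_def by blast

definition reduce :: "('b \<Rightarrow> 'q) \<Rightarrow> 'b \<Rightarrow> 'q set" where "reduce c = (\<lambda>b. \<phi> (c b))"

lemma supp_reduce: "supp R (reduce c) \<subseteq> supp Q c"
proof -
  have "reduce c b = \<zero>\<^bsub>R\<^esub>" if "c b = \<zero>\<^bsub>Q\<^esub>" for b by (simp only: reduce_def that \<phi>_zero)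
  then show ?thesis by (auto simp: supp_def)
qed

lemma reduce_hom: "reduce \<in> mod_hom Q (free_mod Q B) (over_base Q x (free_mod R B))"
proof (rule mod_homI)
  fix c assume "c \<in> carrier (free_mod Q B)"
  then show "reduce c \<in> carrier (over_base Q x (free_mod R B))"
    using supp_reduce[of c] finite_subset[OF supp_reduce[of c]] \<phi>(1)
    by (auto simp: free_mod_sel(1) reduce_def)
qed (auto simp: free_mod_sel(2-4) reduce_def \<phi> free_mod_closed)

lemma reduce_surj:
  assumes c: "c \<in> carrier (free_mod R B)"
  shows "\<exists>c'\<in>carrier (free_mod Q B). reduce c' = c"
proof -
  \<comment> \<open>Zero is represented by zero, which keeps the support of the lifted function
    finite.\<close>
  define rep where "rep r = (if r = \<zero>\<^bsub>R\<^esub> then \<zero>\<^bsub>Q\<^esub> else SOME q. q \<in> carrier Q \<and> \<phi> q = r)" for r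
  have rep: "rep r \<in> carrier Q \<and> \<phi> (rep r) = r" if "r \<in> carrier R" for r
  proof (cases "r = \<zero>\<^bsub>R\<^esub>")
    case True
    then show ?thesis unfolding rep_def by (simp only: if_True \<phi>_zero Q.zero_closed simp_thms)
  next
    case False
    then show ?thesis
      using someI_ex[of "\<lambda>q. q \<in> carrier Q \<and> \<phi> q = r"] \<phi>_surj[OF that] by (simp only: rep_def if_False) blast
  qed
  have sup: "supp Q (\<lambda>b. rep (c b)) \<subseteq> supp R c" by (auto simp: supp_def rep_def)
  show ?thesis
  proof
    show "reduce (\<lambda>b. rep (c b)) = c" using rep free_mod_closed[OF c] by (auto simp: reduce_def)
    show "(\<lambda>b. rep (c b)) \<in> carrier (free_mod Q B)"
      using rep free_mod_closed[OF c] c sup finite_subset[OF sup] by (auto simp: free_mod_sel(1))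
  qed
qed

lemma reduce_kernel:
  assumes c: "c \<in> carrier (free_mod Q B)" and 0: "reduce c = \<zero>\<^bsub>free_mod R B\<^esub>"
  shows "xcong (free_mod Q B) x c \<zero>\<^bsub>free_mod Q B\<^esub>"
proof -
  have "c b \<in> I" for b
    using fun_cong[OF 0, of b] \<phi>_eq_zero_iff[OF free_mod_closed[OF c]] unfolding reduce_def free_mod_sel(2) by blast
  then have "\<exists>z\<in>carrier Q. c b = z \<otimes>\<^bsub>Q\<^esub> x" for b by (rule mem_I_D)
  then obtain z where z: "\<And>b. z b \<in> carrier Q" "\<And>b. c b = z b \<otimes>\<^bsub>Q\<^esub> x" by metis
  \<comment> \<open>The coefficientwise quotients by x are chosen independently; replacing them by
    zero where c vanishes gives finite support.\<close>
  define y where "y b = (if c b = \<zero>\<^bsub>Q\<^esub> then \<zero>\<^bsub>Q\<^esub> else z b)" for b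
  have sup: "supp Q y \<subseteq> supp Q c" by (auto simp: supp_def y_def)
  have y: "y \<in> carrier (free_mod Q B)"
    using c sup finite_subset[OF sup] z(1) by (auto simp: free_mod_sel(1) y_def)
  have "c b = x \<otimes>\<^bsub>Q\<^esub> y b" for b
    using z[of b] x Q.m_comm[of x "z b"] by (auto simp: y_def)
  then show ?thesis
    unfolding xcong_def using y x free_mod_closed[OF c]
    by (intro bexI[OF _ y]) (auto simp: free_mod_sel(2-4) fun_eq_iff)
qed

lemma over_base_diff_self:
  assumes "Module.module R L" "v \<in> carrier L"
  shows "v \<ominus>\<^bsub>over_base Q x L\<^esub> v = \<zero>\<^bsub>L\<^esub>"
proof -
  interpret L: Module.module Q "over_base Q x L" by (rule module_over_base[OF assms(1)])
  show ?thesis using L.M.r_neg[of v] assms(2) by (simp add: a_minus_def)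
qed

text \<open>If \<open>x\<close> kills \<open>L\<close>, the scalar product does not depend on the chosen representative.\<close>

definition descend :: "('q, 'a) module \<Rightarrow> ('q set, 'a) module" where
  "descend L = \<lparr>carrier = carrier L, mult = mult L, one = one L, zero = zero L, add = add L,
     smult = (\<lambda>r u. (SOME q. q \<in> carrier Q \<and> \<phi> q = r) \<odot>\<^bsub>L\<^esub> u)\<rparr>"

lemma descend_sel [simp]:
  "carrier (descend L) = carrier L" "\<zero>\<^bsub>descend L\<^esub> = \<zero>\<^bsub>L\<^esub>" "u \<oplus>\<^bsub>descend L\<^esub> v = u \<oplus>\<^bsub>L\<^esub> v"
  by (simp_all add: descend_def)

lemma descend_smult:
  assumes L: "Module.module Q L" and xL: "\<forall>u\<in>carrier L. x \<odot>\<^bsub>L\<^esub> u = \<zero>\<^bsub>L\<^esub>"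
    and q: "q \<in> carrier Q" and u: "u \<in> carrier L"
  shows "\<phi> q \<odot>\<^bsub>descend L\<^esub> u = q \<odot>\<^bsub>L\<^esub> u"
proof -
  interpret L: Module.module Q L by (rule L)
  define q' where "q' = (SOME q'. q' \<in> carrier Q \<and> \<phi> q' = \<phi> q)"
  have q': "q' \<in> carrier Q" "\<phi> q' = \<phi> q"
    using someI[of "\<lambda>q'. q' \<in> carrier Q \<and> \<phi> q' = \<phi> q" q] q by (auto simp: q'_def)
  have "q' \<in> \<phi> q" unfolding q'(2)[symmetric] by (rule I.a_rcos_self[OF q'(1)])
  then have "q' \<ominus>\<^bsub>Q\<^esub> q \<in> I" using I.a_rcos_module[OF q q'(1)] by (simp add: a_minus_def)
  then obtain z where z: "z \<in> carrier Q" "q' \<ominus>\<^bsub>Q\<^esub> q = z \<otimes>\<^bsub>Q\<^esub> x" using mem_I_D by blast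
  have "q' = z \<otimes>\<^bsub>Q\<^esub> x \<oplus>\<^bsub>Q\<^esub> q" using q q' z Q.minus_add_cancel[of q q'] by simp
  then have "q' \<odot>\<^bsub>L\<^esub> u = q \<odot>\<^bsub>L\<^esub> u"
    using q z x u xL by (simp add: L.smult_l_distr L.smult_assoc1)
  then show ?thesis by (simp add: descend_def q'_def)
qed

lemma module_descend:
  assumes L: "Module.module Q L" and xL: "\<forall>u\<in>carrier L. x \<odot>\<^bsub>L\<^esub> u = \<zero>\<^bsub>L\<^esub>"
  shows "Module.module R (descend L)"
proof -
  interpret L: Module.module Q L by (rule L)
  note sm = descend_smult[OF L xL]
  have ex: "\<exists>q\<in>carrier Q. r = \<phi> q" if "r \<in> carrier R" for r using \<phi>_surj[OF that] by auto
  show ?thesis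
  proof (intro moduleI abelian_groupI)
    show "cring R" by (rule cring_quotient)
    show "\<exists>v\<in>carrier (descend L). v \<oplus>\<^bsub>descend L\<^esub> u = \<zero>\<^bsub>descend L\<^esub>" if "u \<in> carrier (descend L)" for u
      using that by (intro bexI[of _ "\<ominus>\<^bsub>L\<^esub> u"]) (auto simp: L.M.l_neg)
    show "\<one>\<^bsub>R\<^esub> \<odot>\<^bsub>descend L\<^esub> u = u" if "u \<in> carrier (descend L)" for u
      using sm[of "\<one>\<^bsub>Q\<^esub>" u] that \<phi>(4) by simp
  next
    fix r u assume "r \<in> carrier R" "u \<in> carrier (descend L)"
    then show "r \<odot>\<^bsub>descend L\<^esub> u \<in> carrier (descend L)" using ex[of r] by (auto simp: sm)
  next
    fix r s u assume rs: "r \<in> carrier R" "s \<in> carrier R" "u \<in> carrier (descend L)"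
    obtain q p where qp: "q \<in> carrier Q" "r = \<phi> q" "p \<in> carrier Q" "s = \<phi> p" using ex rs by metis
    show "(r \<oplus>\<^bsub>R\<^esub> s) \<odot>\<^bsub>descend L\<^esub> u = r \<odot>\<^bsub>descend L\<^esub> u \<oplus>\<^bsub>descend L\<^esub> s \<odot>\<^bsub>descend L\<^esub> u"
      using rs qp \<phi>(2)[of q p, symmetric] by (simp add: sm L.smult_l_distr)
    show "(r \<otimes>\<^bsub>R\<^esub> s) \<odot>\<^bsub>descend L\<^esub> u = r \<odot>\<^bsub>descend L\<^esub> (s \<odot>\<^bsub>descend L\<^esub> u)"
      using rs qp \<phi>(3)[of q p, symmetric] by (simp add: sm L.smult_assoc1)
  next
    fix r u v assume "r \<in> carrier R" "u \<in> carrier (descend L)" "v \<in> carrier (descend L)"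
    then show "r \<odot>\<^bsub>descend L\<^esub> (u \<oplus>\<^bsub>descend L\<^esub> v) = r \<odot>\<^bsub>descend L\<^esub> u \<oplus>\<^bsub>descend L\<^esub> r \<odot>\<^bsub>descend L\<^esub> v"
      using ex[of r] by (auto simp: sm L.smult_r_distr)
  qed (auto simp: L.M.a_ac)
qed

lemma tensor_killed:
  assumes X: "Module.module Q X" and N: "Module.module Q N" and xN: "\<forall>v\<in>carrier N. x \<odot>\<^bsub>N\<^esub> v = \<zero>\<^bsub>N\<^esub>"
  shows "\<forall>t\<in>carrier (tensor Q X N). x \<odot>\<^bsub>tensor Q X N\<^esub> t = \<zero>\<^bsub>tensor Q X N\<^esub>"
proof
  fix t assume t: "t \<in> carrier (tensor Q X N)"
  interpret X: tensor_prod Q X N by (rule tensor_prodI[OF X N])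
  interpret T: Module.module Q "tensor Q X N" by (rule X.module_tensor)
  have h: "(\<lambda>t. x \<odot>\<^bsub>tensor Q X N\<^esub> t) \<in> mod_hom Q (tensor Q X N) (tensor Q X N)"
    using x by (intro mod_homI) (auto simp: T.smult_r_distr T.smult_assoc1[symmetric] Q.m_comm)
  show "x \<odot>\<^bsub>tensor Q X N\<^esub> t = \<zero>\<^bsub>tensor Q X N\<^esub>"
  proof (rule X.tensor_hom_eq[OF X.module_tensor h mod_hom_const_zero[OF X.module_tensor] _ t])
    fix u v assume uv: "u \<in> carrier X" "v \<in> carrier N"
    have "x \<odot>\<^bsub>tensor Q X N\<^esub> pure_tensor Q X N u v = pure_tensor Q X N u (\<zero>\<^bsub>Q\<^esub> \<odot>\<^bsub>N\<^esub> v)"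
      using uv x xN by (simp add: X.pure_smult_right[symmetric])
    then show "x \<odot>\<^bsub>tensor Q X N\<^esub> pure_tensor Q X N u v = \<zero>\<^bsub>tensor Q X N\<^esub>"
      using uv X.pure_closed by (subst (asm) X.pure_smult_right) auto
  qed
qed

text \<open>The hypotheses present P as X/xX. The map u \<otimes> v to p u \<otimes> v is inverted
  by choosing preimages under p, which is legitimate because a tensor with N depends on u modulo x
  alone.\<close>

lemma tensor_reduction:
  assumes X: "Module.module Q X" and P: "Module.module R P" and N: "Module.module R N"
    and p: "p \<in> mod_hom Q X (over_base Q x P)"
    and p_surj: "\<And>w. w \<in> carrier P \<Longrightarrow> \<exists>u\<in>carrier X. p u = w"
    and p_ker: "\<And>u. u \<in> carrier X \<Longrightarrow> p u = \<zero>\<^bsub>P\<^esub> \<Longrightarrow> xcong X x u \<zero>\<^bsub>X\<^esub>"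
  obtains \<tau> where "\<tau> \<in> mod_hom Q (tensor Q X (over_base Q x N)) (over_base Q x (tensor R P N))"
    and "\<And>u v. u \<in> carrier X \<Longrightarrow> v \<in> carrier N \<Longrightarrow>
      \<tau> (pure_tensor Q X (over_base Q x N) u v) = pure_tensor R P N (p u) v"
    and "bij_betw \<tau> (carrier (tensor Q X (over_base Q x N))) (carrier (tensor R P N))"
proof -
  let ?N = "over_base Q x N" and ?P = "over_base Q x P"
  let ?TX = "tensor Q X ?N" and ?TP = "tensor R P N"
  have NQ: "Module.module Q ?N" and PQ: "Module.module Q ?P" by (rule module_over_base, fact)+
  note xN = over_base_killed[OF N]
  interpret X: Module.module Q X by (rule X)
  interpret P: Module.module R P by (rule P)
  interpret A: tensor_prod Q X ?N by (rule tensor_prodI[OF X NQ])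
  interpret B: tensor_prod R P N by (rule tensor_prodI[OF P N])
  interpret TX: Module.module Q ?TX by (rule A.module_tensor)
  interpret TP: Module.module R ?TP by (rule B.module_tensor)
  have TPQ: "Module.module Q (over_base Q x ?TP)" by (rule module_over_base[OF B.module_tensor])
  note xT = tensor_killed[OF X NQ xN]
  have pcl: "p u \<in> carrier P" if "u \<in> carrier X" for u using mod_hom_closed[OF p that] by simp
  have bal: "A.balanced (over_base Q x ?TP) (\<lambda>u v. pure_tensor R P N (p u) v)"
    unfolding A.balanced_def
    by (simp add: pcl mod_hom_add[OF p] mod_hom_smult[OF p] \<phi> B.pure_closed
      B.pure_add_left B.pure_add_right B.pure_smult_left B.pure_smult_right)
  obtain \<tau> where \<tau>: "\<tau> \<in> mod_hom Q ?TX (over_base Q x ?TP)"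
    and \<tau>p: "\<And>u v. u \<in> carrier X \<Longrightarrow> v \<in> carrier N \<Longrightarrow> \<tau> (pure_tensor Q X ?N u v) = pure_tensor R P N (p u) v"
    using A.tensor_lift[OF TPQ bal] by simp
  have cong: "pure_tensor Q X ?N u v = pure_tensor Q X ?N u' v"
    if u: "u \<in> carrier X" "u' \<in> carrier X" "p u = p u'" and v: "v \<in> carrier N" for u u' v
  proof -
    have "p (u \<ominus>\<^bsub>X\<^esub> u') = \<zero>\<^bsub>P\<^esub>"
      by (simp only: mod_hom_minus[OF X PQ p u(1,2)] u(3) over_base_diff_self[OF P pcl[OF u(2)]])
    then have "xcong X x (u \<ominus>\<^bsub>X\<^esub> u') \<zero>\<^bsub>X\<^esub>" using u by (intro p_ker) auto
    then obtain z where z: "z \<in> carrier X" "u \<ominus>\<^bsub>X\<^esub> u' = x \<odot>\<^bsub>X\<^esub> z" using x by (auto simp: xcong_def)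
    have "u = x \<odot>\<^bsub>X\<^esub> z \<oplus>\<^bsub>X\<^esub> u'" using X.M.minus_add_cancel[OF u(2,1)] z(2) by simp
    moreover have "x \<odot>\<^bsub>?TX\<^esub> pure_tensor Q X ?N z v = \<zero>\<^bsub>?TX\<^esub>" using xT A.pure_closed z v by simp
    ultimately show ?thesis
      using x z u v A.pure_closed by (simp add: A.pure_add_left A.pure_smult_left)
  qed
  define s where "s w = (SOME u. u \<in> carrier X \<and> p u = w)" for w
  have s: "s w \<in> carrier X" "p (s w) = w" if "w \<in> carrier P" for w
    using someI_ex[of "\<lambda>u. u \<in> carrier X \<and> p u = w"] p_surj[OF that] by (auto simp: s_def)
  \<comment> \<open>The inverse is built from the universal property over the quotient ring, so the
    tensor product over Q is first made a module over that ring.\<close>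
  have DT: "Module.module R (descend ?TX)" by (rule module_descend[OF A.module_tensor xT])
  note dsm = descend_smult[OF A.module_tensor xT]
  have bal': "B.balanced (descend ?TX) (\<lambda>w v. pure_tensor Q X ?N (s w) v)"
    unfolding B.balanced_def
  proof (intro conjI ballI)
    fix w w' v assume w: "w \<in> carrier P" "w' \<in> carrier P" "v \<in> carrier N"
    have "pure_tensor Q X ?N (s (w \<oplus>\<^bsub>P\<^esub> w')) v = pure_tensor Q X ?N (s w \<oplus>\<^bsub>X\<^esub> s w') v"
      using w s by (intro cong) (auto simp: mod_hom_add[OF p])
    then show "pure_tensor Q X ?N (s (w \<oplus>\<^bsub>P\<^esub> w')) v
        = pure_tensor Q X ?N (s w) v \<oplus>\<^bsub>descend ?TX\<^esub> pure_tensor Q X ?N (s w') v"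
      using w s by (simp add: A.pure_add_left)
  next
    fix r w v assume w: "r \<in> carrier R" "w \<in> carrier P" "v \<in> carrier N"
    obtain q where q: "q \<in> carrier Q" "\<phi> q = r" using \<phi>_surj w by blast
    have "pure_tensor Q X ?N (s (r \<odot>\<^bsub>P\<^esub> w)) v = pure_tensor Q X ?N (q \<odot>\<^bsub>X\<^esub> s w) v"
      using w s q by (intro cong) (auto simp: mod_hom_smult[OF p])
    then show "pure_tensor Q X ?N (s (r \<odot>\<^bsub>P\<^esub> w)) v = r \<odot>\<^bsub>descend ?TX\<^esub> pure_tensor Q X ?N (s w) v"
      using w s q A.pure_closed dsm[OF q(1)] by (simp add: A.pure_smult_left)
    show "pure_tensor Q X ?N (s w) (r \<odot>\<^bsub>N\<^esub> v) = r \<odot>\<^bsub>descend ?TX\<^esub> pure_tensor Q X ?N (s w) v"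
      using w s q A.pure_closed dsm[OF q(1)] A.pure_smult_right[OF q(1), of "s w" v] by simp
  next
    fix w v v' assume w: "w \<in> carrier P" "v \<in> carrier N" "v' \<in> carrier N"
    then show "pure_tensor Q X ?N (s w) (v \<oplus>\<^bsub>N\<^esub> v')
        = pure_tensor Q X ?N (s w) v \<oplus>\<^bsub>descend ?TX\<^esub> pure_tensor Q X ?N (s w) v'"
      using s A.pure_add_right[of "s w" v v'] by simp
  qed (use s A.pure_closed in simp)
  obtain \<rho> where \<rho>: "\<rho> \<in> mod_hom R ?TP (descend ?TX)"
    and \<rho>p: "\<And>w v. w \<in> carrier P \<Longrightarrow> v \<in> carrier N \<Longrightarrow> \<rho> (pure_tensor R P N w v) = pure_tensor Q X ?N (s w) v"
    using B.tensor_lift[OF DT bal'] by metis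
  have \<rho>Q: "\<rho> \<in> mod_hom Q (over_base Q x ?TP) ?TX"
    by (rule mod_homI)
      (use mod_hom_closed[OF \<rho>] mod_hom_add[OF \<rho>] mod_hom_smult[OF \<rho>] \<phi> dsm in auto)
  have inj: "\<rho> (\<tau> t) = t" if t: "t \<in> carrier ?TX" for t
  proof (rule A.tensor_hom_eq[OF A.module_tensor mod_hom_comp[OF \<rho>Q \<tau>] mod_hom_id _ t])
    fix u v assume uv: "u \<in> carrier X" "v \<in> carrier ?N"
    have "pure_tensor Q X ?N (s (p u)) v = pure_tensor Q X ?N u v"
      using uv s pcl by (intro cong) auto
    then show "\<rho> (\<tau> (pure_tensor Q X ?N u v)) = pure_tensor Q X ?N u v"
      using uv by (simp add: \<tau>p \<rho>p pcl)
  qed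
  have im: "submodule (\<tau> ` carrier ?TX) R ?TP"
    using submodule_image[OF A.module_tensor TPQ \<tau> TX.carrier_is_submodule]
    by (simp add: submodule_over_base[OF B.module_tensor])
  have "t \<in> \<tau> ` carrier ?TX" if t: "t \<in> carrier ?TP" for t
  proof (rule B.tensor_induct[OF im _ t])
    fix w v assume w: "w \<in> carrier P" "v \<in> carrier N"
    then have "pure_tensor R P N w v = \<tau> (pure_tensor Q X ?N (s w) v)" using s by (simp add: \<tau>p)
    then show "pure_tensor R P N w v \<in> \<tau> ` carrier ?TX" using w s A.pure_closed by simp
  qed
  moreover have "inj_on \<tau> (carrier ?TX)" by (rule inj_on_inverseI) (rule inj)
  ultimately have "bij_betw \<tau> (carrier ?TX) (carrier ?TP)"
    using mod_hom_closed[OF \<tau>] by (auto simp: bij_betw_def)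
  then show thesis using that \<tau> \<tau>p by blast
qed

text \<open>Each differential of P lifts along p by projectivity. Exactness modulo x of the lifts
  mirrors exactness of P because p identifies P with X/xX, and \<open>tensor_reduction\<close>
  identifies the two tensored complexes degree by degree.\<close>

lemma lift_resolution:
  assumes P: "xresolution R M \<zero>\<^bsub>R\<^esub> P d \<epsilon>" and N: "Module.module R N"
    and X: "\<And>j. Module.module Q (X j)" and projX: "\<And>j. projective Q (X j)"
    and trivX: "\<And>j. j < 0 \<Longrightarrow> carrier (X j) = {\<zero>\<^bsub>X j\<^esub>}"
    and p: "\<And>j. p j \<in> mod_hom Q (X j) (over_base Q x (P j))"
    and p_surj: "\<And>j w. w \<in> carrier (P j) \<Longrightarrow> \<exists>u\<in>carrier (X j). p j u = w"
    and p_ker: "\<And>j u. u \<in> carrier (X j) \<Longrightarrow> p j u = \<zero>\<^bsub>P j\<^esub> \<Longrightarrow> xcong (X j) x u \<zero>\<^bsub>X j\<^esub>"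
  obtains D where "xresolution Q (over_base Q x M) x X D (\<lambda>u. \<epsilon> (p 0 u))"
    and "\<And>j. xresolution.hlength R P d N j = xresolution.hlength Q X D (over_base Q x N) j"
proof -
  interpret P: xresolution R M "\<zero>\<^bsub>R\<^esub>" P d \<epsilon> by (rule P)
  interpret PP: Module.module R "P j" for j by (rule P.modX)
  let ?P = "\<lambda>j. over_base Q x (P j)" and ?N = "over_base Q x N" and ?M = "over_base Q x M"
  have PQ: "Module.module Q (?P j)" for j by (rule module_over_base[OF P.modX])
  have NQ: "Module.module Q ?N" by (rule module_over_base[OF N])
  have MQ: "Module.module Q ?M" by (rule module_over_base[OF P.modM])
  have N0: "\<forall>v\<in>carrier N. \<zero>\<^bsub>R\<^esub> \<odot>\<^bsub>N\<^esub> v = \<zero>\<^bsub>N\<^esub>" using Module.module.smult_l_null[OF N] by auto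
  have dQ: "d j \<in> mod_hom Q (?P j) (?P (j - 1))" for j by (rule mod_hom_over_base[OF P.D])
  have pc: "p j u \<in> carrier (P j)" if "u \<in> carrier (X j)" for j u using mod_hom_closed[OF p that] by simp
  \<comment> \<open>x acts on P as zero, so congruence there is equality and
    \<open>projective_lift\<close> yields honest lifts.\<close>
  have killed: "xcong (?P j) x u v \<longleftrightarrow> u = v" if "u \<in> carrier (P j)" "v \<in> carrier (P j)" for j u v
    using xcong_killed[OF PQ x, of j u v] over_base_killed[OF P.modX[of j]] that xcong_refl[OF PQ x, of u j] by auto
  have zeroX: "\<zero>\<^bsub>X j\<^esub> \<in> carrier (X j)" for j
    using submodule_zero[OF Module.module.carrier_is_submodule[OF X]] .
  have "\<exists>D. D \<in> mod_hom Q (X j) (X (j - 1)) \<and> (\<forall>u\<in>carrier (X j). d j (p j u) = p (j - 1) (D u))" for j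
  proof -
    have "\<exists>z\<in>carrier (X (j - 1)). xcong (?P (j - 1)) x (d j (p j u)) (p (j - 1) z)" if u: "u \<in> carrier (X j)" for u
      using p_surj[OF mod_hom_closed[OF P.D pc[OF u]]] killed[OF mod_hom_closed[OF P.D pc[OF u]]] pc by metis
    then obtain g where g: "g \<in> mod_hom Q (X j) (X (j - 1))"
        "\<And>u. u \<in> carrier (X j) \<Longrightarrow> xcong (?P (j - 1)) x (d j (p j u)) (p (j - 1) (g u))"
      using projective_lift[OF X PQ X x projX mod_hom_comp[OF dQ p] p] by metis
    then show ?thesis
      using killed[OF mod_hom_closed[OF P.D pc] pc[OF mod_hom_closed[OF g(1)]]] by blast
  qed
  then obtain D where D: "\<And>j. D j \<in> mod_hom Q (X j) (X (j - 1))"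
    and pD: "\<And>j u. u \<in> carrier (X j) \<Longrightarrow> d j (p j u) = p (j - 1) (D j u)" by metis
  have D': "D (j + 1) \<in> mod_hom Q (X (j + 1)) (X j)" for j using D[of "j + 1"] by simp
  have pD': "d (j + 1) (p (j + 1) u) = p j (D (j + 1) u)" if "u \<in> carrier (X (j + 1))" for j u
    using pD[OF that] by simp
  \<comment> \<open>The dictionary that carries exactness from P to X.\<close>
  have p_eq: "xcong (X j) x u v \<longleftrightarrow> p j u = p j v" if uv: "u \<in> carrier (X j)" "v \<in> carrier (X j)" for j u v
  proof
    interpret Xj: Module.module Q "X j" by (rule X)
    assume "p j u = p j v"
    then have "p j (u \<ominus>\<^bsub>X j\<^esub> v) = \<zero>\<^bsub>P j\<^esub>"
      by (simp only: mod_hom_minus[OF X PQ p uv] over_base_diff_self[OF P.modX pc[OF uv(2)]])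
    then have "xcong (X j) x (u \<ominus>\<^bsub>X j\<^esub> v) \<zero>\<^bsub>X j\<^esub>" using uv by (intro p_ker) auto
    then have "xcong (X j) x ((u \<ominus>\<^bsub>X j\<^esub> v) \<oplus>\<^bsub>X j\<^esub> v) (\<zero>\<^bsub>X j\<^esub> \<oplus>\<^bsub>X j\<^esub> v)"
      using uv by (intro xcong_add[OF X x] xcong_refl[OF X x]) auto
    then show "xcong (X j) x u v" using uv by (simp add: Xj.M.minus_add_cancel)
  next
    assume "xcong (X j) x u v"
    then have "xcong (?P j) x (p j u) (p j v)" by (rule xcong_hom[OF X x PQ p _ uv(2)])
    then show "p j u = p j v" using killed pc uv by blast
  qed
  have bd: "(\<exists>v\<in>carrier (P (j + 1)). xcong (P j) \<zero>\<^bsub>R\<^esub> (p j u) (d (j + 1) v)) \<longleftrightarrow>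
      (\<exists>v\<in>carrier (X (j + 1)). xcong (X j) x u (D (j + 1) v))" if u: "u \<in> carrier (X j)" for j u
  proof
    assume "\<exists>v\<in>carrier (P (j + 1)). xcong (P j) \<zero>\<^bsub>R\<^esub> (p j u) (d (j + 1) v)"
    then obtain v where v: "v \<in> carrier (P (j + 1))" "p j u = d (j + 1) v"
      using xcong_zero_iff[OF P.modX mod_hom_closed[OF P.D']] by blast
    obtain w where w: "w \<in> carrier (X (j + 1))" "p (j + 1) w = v" using p_surj[OF v(1)] by blast
    then show "\<exists>v\<in>carrier (X (j + 1)). xcong (X j) x u (D (j + 1) v)"
      using p_eq[OF u mod_hom_closed[OF D' w(1)]] v(2) pD'[OF w(1)] by auto
  next
    assume "\<exists>v\<in>carrier (X (j + 1)). xcong (X j) x u (D (j + 1) v)"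
    then obtain v where v: "v \<in> carrier (X (j + 1))" "xcong (X j) x u (D (j + 1) v)" by blast
    then have "p j u = d (j + 1) (p (j + 1) v)"
      using p_eq[OF u mod_hom_closed[OF D' v(1)]] pD'[OF v(1)] by simp
    then show "\<exists>v\<in>carrier (P (j + 1)). xcong (P j) \<zero>\<^bsub>R\<^esub> (p j u) (d (j + 1) v)"
      using pc[OF v(1)] xcong_zero_iff[OF P.modX mod_hom_closed[OF P.D' pc[OF v(1)]]] by blast
  qed
  have \<epsilon>Q: "\<epsilon> \<in> mod_hom Q (?P 0) ?M" by (rule mod_hom_over_base[OF P.\<epsilon>])
  have res: "xresolution Q ?M x X D (\<lambda>u. \<epsilon> (p 0 u))"
  proof (rule xresolution.intro[OF MQ x X projX trivX D mod_hom_comp[OF \<epsilon>Q p]])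
    show "\<exists>u\<in>carrier (X 0). \<epsilon> (p 0 u) = m" if m: "m \<in> carrier ?M" for m
      using P.\<epsilon>_surj[of m] p_surj m by (simp, metis)
    show "\<epsilon> (p 0 u) = \<zero>\<^bsub>?M\<^esub> \<longleftrightarrow> (\<exists>v\<in>carrier (X 1). xcong (X 0) x u (D 1 v))" if u: "u \<in> carrier (X 0)" for u
      using P.exact0[OF pc[OF u]] bd[OF u] by simp
    show "xcong (X (j - 1)) x (D j u) \<zero>\<^bsub>X (j - 1)\<^esub> \<longleftrightarrow> (\<exists>v\<in>carrier (X (j + 1)). xcong (X j) x u (D (j + 1) v))"
      if j: "0 < j" and u: "u \<in> carrier (X j)" for j u
    proof -
      have "xcong (X (j - 1)) x (D j u) \<zero>\<^bsub>X (j - 1)\<^esub> \<longleftrightarrow> d j (p j u) = \<zero>\<^bsub>P (j - 1)\<^esub>"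
        using p_eq[OF mod_hom_closed[OF D u] zeroX] pD[OF u] mod_hom_zero[OF X PQ p] by simp
      also have "\<dots> \<longleftrightarrow> xcong (P (j - 1)) \<zero>\<^bsub>R\<^esub> (d j (p j u)) \<zero>\<^bsub>P (j - 1)\<^esub>"
        by (simp add: xcong_zero_iff[OF P.modX PP.M.zero_closed])
      finally show ?thesis using P.exact_pos[OF j pc[OF u]] bd[OF u] by simp
    qed
  qed
  interpret X: xresolution Q ?M x X D "\<lambda>u. \<epsilon> (p 0 u)" by (rule res)
  have "\<exists>\<tau>. \<tau> \<in> mod_hom Q (tensor Q (X j) ?N) (over_base Q x (tensor R (P j) N)) \<and>
     (\<forall>u\<in>carrier (X j). \<forall>v\<in>carrier N. \<tau> (pure_tensor Q (X j) ?N u v) = pure_tensor R (P j) N (p j u) v) \<and>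
     bij_betw \<tau> (carrier (tensor Q (X j) ?N)) (carrier (tensor R (P j) N))" for j
    by (rule tensor_reduction[OF X P.modX N p p_surj p_ker]) blast+
  then obtain \<tau> where \<tau>: "\<And>j. \<tau> j \<in> mod_hom Q (tensor Q (X j) ?N) (over_base Q x (tensor R (P j) N))"
    and \<tau>p: "\<And>j u v. u \<in> carrier (X j) \<Longrightarrow> v \<in> carrier N \<Longrightarrow> \<tau> j (pure_tensor Q (X j) ?N u v) = pure_tensor R (P j) N (p j u) v"
    and bij: "\<And>j. bij_betw (\<tau> j) (carrier (tensor Q (X j) ?N)) (carrier (tensor R (P j) N))" by metis
  have modT: "Module.module R (tensor R (P j) N)" for j by (rule P.module_TX[OF N N0])
  have modTQ: "Module.module Q (over_base Q x (tensor R (P j) N))" for j by (rule module_over_base[OF modT])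
  note xN = over_base_killed[OF N]
  have comm: "\<tau> (j - 1) (tensor_map Q (X (j - 1)) ?N (D j) t) = tensor_map R (P (j - 1)) N (d j) (\<tau> j t)"
    if t: "t \<in> carrier (tensor Q (X j) ?N)" for j t
  proof -
    interpret A: tensor_prod Q "X j" ?N by (rule tensor_prodI[OF X NQ])
    show ?thesis
      by (rule A.tensor_hom_eq[OF modTQ mod_hom_comp[OF \<tau> X.TD[OF NQ xN]]
            mod_hom_comp[OF mod_hom_over_base[OF P.TD[OF N N0]] \<tau>] _ t])
        (simp add: tensor_map_pure[OF X X NQ D] \<tau>p mod_hom_closed[OF D] pc
          tensor_map_pure[OF P.modX P.modX N P.D] pD)
  qed
  have \<tau>0: "\<tau> j t = \<zero>\<^bsub>tensor R (P j) N\<^esub> \<longleftrightarrow> t = \<zero>\<^bsub>tensor Q (X j) ?N\<^esub>" if t: "t \<in> carrier (tensor Q (X j) ?N)" for j t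
  proof -
    have z: "\<zero>\<^bsub>tensor Q (X j) ?N\<^esub> \<in> carrier (tensor Q (X j) ?N)"
      using submodule_zero[OF Module.module.carrier_is_submodule[OF X.module_TX[OF NQ xN]]] .
    have "\<tau> j \<zero>\<^bsub>tensor Q (X j) ?N\<^esub> = \<zero>\<^bsub>tensor R (P j) N\<^esub>"
      using mod_hom_zero[OF X.module_TX[OF NQ xN] modTQ \<tau>] by simp
    then show ?thesis using bij[of j] t z by (auto simp: bij_betw_def inj_on_def)
  qed
  have "P.hlength N j = X.hlength ?N j" for j
  proof -
    have \<tau>cl: "\<tau> i t \<in> carrier (tensor R (P i) N)" if "t \<in> carrier (tensor Q (X i) ?N)" for i t
      using mod_hom_closed[OF \<tau> that] by simp
    have TDcl: "tensor_map Q (X (j - 1)) ?N (D j) t \<in> carrier (tensor Q (X (j - 1)) ?N)"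
      if "t \<in> carrier (tensor Q (X j) ?N)" for t by (rule mod_hom_closed[OF X.TD[OF NQ xN] that])
    have cyc: "\<tau> j t \<in> P.cycles N j \<longleftrightarrow> t \<in> X.cycles ?N j" if t: "t \<in> carrier (tensor Q (X j) ?N)" for t
      using t \<tau>cl[OF t] comm[OF t, symmetric] \<tau>0[OF TDcl[OF t]] by (simp add: P.cycles_def X.cycles_def)
    have surj: "\<exists>t\<in>carrier (tensor Q (X i) ?N). \<tau> i t = w" if "w \<in> carrier (tensor R (P i) N)" for i w
      using bij_betw_imp_surj_on[OF bij[of i]] that by (metis imageE)
    have bdr: "\<tau> j t \<in> P.boundaries N j \<longleftrightarrow> t \<in> X.boundaries ?N j" if t: "t \<in> carrier (tensor Q (X j) ?N)" for t
    proof
      assume "t \<in> X.boundaries ?N j"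
      then obtain s where s: "s \<in> carrier (tensor Q (X (j + 1)) ?N)" "t = tensor_map Q (X j) ?N (D (j + 1)) s"
        by (auto simp: X.boundaries_def)
      then show "\<tau> j t \<in> P.boundaries N j"
        using comm[OF s(1)] \<tau>cl[OF s(1)] by (auto simp: P.boundaries_def)
    next
      assume "\<tau> j t \<in> P.boundaries N j"
      then obtain w where w: "w \<in> carrier (tensor R (P (j + 1)) N)" "\<tau> j t = tensor_map R (P j) N (d (j + 1)) w"
        by (auto simp: P.boundaries_def)
      obtain s where s: "s \<in> carrier (tensor Q (X (j + 1)) ?N)" "\<tau> (j + 1) s = w" using surj[OF w(1)] by blast
      have "\<tau> j t = \<tau> j (tensor_map Q (X j) ?N (D (j + 1)) s)" using w s comm[OF s(1)] by simp
      moreover have "tensor_map Q (X j) ?N (D (j + 1)) s \<in> carrier (tensor Q (X j) ?N)"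
        by (rule mod_hom_closed[OF X.TD'[OF NQ xN] s(1)])
      ultimately have "t = tensor_map Q (X j) ?N (D (j + 1)) s" using bij[of j] t by (auto simp: bij_betw_def inj_on_def)
      then show "t \<in> X.boundaries ?N j" using s(1) by (auto simp: X.boundaries_def)
    qed
    note cX = subsetD[OF submodule_subset[OF X.submodule_cycles[OF NQ xN]]]
    have subs: "submodule (P.boundaries N j) Q (over_base Q x (tensor R (P j) N))"
        "submodule (P.cycles N j) Q (over_base Q x (tensor R (P j) N))"
      unfolding submodule_over_base[OF modT]
      using P.submodule_boundaries[OF N N0] P.submodule_cycles[OF N N0] by auto
    have "X.hlength ?N j = rel_length Q (over_base Q x (tensor R (P j) N)) (P.boundaries N j) (P.cycles N j)"
      unfolding X.hlength_def
    proof (rule rel_length_hom[OF X.module_TX[OF NQ xN] modTQ X.submodule_boundaries[OF NQ xN]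
          X.submodule_cycles[OF NQ xN] X.boundaries_subset_cycles[OF NQ xN] subs P.boundaries_subset_cycles[OF N N0],
          where f = "\<tau> j"])
      fix w assume w: "w \<in> P.cycles N j"
      then have wc: "w \<in> carrier (tensor R (P j) N)" using submodule_subset[OF subs(2)] by auto
      obtain t where t: "t \<in> carrier (tensor Q (X j) ?N)" "\<tau> j t = w" using surj[OF wc] by blast
      have "w \<ominus>\<^bsub>over_base Q x (tensor R (P j) N)\<^esub> w \<in> P.boundaries N j"
        using submodule_zero[OF subs(1)] over_base_diff_self[OF modT wc] by simp
      then show "\<exists>z\<in>X.cycles ?N j. w \<ominus>\<^bsub>over_base Q x (tensor R (P j) N)\<^esub> \<tau> j z \<in> P.boundaries N j"
        using t w cyc[OF t(1)] by (intro bexI[of _ t]) auto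
    qed (use cX cyc bdr mod_hom_add[OF \<tau>] mod_hom_smult[OF \<tau>] in auto)
    then show ?thesis by (simp add: P.hlength_def rel_length_over_base[OF modT])
  qed
  then show thesis using that[OF res] by blast
qed

end

section \<open>Assembly: Tor over the quotient ring through G, Tor over Q through F\<close>

theorem theorem4p7:
  fixes Q :: "('q, 'z) ring_scheme"
    and \<nn> :: "'q set"
    and x :: 'q
    and R :: "'q set ring"
    and M :: "('q set, 'm) module"
    and N :: "('q set, 'n) module"
    and n :: nat
  assumes "noetherian_local_ring Q \<nn>"
    and "x \<in> \<nn>"
    and "non_zerodivisor Q x"
    and "R = Q Quot (PIdl\<^bsub>Q\<^esub> x)"
    and "Module.module R M"
    and "finitely_generated R M"
    and "carrier M \<noteq> {\<zero>\<^bsub>M\<^esub>}"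
    and "Module.module R N"
    and "pre_rigid TYPE('f) 0 Q x M N"
    and "finite_length R (Tor R (int n) M N)"
  shows "(\<forall>i::nat. finite_length Q
             (Tor Q (int n - 2 * int i) (over_base Q x M) (over_base Q x N))) \<and>
         module_length R (Tor R (int n) M N)
           = (\<Sum>i::nat. module_length Q
                (Tor Q (int n - 2 * int i) (over_base Q x M) (over_base Q x N)))"
proof -
  interpret L: noetherian_local_ring Q \<nn> by fact
  have xQ: "x \<in> carrier Q" using assms(3) by (simp add: non_zerodivisor_def)
  interpret q: quotient_ring Q x by unfold_locales (rule xQ)
  let ?M = "over_base Q x M" and ?N = "over_base Q x N"
  have M: "Module.module R M" and N: "Module.module R N" by fact+
  have MQ: "Module.module Q ?M" and NQ: "Module.module Q ?N"
    using q.module_over_base M N unfolding assms(4) by auto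
  have xM: "\<forall>v\<in>carrier ?M. x \<odot>\<^bsub>?M\<^esub> v = \<zero>\<^bsub>?M\<^esub>" and xN: "\<forall>v\<in>carrier ?N. x \<odot>\<^bsub>?N\<^esub> v = \<zero>\<^bsub>?N\<^esub>"
    using q.over_base_killed M N unfolding assms(4) by auto
  have zN: "\<forall>v\<in>carrier N. \<zero>\<^bsub>R\<^esub> \<odot>\<^bsub>N\<^esub> v = \<zero>\<^bsub>N\<^esub>" using Module.module.smult_l_null[OF N] by auto
  have zNQ: "\<forall>v\<in>carrier ?N. \<zero>\<^bsub>Q\<^esub> \<odot>\<^bsub>?N\<^esub> v = \<zero>\<^bsub>?N\<^esub>" using Module.module.smult_l_null[OF NQ] by auto
  obtain F :: "int \<Rightarrow> ('q, 'f) module" and d \<epsilon> \<sigma> where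
    F: "free_resolution Q F d \<epsilon> ?M" and \<sigma>: "higher_homotopies Q x F d \<sigma>" and
    rigid: "\<And>i j t. 1 \<le> i \<Longrightarrow> j > 0 - (2 * int i - 1) \<Longrightarrow> t \<in> carrier (tensor Q (F j) ?N) \<Longrightarrow>
      tensor_map Q (F (j + (2 * int i - 1))) ?N (\<sigma> i j) t = \<zero>\<^bsub>tensor Q (F (j + (2 * int i - 1))) ?N\<^esub>"
    using assms(9) unfolding pre_rigid_def by blast
  interpret H: homotopy_resolution Q x ?M F d \<epsilon> \<sigma>
    by (rule homotopy_resolution.intro[OF MQ xM assms(3) F \<sigma>])
  interpret H: rigid_homotopy_resolution Q x ?M F d \<epsilon> \<sigma> ?N
  proof (intro rigid_homotopy_resolution.intro rigid_homotopy_resolution_axioms.intro H.homotopy_resolution_axioms)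
    fix i :: nat and j t assume i: "1 \<le> i" and t: "t \<in> carrier (tensor Q (F j) ?N)"
    have \<sigma>h: "\<sigma> i j \<in> mod_hom Q (F j) (F (j + (2 * int i - 1)))"
      using \<sigma> unfolding higher_homotopies_def by blast
    show "tensor_map Q (F (j + (2 * int i - 1))) ?N (\<sigma> i j) t = \<zero>\<^bsub>tensor Q (F (j + (2 * int i - 1))) ?N\<^esub>"
    \<comment> \<open>Pre-rigidity of degree 0 covers all j > 1 - 2 i, hence every j \<ge> 0; for j
      < 0 the module F j is zero.\<close>
    proof (cases "j < 0")
      case True
      show ?thesis
        by (rule tensor_map_zero[OF H.modF H.modF NQ \<sigma>h t])
          (use H.F.trivX[OF True] mod_hom_zero[OF H.modF H.modF \<sigma>h] in auto)
    next
      case False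
      then show ?thesis using i by (intro rigid[OF i _ t]) auto
    qed
  qed (use NQ xN in auto)
  have SR: "xresolution R M \<zero>\<^bsub>R\<^esub> (std_mod R M) (std_diff R M) (std_aug R M)" by (rule std_resolution[OF M])
  have SQ: "xresolution Q ?M \<zero>\<^bsub>Q\<^esub> (std_mod Q ?M) (std_diff Q ?M) (std_aug Q ?M)" by (rule std_resolution[OF MQ])
  \<comment> \<open>The bases of the standard resolution over the quotient ring; the free Q-modules
    on the same sets are its lift.\<close>
  define B where "B j = (if j < 0 then {} else std_basis R M (nat j))" for j
  have std: "std_mod R M j = free_mod R (B j)" for j by (simp add: std_mod_def B_def)
  note red = q.reduce_hom q.reduce_surj q.reduce_kernel
  obtain D where D: "xresolution Q ?M x (\<lambda>j. free_mod Q (B j)) D (\<lambda>u. std_aug R M (q.reduce u))"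
    and len: "\<And>j. xresolution.hlength R (std_mod R M) (std_diff R M) N j
      = xresolution.hlength Q (\<lambda>j. free_mod Q (B j)) D ?N j"
  proof (rule q.lift_resolution[OF SR[unfolded assms(4)] N[unfolded assms(4)],
        where X = "\<lambda>j. free_mod Q (B j)" and p = "\<lambda>j. q.reduce"])
    show "carrier (free_mod Q (B j)) = {\<zero>\<^bsub>free_mod Q (B j)\<^esub>}" if "j < 0" for j
      using that by (auto simp: B_def free_mod_sel supp_def fun_eq_iff)
  qed (use red module_free_mod[OF L.is_cring] projective_free_mod[OF L.is_cring] std in \<open>auto simp: assms(4)\<close>)
  have "module_length R (Tor R (int n) M N) = xresolution.hlength R (std_mod R M) (std_diff R M) N (int n)"
    unfolding Tor_def by (rule xresolution.module_length_homology[OF SR N zN])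
  also have "\<dots> = xresolution.hlength Q (\<lambda>j. free_mod Q (B j)) D ?N (int n)" by (rule len)
  also have "\<dots> = H.G.hlength ?N (int n)"
    by (rule hlength_unique[OF D H.G.xresolution_axioms NQ xN])
  also have "\<dots> = (\<Sum>i. H.F.hlength ?N (int n - 2 * int i))" by (rule H.hlength_sum)
  \<comment> \<open>The case x = 0 of \<open>hlength_unique\<close>, comparing F with the standard
    resolution over Q.\<close>
  also have "(\<lambda>i. H.F.hlength ?N (int n - 2 * int i)) = (\<lambda>i. module_length Q (Tor Q (int n - 2 * int i) ?M ?N))"
    unfolding Tor_def xresolution.module_length_homology[OF SQ NQ zNQ]
    by (rule ext) (rule hlength_unique[OF H.F.xresolution_axioms SQ NQ zNQ])
  finally have eq: "module_length R (Tor R (int n) M N)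
      = (\<Sum>i. module_length Q (Tor Q (int n - 2 * int i) ?M ?N))" .
  \<comment> \<open>Each summand is bounded by the whole sum, which is finite by the formula just
    proved.\<close>
  have "finite_length Q (Tor Q (int n - 2 * int i) ?M ?N)" for i
  proof -
    have "module_length Q (Tor Q (int n - 2 * int i) ?M ?N)
        \<le> (\<Sum>i. module_length Q (Tor Q (int n - 2 * int i) ?M ?N))"
      using sum_le_suminf[of "\<lambda>i. module_length Q (Tor Q (int n - 2 * int i) ?M ?N)" "{i}"] by (simp add: summableI)
    then show ?thesis using assms(10) eq by (auto simp: finite_length_def dest: enat_ile)
  qed
  then show ?thesis using eq by blast
qed

end
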